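(* All periodic points of $\mathfrak{g}(z)$ in $\overline{\mathbb{Q}}_5$ lie in $\mathsf{K}_5(\sqrt5)$. For each $n\ge1$, the periodic points of $\mathfrak{g}(z)$ of minimal period $n$ coincide with the roots of $\mathsf{P}_n(x)$, and they have degree $n$ over $\mathbb{Q}_5(\sqrt5)$. For $n>1$, exactly half of the periodic points of $\mathfrak{g}(z)$ of minimal period $n$ lie in $\mathsf{K}_5$.
   Context: Let $g(x,y)=(y^4+2y^3+4y^2+3y+1)x^5-y(y^4-3y^3+4y^2-2y+1)$ and $\mathfrak{g}(z)$ the multi-valued function defined by $g(z,\mathfrak{g}(z))=0$. An element $a\in\overline{\mathbb{Q}}_5$ is a periodic point of $\mathfrak{g}$ if there exist $n\ge1$ and $a_1,\dots,a_{n-1}\in\overline{\mathbb{Q}}_5$ with $g(a,a_1)=g(a_1,a_2)=\cdots=g(a_{n-1},a)=0$; the least such $n$ is its minimal period. Define $R^{(1)}(x,x_1)=g(x,x_1)$, $R^{(n)}(x,x_n)=\mathrm{Res}_{x_{n-1}}\big(R^{(n-1)}(x,x_{n-1}),g(x_{n-1},x_n)\big)$ for $n\ge2$, $R_n(x)=R^{(n)}(x,x)$, and $\mathsf{P}_n(x)=\prod_{k\mid n}R_k(x)^{\mu(n/k)}$ ($\mu$ the Möbius function; a priori a rational function). $\mathsf{K}_5$ is the maximal unramified algebraic extension of $\mathbb{Q}_5$. *)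

theory Defs
  imports
    "HOL-Algebra.Algebraic_Closure_Type"
    "HOL-Algebra.Generated_Fields"
    "HOL-Computational_Algebra.Squarefree"
    "Subresultants.Resultant_Prelim"
begin

section \<open>The ring \<open>\<int>\<^sub>5\<close>\<close>

text \<open>
  \<open>\<int>\<^sub>5\<close> is the inverse limit of the rings \<open>\<int>/5\<^sup>n\<close>. The condition
  \<open>f n = f (Suc n) mod 5 ^ n\<close> says both that the sequence is coherent and that \<open>f n\<close>
  is the representative in \<open>{0..<5 ^ n}\<close>.
\<close>

typedef z5 = "{f :: nat \<Rightarrow> int. \<forall>n. f n = f (Suc n) mod 5 ^ n}"
  morphisms z5_res Abs_z5
  by (rule exI[of _ "\<lambda>_. 0"]) simp

setup_lifting type_definition_z5

lemma z5_eqI: "(\<And>n. z5_res x n = z5_res y n) \<Longrightarrow> x = y"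
  by (simp add: z5_res_inject[symmetric] fun_eq_iff)

lemma z5_res_step: "z5_res x n = z5_res x (Suc n) mod 5 ^ n"
  using z5_res[of x] by blast

lemma z5_res_mod_self [simp]: "z5_res x n mod 5 ^ n = z5_res x n"
  by (subst (1 2) z5_res_step) (rule mod_mod_trivial)

lemma mod_pow5_Suc: "(a :: int) mod 5 ^ Suc n mod 5 ^ n = a mod 5 ^ n"
  by (rule mod_mod_cancel) simp

instantiation z5 :: comm_ring_1
begin

lift_definition zero_z5 :: z5 is "\<lambda>n. 0" by simp

lift_definition one_z5 :: z5 is "\<lambda>n. 1 mod 5 ^ n"
  by (simp only: mod_pow5_Suc simp_thms)

lift_definition plus_z5 :: "z5 \<Rightarrow> z5 \<Rightarrow> z5" is "\<lambda>f g n. (f n + g n) mod 5 ^ n"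
proof -
  fix f g :: "nat \<Rightarrow> int" and n
  assume f: "\<And>n. f n = f (Suc n) mod 5 ^ n" and g: "\<And>n. g n = g (Suc n) mod 5 ^ n"
  have "(f n + g n) mod 5 ^ n = ((f (Suc n) mod 5 ^ n) + (g (Suc n) mod 5 ^ n)) mod 5 ^ n"
    by (subst f[of n], subst g[of n], rule refl)
  thus "(f n + g n) mod 5 ^ n = (f (Suc n) + g (Suc n)) mod 5 ^ Suc n mod 5 ^ n"
    by (simp only: mod_pow5_Suc mod_add_eq)
qed

lift_definition uminus_z5 :: "z5 \<Rightarrow> z5" is "\<lambda>f n. (- f n) mod 5 ^ n"
proof -
  fix f :: "nat \<Rightarrow> int" and n
  assume f: "\<And>n. f n = f (Suc n) mod 5 ^ n"
  have "(- f n) mod 5 ^ n = (- (f (Suc n) mod 5 ^ n)) mod 5 ^ n"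
    by (subst f[of n], rule refl)
  thus "(- f n) mod 5 ^ n = (- f (Suc n)) mod 5 ^ Suc n mod 5 ^ n"
    by (simp only: mod_pow5_Suc mod_minus_eq)
qed

lift_definition minus_z5 :: "z5 \<Rightarrow> z5 \<Rightarrow> z5" is "\<lambda>f g n. (f n - g n) mod 5 ^ n"
proof -
  fix f g :: "nat \<Rightarrow> int" and n
  assume f: "\<And>n. f n = f (Suc n) mod 5 ^ n" and g: "\<And>n. g n = g (Suc n) mod 5 ^ n"
  have "(f n - g n) mod 5 ^ n = ((f (Suc n) mod 5 ^ n) - (g (Suc n) mod 5 ^ n)) mod 5 ^ n"
    by (subst f[of n], subst g[of n], rule refl)
  thus "(f n - g n) mod 5 ^ n = (f (Suc n) - g (Suc n)) mod 5 ^ Suc n mod 5 ^ n"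
    by (simp only: mod_pow5_Suc mod_diff_eq)
qed

lift_definition times_z5 :: "z5 \<Rightarrow> z5 \<Rightarrow> z5" is "\<lambda>f g n. (f n * g n) mod 5 ^ n"
proof -
  fix f g :: "nat \<Rightarrow> int" and n
  assume f: "\<And>n. f n = f (Suc n) mod 5 ^ n" and g: "\<And>n. g n = g (Suc n) mod 5 ^ n"
  have "(f n * g n) mod 5 ^ n = ((f (Suc n) mod 5 ^ n) * (g (Suc n) mod 5 ^ n)) mod 5 ^ n"
    by (subst f[of n], subst g[of n], rule refl)
  thus "(f n * g n) mod 5 ^ n = (f (Suc n) * g (Suc n)) mod 5 ^ Suc n mod 5 ^ n"
    by (simp only: mod_pow5_Suc mod_mult_eq)
qed

lemmas z5_ops =
  zero_z5.rep_eq one_z5.rep_eq plus_z5.rep_eq uminus_z5.rep_eq minus_z5.rep_eq times_z5.rep_eq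

instance
proof
  fix a b c :: z5
  show "a * b * c = a * (b * c)"
    by (rule z5_eqI) (simp add: z5_ops mod_mult_left_eq mod_mult_right_eq mult.assoc)
  show "a * b = b * a"
    by (rule z5_eqI) (simp add: z5_ops mult.commute)
  show "1 * a = a"
    by (rule z5_eqI) (simp add: times_z5.rep_eq one_z5.rep_eq mod_mult_left_eq)
  show "a + b + c = a + (b + c)"
    by (rule z5_eqI) (simp add: z5_ops mod_add_left_eq mod_add_right_eq add.assoc)
  show "a + b = b + a"
    by (rule z5_eqI) (simp add: z5_ops add.commute)
  show "0 + a = a"
    by (rule z5_eqI) (simp add: plus_z5.rep_eq zero_z5.rep_eq)
  show "- a + a = 0"
    by (rule z5_eqI) (simp add: z5_ops mod_add_left_eq)
  show "a - b = a + - b"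
    by (rule z5_eqI) (simp add: z5_ops mod_add_right_eq)
  show "(a + b) * c = a * c + b * c"
    by (rule z5_eqI) (simp add: z5_ops mod_mult_left_eq mod_add_eq distrib_right)
  show "(0 :: z5) \<noteq> 1"
  proof
    assume "(0 :: z5) = 1"
    hence "z5_res 0 1 = z5_res 1 1" by simp
    thus False by (simp add: zero_z5.rep_eq one_z5.rep_eq)
  qed
qed

end

lemma z5_res_mod: "z5_res x (m + k) mod 5 ^ m = z5_res x m"
proof (induction k)
  case 0
  show ?case by simp
next
  case (Suc k)
  have "z5_res x (m + k) = z5_res x (Suc (m + k)) mod 5 ^ (m + k)" by (rule z5_res_step)
  hence "z5_res x (m + k) mod 5 ^ m = z5_res x (Suc (m + k)) mod 5 ^ m"
    by (simp add: mod_mod_cancel le_imp_power_dvd)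
  with Suc show ?case by simp
qed

lemma pow5_dvd_mult:
  fixes a b :: int
  assumes "\<not> 5 ^ m dvd a" "\<not> 5 ^ n dvd b"
  shows "\<not> 5 ^ (m + n) dvd a * b"
proof -
  have [simp]: "prime (5 :: int)" by simp
  have ab: "a \<noteq> 0" "b \<noteq> 0" using assms by auto
  have "multiplicity 5 a < m" "multiplicity 5 b < n"
    using assms ab by (simp_all add: power_dvd_iff_le_multiplicity)
  moreover have "multiplicity 5 (a * b) = multiplicity 5 a + multiplicity 5 b"
    using ab by (intro prime_elem_multiplicity_mult_distrib) auto
  ultimately show ?thesis
    using ab by (simp add: power_dvd_iff_le_multiplicity)
qed

instance z5 :: idom
proof
  fix a b :: z5
  assume "a \<noteq> 0" "b \<noteq> 0"
  then obtain m n where mn: "z5_res a m \<noteq> 0" "z5_res b n \<noteq> 0"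
    using z5_eqI[of a 0] z5_eqI[of b 0] by (auto simp: z5_ops)
  have "\<not> 5 ^ m dvd z5_res a (m + n)"
    using mn z5_res_mod[of a m n] by (auto simp: dvd_eq_mod_eq_0)
  moreover have "\<not> 5 ^ n dvd z5_res b (m + n)"
    using mn z5_res_mod[of b n m] by (auto simp: dvd_eq_mod_eq_0 add.commute)
  ultimately have "z5_res (a * b) (m + n) \<noteq> 0"
    using pow5_dvd_mult by (simp add: times_z5.rep_eq dvd_eq_mod_eq_0)
  thus "a * b \<noteq> 0"
    by (auto simp: zero_z5.rep_eq)
qed


section \<open>\<open>\<rat>\<^sub>5\<close>, its algebraic closure and its maximal unramified extension\<close>

type_synonym q5 = "z5 fract"
type_synonym qbar5 = "q5 alg_closure"

abbreviation qbar5_ring :: "qbar5 ring" where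
  "qbar5_ring \<equiv> ring_of_type_algebra"

definition Q5 :: "qbar5 set" where
  "Q5 = range to_ac"

definition field_adjoin :: "qbar5 set \<Rightarrow> qbar5 \<Rightarrow> qbar5 set" where
  "field_adjoin F a = generate_field qbar5_ring (insert a F)"

definition has_degree_over :: "qbar5 set \<Rightarrow> qbar5 \<Rightarrow> nat \<Rightarrow> bool" where
  "has_degree_over F a n \<longleftrightarrow> ring.dimension qbar5_ring n F (field_adjoin F a)"

definition integral_over_z5 :: "qbar5 \<Rightarrow> bool" where
  "integral_over_z5 a \<longleftrightarrow>
     (\<exists>p :: z5 poly. Polynomial.lead_coeff p = 1 \<and> poly (map_poly (\<lambda>c. to_ac (Fract c 1)) p) a = 0)"

definition ring_of_integers :: "qbar5 set \<Rightarrow> qbar5 set" where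
  "ring_of_integers L = {a \<in> L. integral_over_z5 a}"

text \<open>
  A finite extension \<open>L\<close> of \<open>\<rat>\<^sub>5\<close> is unramified if 5 still generates the maximal ideal of
  its valuation ring, that is, the ideal of non-units. Separability of the residue field
  extension is automatic over the perfect field with 5 elements. Since \<open>inverse 0 = 0\<close>, the
  non-unit 0 has to be listed separately.
\<close>

definition finite_unramified :: "qbar5 set \<Rightarrow> bool" where
  "finite_unramified L \<longleftrightarrow>
     subfield L qbar5_ring \<and> Q5 \<subseteq> L \<and> ring.finite_dimension qbar5_ring Q5 L \<and>
     {a \<in> ring_of_integers L. a = 0 \<or> inverse a \<notin> ring_of_integers L} =
       (\<lambda>b. 5 * b) ` ring_of_integers L"

text \<open>The maximal unramified algebraic extension is the compositum of the finite ones.\<close>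

definition K5 :: "qbar5 set" where
  "K5 = generate_field qbar5_ring (\<Union>{L. finite_unramified L})"


section \<open>The algebraic function and its periodic points\<close>

definition g_poly :: "'a :: comm_ring_1 \<Rightarrow> 'a \<Rightarrow> 'a" where
  "g_poly x y = (y^4 + 2*y^3 + 4*y^2 + 3*y + 1) * x^5 - y * (y^4 - 3*y^3 + 4*y^2 - 2*y + 1)"

definition on_cycle :: "nat \<Rightarrow> qbar5 \<Rightarrow> bool" where
  "on_cycle n a \<longleftrightarrow> (\<exists>c :: nat \<Rightarrow> qbar5. c 0 = a \<and> c n = a \<and> (\<forall>i<n. g_poly (c i) (c (Suc i)) = 0))"

definition periodic_point :: "qbar5 \<Rightarrow> bool" where
  "periodic_point a \<longleftrightarrow> (\<exists>n\<ge>1. on_cycle n a)"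

definition minimal_period :: "qbar5 \<Rightarrow> nat" where
  "minimal_period a = (LEAST n. n \<ge> 1 \<and> on_cycle n a)"

definition points_of_period :: "nat \<Rightarrow> qbar5 set" where
  "points_of_period n = {a. periodic_point a \<and> minimal_period a = n}"


section \<open>Iterated resultants\<close>

text \<open>
  \<open>R_iter n\<close> is \<open>R\<^sup>(\<^sup>n\<^sup>)(x, x\<^sub>n)\<close> as a polynomial in \<open>x\<^sub>n\<close> with coefficients in \<open>\<int>[x]\<close>. The
  resultant is taken in \<open>\<int>[x][x\<^sub>n][x\<^sub>n\<^sub>-\<^sub>1]\<close>: there \<open>x\<^sub>n\<^sub>-\<^sub>1\<close> is \<open>[:0, 1:]\<close>, \<open>x\<^sub>n\<close> is
  \<open>[:[:0, 1:]:]\<close>, and \<open>map_poly (\<lambda>c. [:c:])\<close> embeds \<open>\<int>[x][x\<^sub>n\<^sub>-\<^sub>1]\<close>. The value at \<open>n = 0\<close> is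
  arbitrary.
\<close>

fun R_iter :: "nat \<Rightarrow> int poly poly" where
  "R_iter 0 = 0"
| "R_iter (Suc 0) = g_poly [:[:0, 1:]:] [:0, 1:]"
| "R_iter (Suc (Suc n)) =
     resultant (map_poly (\<lambda>c. [:c:]) (R_iter (Suc n))) (g_poly [:0, 1:] [:[:0, 1:]:])"

definition R_diag :: "nat \<Rightarrow> int poly" where
  "R_diag n = poly (R_iter n) [:0, 1:]"

definition moebius :: "nat \<Rightarrow> int" where
  "moebius n = (if squarefree n then (-1) ^ card (prime_factors n) else 0)"

text \<open>The fraction field of \<open>\<int>[x]\<close> is \<open>\<rat>(x)\<close>.\<close>

definition P_fun :: "nat \<Rightarrow> int poly fract" where
  "P_fun n = (\<Prod>k | k dvd n. Fract (R_diag k) 1 powi moebius (n div k))"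

text \<open>A root of a rational function is a point at which it is defined and takes the value 0.\<close>

definition rational_function_roots :: "int poly fract \<Rightarrow> qbar5 set" where
  "rational_function_roots F =
     {a. \<exists>p q. F = Fract p q \<and> poly (of_int_poly q) a \<noteq> 0 \<and> poly (of_int_poly p) a = 0}"

end

theory Submission
  imports Defs "Subresultants.Subresultant_Gcd" "Jordan_Normal_Form.Char_Poly"
begin

text \<open>
  Modulo 5 one has \<open>g(x, y) = (y - 2)\<^sup>4 (x\<^sup>5 - y)\<close>, so with \<open>q = 5\<^sup>n\<close> the polynomial \<open>R\<^sub>n\<close> reduces
  to \<open>\<plusminus>(x - x\<^sup>q) (x - 2)\<^bsup>q-1\<^esup>\<close>. By Hensel's lemma in the unramified ring of degree \<open>n\<close>, every
  residue other than 2 in the field with \<open>q\<close> elements lifts to exactly one root; this gives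
  \<open>q - 1\<close> unramified roots. The involution \<open>T(x) = (2 - (1 + s) x) / (2 x + 1 + s)\<close> with \<open>s\<^sup>2 = 5\<close>
  reverses the relation \<open>g(x, y) = 0\<close>, so it maps cycles to cycles and gives \<open>q - 1\<close> further roots,
  and \<open>T(\<infinity>) = - (1 + s) / 2\<close> is one more. Since \<open>R\<^sub>n\<close> has degree at most \<open>2 q - 1\<close>, these are all
  roots and all of them are simple. The minimal period of a root is the degree of the residue
  of its unramified representative over the field with 5 elements.

  The maximal unramified extension does not contain \<open>s\<close> because the ring generated by all unramified
  rings of integers is reduced modulo 5: each of its elements is fixed modulo 5 by a power of the
  Frobenius map.
\<close>

section \<open>Resultants and linear factors\<close>

text \<open>T comes from the Rogers-Ramanujan continued fraction r: \<open>g_poly x y = 0\<close>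
  relates x = r(t) and y = r(5t), and r(-1/t) = T(r(t)), so replacing t by -1/(5t) exchanges the two
  arguments. This is why T reverses the relation. No extension of the 5-adic valuation to the
  algebraic closure is constructed. In its place stands \<open>V5\<close>, a maximal subring over
  the 5-adic integers without 1/5; its maximal ideal supplies reduction and the residue field
  \<open>rf\<close>. Uniqueness of lifts is proved in \<open>V5\<close>; existence needs
  completeness and is proved in the modules \<open>zspan\<close>, where it holds coordinatewise.
  Hensel lifting is blind at the residue 2, a root of multiplicity 5^n of the reduction; the roots
  there are supplied by T and shown to be all of them by counting alone. The count is tight because
  the top power of x_n in \<open>R_iter n\<close> has a constant coefficient, which lowers the
  degree of \<open>R_diag n\<close> from 2 * 5^n by one. The same count makes all roots simple, so
  that Moebius inversion can be applied to orders of vanishing.\<close>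

lemma coeff_int_linear_mult:
  "coeff_int ([:- r, 1:] * p) k = coeff_int p (k - 1) - r * coeff_int p k"
  for r :: "'a :: comm_ring_1"
proof (cases "k \<le> 0")
  case True
  then show ?thesis by (cases "k = 0") (auto simp: coeff_int_def)
next
  case False
  then obtain j where j: "k = int (Suc j)" using zero_less_imp_eq_int gr0_conv_Suc
    by (metis not_le)
  then have "nat k = Suc j" by simp
  with j show ?thesis by (simp add: coeff_int_def)
qed

text \<open>With integer indices the zeros outside the two bands come from \<open>coeff_int\<close>
  itself, so each band is a single formula.\<close>

lemma sylvester_mat_sub_coeff_int:
  assumes "degree p \<le> m" "degree q \<le> n" "i < m + n" "j < m + n"
  shows "sylvester_mat_sub m n p q $$ (i, j) =
    (if i < n then coeff_int p (int m + int i - int j) else coeff_int q (int i - int j))"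
  using assms
  by (auto simp: sylvester_mat_sub_index coeff_int_def nat_diff_distrib coeff_eq_0 nat_eq_iff
      intro!: arg_cong[where f = "coeff _"] coeff_eq_0)

text \<open>The rows of the Sylvester matrix are the polynomials X^i (X - r) p and X^i q. In the
  basis X^i (X - r), 1 the differences X^(i+1) q - r X^i q = X^i q (X - r) and the last row q = (X -
  r) Q + q(r) give a block triangular matrix with the smaller Sylvester matrix and the corner q(r).
  The formal degrees \<open>m\<close> and \<open>n\<close> are only upper bounds, so the formula
  survives vanishing leading coefficients and holds over any commutative ring.\<close>

lemma resultant_sub_linear_mult:
  fixes p q :: "'a :: comm_ring_1 poly"
  assumes "degree p \<le> m" "degree q \<le> n"
  shows "resultant_sub (Suc m) n ([:- r, 1:] * p) q = poly q r * resultant_sub m n p q"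
proof -
  define N where "N = m + n"
  define S where "S = sylvester_mat_sub m n p q"
  define S' where "S' = sylvester_mat_sub (Suc m) n ([:- r, 1:] * p) q"
  \<comment> \<open>Change of basis: row \<open>k\<close> holds the coefficients of X^(N-1-k) (X -
    r), the last row those of 1.\<close>
  define E where "E = mat (Suc N) (Suc N) (\<lambda>(k, j). if j = k then 1 else if j = Suc k then - r else 0)"
  \<comment> \<open>Subtracts \<open>r\<close> times the next row from each row belonging to
    \<open>q\<close> but the last.\<close>
  define U where "U = mat (Suc N) (Suc N)
    (\<lambda>(i, k). if k = i then 1 else if k = Suc i \<and> n \<le> i then - r else 0)"
  define Q where "Q = synthetic_div q r"
  define w where "w = mat 1 N (\<lambda>(i, j). coeff_int Q (int N - 1 - int j))"
  define F where "F = four_block_mat S (0\<^sub>m N 1) w (mat 1 1 (\<lambda>_. poly q r))"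
  have dims [simp]: "S \<in> carrier_mat N N" "S' \<in> carrier_mat (Suc N) (Suc N)"
      "E \<in> carrier_mat (Suc N) (Suc N)" "U \<in> carrier_mat (Suc N) (Suc N)"
      "w \<in> carrier_mat 1 N" "F \<in> carrier_mat (Suc N) (Suc N)"
    by (auto simp: S_def S'_def E_def U_def w_def F_def N_def intro!: carrier_matI)
  have degp: "degree ([:- r, 1:] * p) \<le> Suc m"
    using degree_mult_le[of "[:- r, 1:]" p] assms by simp
  have q_eq: "q = [:- r, 1:] * Q + [:poly q r:]"
    using synthetic_div_correct'[of r q] by (simp add: Q_def)
  have q_coeff: "coeff_int q k = coeff_int Q (k - 1) - r * coeff_int Q k + (if k = 0 then poly q r else 0)" for k
  proof -
    have "coeff_int q k = coeff_int ([:- r, 1:] * Q) k + coeff_int [:poly q r:] k"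
      by (subst q_eq) (simp add: coeff_int_def)
    moreover have "coeff_int [:poly q r:] k = (if k = 0 then poly q r else 0)"
      by (auto simp: coeff_int_def coeff_pCons split: nat.splits)
    ultimately show ?thesis by (simp add: coeff_int_linear_mult)
  qed
  have detE: "det E = 1"
    by (subst det_upper_triangular[of _ "Suc N"]) (auto simp: E_def diag_mat_def intro!: prod_list_neutral)
  have detU: "det U = 1"
    by (subst det_upper_triangular[of _ "Suc N"]) (auto simp: U_def diag_mat_def intro!: prod_list_neutral)
  have detF: "det F = det S * poly q r"
    unfolding F_def
    by (subst det_four_block_mat_upper_right_zero_col[of _ N]) (use dims in \<open>auto simp: det_single\<close>)
  have Findex: "F $$ (i, k) =
      (if i < n then (if k < N then coeff_int p (int m + int i - int k) else 0)
       else if i < N then (if k < N then coeff_int q (int i - int k) else 0)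
       else if k < N then coeff_int Q (int N - 1 - int k) else poly q r)"
    if "i \<le> N" "k \<le> N" for i k
    using that assms dims(1,5) unfolding F_def
    by (subst index_mat_four_block)
       (auto simp: S_def w_def N_def sylvester_mat_sub_coeff_int)
  have S'index: "S' $$ (i, k) = (if i < n then coeff_int ([:- r, 1:] * p) (1 + int m + int i - int k)
      else coeff_int q (int i - int k))"
    if "i \<le> N" "k \<le> N" for i k
    using that assms degp unfolding S'_def
    by (subst sylvester_mat_sub_coeff_int) (auto simp: N_def)
  have mult_index: "(A * B) $$ (i, j) = (\<Sum>k = 0..<Suc N. A $$ (i, k) * B $$ (k, j))"
    if "A \<in> carrier_mat (Suc N) (Suc N)" "B \<in> carrier_mat (Suc N) (Suc N)" "i \<le> N" "j \<le> N"
    for A B :: "'a mat" and i j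
    using that by (auto simp: scalar_prod_def simp del: sum.op_ivl_Suc intro!: sum.cong)
  have FE: "(F * E) $$ (i, j) = F $$ (i, j) - (if j = 0 then 0 else r * F $$ (i, j - 1))"
    if "i \<le> N" "j \<le> N" for i j
  proof -
    have "(F * E) $$ (i, j) = (\<Sum>k = 0..<Suc N. F $$ (i, k) * (if j = k then 1 else if j = Suc k then - r else 0))"
      using that by (subst mult_index[OF dims(6,3)]) (auto simp: E_def simp del: sum.op_ivl_Suc intro!: sum.cong)
    also have "\<dots> = (\<Sum>k = 0..<Suc N. (if k = j then F $$ (i, k) else 0)
        + (if k = j - 1 then if j = 0 then 0 else - (r * F $$ (i, k)) else 0))"
      by (intro sum.cong) auto
    also have "\<dots> = F $$ (i, j) - (if j = 0 then 0 else r * F $$ (i, j - 1))"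
      using that unfolding sum.distrib by (subst (1 2) sum.delta) auto
    finally show ?thesis .
  qed
  have US: "(U * S') $$ (i, j) = S' $$ (i, j) - (if n \<le> i \<and> i < N then r * S' $$ (Suc i, j) else 0)"
    if "i \<le> N" "j \<le> N" for i j
  proof -
    have "(U * S') $$ (i, j) = (\<Sum>k = 0..<Suc N. (if k = i then 1 else if k = Suc i \<and> n \<le> i then - r else 0) * S' $$ (k, j))"
      using that by (subst mult_index[OF dims(4,2)]) (auto simp: U_def simp del: sum.op_ivl_Suc intro!: sum.cong)
    also have "\<dots> = (\<Sum>k = 0..<Suc N. (if k = i then S' $$ (k, j) else 0)
        + (if k = Suc i then if n \<le> i then - (r * S' $$ (k, j)) else 0 else 0))"
      by (intro sum.cong) auto
    also have "\<dots> = S' $$ (i, j) - (if n \<le> i \<and> i < N then r * S' $$ (Suc i, j) else 0)"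
      using that unfolding sum.distrib by (subst (1 2) sum.delta) auto
    finally show ?thesis .
  qed
  have "F * E = U * S'"
  proof (rule eq_matI)
    show "dim_row (F * E) = dim_row (U * S')" "dim_col (F * E) = dim_col (U * S')"
      using carrier_matD[OF dims(6)] carrier_matD[OF dims(3)] carrier_matD[OF dims(4)]
        carrier_matD[OF dims(2)] by auto
    fix i j assume "i < dim_row (U * S')" "j < dim_col (U * S')"
    then have ij: "i \<le> N" "j \<le> N" using carrier_matD[OF dims(4)]
        carrier_matD[OF dims(2)] by auto
    have pz: "i < n \<Longrightarrow> j = 0 \<Longrightarrow> coeff_int p (1 + int m + int i - int j) = 0"
      using assms by (auto simp: coeff_int_def intro!: coeff_eq_0)
    have pN: "coeff_int p (int m + int i - int N) = 0" if "i < n"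
      using that by (auto simp: coeff_int_def N_def)
    have qN: "coeff_int q (int i - int N) = 0" if "i < N"
      using that by (auto simp: coeff_int_def N_def)
    have qz: "coeff_int q (1 + int i) = 0" if "n \<le> i"
      using that assms by (auto simp: coeff_int_def N_def intro!: coeff_eq_0)
    have Qz: "coeff_int Q (int N) = 0"
    proof (cases "degree q = 0")
      case True
      then have "Q = 0" by (simp add: Q_def synthetic_div_eq_0_iff)
      then show ?thesis by (simp add: coeff_int_def)
    next
      case False
      then have "degree Q < N" using assms by (simp add: Q_def N_def degree_synthetic_div)
      then show ?thesis by (simp add: coeff_int_def coeff_eq_0)
    qed
    show "(F * E) $$ (i, j) = (U * S') $$ (i, j)"
    proof (cases "i < n")
      case True
      then show ?thesis using ij pz pN
        by (auto simp: FE US Findex S'index coeff_int_linear_mult algebra_simps N_def of_nat_diff)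
    next
      case False
      show ?thesis
      proof (cases "i < N")
        case True
        then show ?thesis using ij False qN qz
          by (auto simp: FE US Findex S'index algebra_simps of_nat_diff)
      next
        case iN: False
        with ij have "i = N" by simp
        then show ?thesis using ij False Qz
          by (auto simp: FE US Findex S'index q_coeff algebra_simps of_nat_diff N_def)
             (auto simp: coeff_int_def)
      qed
    qed
  qed
  then have "det F * det E = det U * det S'"
    using det_mult[OF dims(6,3)] det_mult[OF dims(4,2)] by simp
  then show ?thesis
    by (simp add: detE detU detF resultant_sub_def S_def S'_def mult.commute)
qed


section \<open>The iterated resultants\<close>

declare pCons_one [simp del] R_iter.simps(3) [simp del]

text \<open>Each root strips one linear factor; what remains is the Sylvester matrix of the constant
  \<open>c\<close> against \<open>q\<close>, namely \<open>c\<close> times the identity of size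
  \<open>n\<close>.\<close>

lemma resultant_sub_linear_factors:
  fixes q :: "'a :: comm_ring_1 poly"
  assumes "degree q \<le> n"
  shows "resultant_sub (size rs) n (smult c (\<Prod>r\<in>#rs. [:- r, 1:])) q = c ^ n * (\<Prod>r\<in>#rs. poly q r)"
proof (induction rs)
  case empty
  have "sylvester_mat_sub 0 n [:c:] q = c \<cdot>\<^sub>m 1\<^sub>m n"
    by (rule eq_matI) (auto simp: sylvester_mat_sub_index)
  then show ?case by (simp add: resultant_sub_def)
next
  case (add r rs)
  have "degree (smult c (\<Prod>r\<in>#rs. [:- r, 1:])) \<le> size rs"
  proof (induction rs)
    case (add x rs)
    have "degree ([:- x, 1:] * smult c (\<Prod>r\<in>#rs. [:- r, 1:])) \<le> 1 + size rs"
      using degree_mult_le[of "[:- x, 1:]" "smult c (\<Prod>r\<in>#rs. [:- r, 1:])"] add by simp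
    then show ?case by (simp add: mult_smult_right)
  qed simp
  from resultant_sub_linear_mult[OF this assms, of r] add.IH show ?case
    by (simp add: mult_smult_right mult_ac)
qed

text \<open>The outer variable of \<open>R_iter\<close> survives, the inner one is replaced by \<open>\<alpha>\<close>.\<close>

definition spec :: "'a :: comm_ring_1 \<Rightarrow> int poly poly \<Rightarrow> 'a poly" where
  "spec \<alpha> = map_poly (\<lambda>c. poly (of_int_poly c) \<alpha>)"

lemma spec_comm_ring_hom: "comm_ring_hom (spec (\<alpha> :: 'a :: comm_ring_1))"
proof -
  interpret c: comm_ring_hom "\<lambda>c :: int poly. poly (of_int_poly c) \<alpha>"
    by unfold_locales (auto simp: of_int_poly_hom.hom_add of_int_poly_hom.hom_mult)
  interpret m: map_poly_comm_ring_hom "\<lambda>c :: int poly. poly (of_int_poly c) \<alpha>" ..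
  show ?thesis unfolding spec_def by (rule m.comm_ring_hom_axioms)
qed

interpretation spec: comm_ring_hom "spec \<alpha> :: _ \<Rightarrow> 'a :: comm_ring_1 poly" for \<alpha>
  by (rule spec_comm_ring_hom)

section \<open>The polynomial g under ring homomorphisms and specialisation\<close>

lemma g_poly_hom:
  assumes "comm_ring_hom h"
  shows "h (g_poly x y) = g_poly (h x) (h y)"
proof -
  interpret comm_ring_hom h by fact
  show ?thesis by (simp add: g_poly_def hom_distribs)
qed

lemma coeff_spec: "coeff (spec \<alpha> F) j = poly (of_int_poly (coeff F j)) \<alpha>"
  by (simp add: spec_def coeff_map_poly)

lemma spec_const [simp]: "spec \<alpha> [:c:] = [:poly (of_int_poly c) \<alpha>:]"
  by (rule poly_eqI) (simp add: coeff_spec coeff_pCons split: nat.split)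

lemma spec_x [simp]: "spec \<alpha> [:0, 1:] = [:0, 1:]"
  by (rule poly_eqI) (simp add: coeff_spec coeff_pCons split: nat.split)

lemma g_poly_const_var:
  "g_poly [:r:] [:0, 1:] = [:r^5, 3*r^5 - 1, 4*r^5 + 2, 2*r^5 - 4, r^5 + 3, -1:]"
  for r :: "'a :: comm_ring_1"
  unfolding g_poly_def by (simp add: power_numeral_reduce numeral_poly one_pCons algebra_simps)

lemma g_poly_var_const:
  "g_poly [:0, 1:] [:y:] = [:- y * (y^4 - 3*y^3 + 4*y^2 - 2*y + 1), 0, 0, 0, 0,
     y^4 + 2*y^3 + 4*y^2 + 3*y + 1:]" for y :: "'a :: comm_ring_1"
  unfolding g_poly_def by (simp add: power_numeral_reduce numeral_poly one_pCons algebra_simps)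

lemma degree_g_poly_var: "degree (g_poly [:0, 1:] [:[:0, 1:]:] :: int poly poly poly) = 5"
proof -
  have "([:0, 1:] ^ 4 + 2 * [:0, 1:] ^ 3 + 4 * [:0, 1:]\<^sup>2 + 3 * [:0, 1:] + 1 :: int poly poly) \<noteq> 0"
    by (simp add: power_numeral_reduce numeral_poly one_pCons)
  then show ?thesis unfolding g_poly_var_const by simp
qed

text \<open>A determinant of fixed size commutes with every ring homomorphism on the coefficients,
  whereas the degrees entering \<open>resultant\<close> may drop under one. Hence the formal degrees
  are fixed before specialising.\<close>

lemma R_iter_Suc_Suc_sub:
  "R_iter (Suc (Suc n)) = resultant_sub (degree (R_iter (Suc n))) 5
     (map_poly (\<lambda>c. [:c:]) (R_iter (Suc n))) (g_poly [:0, 1:] [:[:0, 1:]:])"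
  unfolding R_iter.simps resultant_sub degree_g_poly_var by (simp add: degree_map_poly)

lemma map_poly_const_prod_linear:
  "map_poly (\<lambda>c. [:c:]) (smult c (\<Prod>r\<in>#rs. [:- r, 1:])) =
     smult [:c:] (\<Prod>r\<in>#image_mset (\<lambda>r. [:r:]) rs. [:- r, 1 :: 'a poly:])"
  for c :: "'a :: comm_ring_1"
proof -
  interpret h: comm_ring_hom "\<lambda>c :: 'a. [:c:]" by unfold_locales (auto simp: one_pCons)
  interpret m: map_poly_comm_ring_hom "\<lambda>c :: 'a. [:c:]" ..
  have "map_poly (\<lambda>c. [:c:]) (\<Prod>r\<in>#rs. [:- r, 1:]) = (\<Prod>r\<in>#image_mset (\<lambda>r. [:r:]) rs. [:- r, 1 :: 'a poly:])"
  proof (induction rs)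
    case (add r rs)
    show ?case
      unfolding image_mset_add_mset prod_mset.add_mset m.hom_mult add by (simp add: map_poly_pCons one_pCons)
  qed simp
  moreover have "map_poly (\<lambda>c. [:c:]) (smult c p) = smult [:c:] (map_poly (\<lambda>c. [:c:]) p)" for p
    by (rule poly_eqI) (simp add: coeff_map_poly)
  ultimately show ?thesis by simp
qed

text \<open>The determinant commutes with the specialisation, and a splitting into as many linear
  factors as the degree of \<open>R_iter (Suc n)\<close> makes it a product over the roots. The
  exponent in \<open>c ^ 5\<close> is the formal degree of g in the eliminated variable.\<close>

lemma spec_R_iter_step:
  fixes \<alpha> :: "'a :: comm_ring_1"
  assumes "spec \<alpha> (R_iter (Suc n)) = smult c (\<Prod>r\<in>#rs. [:- r, 1:])"
    and "size rs = degree (R_iter (Suc n))"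
  shows "spec \<alpha> (R_iter (Suc (Suc n))) = smult (c ^ 5) (\<Prod>r\<in>#rs. g_poly [:r:] [:0, 1:])"
proof -
  let ?p = "R_iter (Suc n)"
  interpret m: map_poly_comm_ring_hom "spec \<alpha>" ..
  have 1: "map_poly (spec \<alpha>) (map_poly (\<lambda>c. [:c:]) ?p) = map_poly (\<lambda>c. [:c:]) (spec \<alpha> ?p)"
    by (rule poly_eqI) (simp add: coeff_map_poly coeff_spec)
  have 2: "map_poly (spec \<alpha>) (g_poly [:0, 1:] [:[:0, 1:]:]) = g_poly [:0, 1:] [:[:0, 1:]:]"
    by (subst g_poly_hom[OF m.comm_ring_hom_axioms]) (simp add: map_poly_pCons)
  have deg: "degree (g_poly [:0, 1:] [:[:0, 1:]:] :: 'a poly poly) \<le> 5"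
    by (simp add: g_poly_var_const)
  have map_sylv: "map_mat (spec \<alpha>) (sylvester_mat_sub m k p q) =
      sylvester_mat_sub m k (map_poly (spec \<alpha>) p) (map_poly (spec \<alpha>) q)" for m k p q
    by (rule sylvester_mat_sub_map) simp
  have "spec \<alpha> (R_iter (Suc (Suc n))) = resultant_sub (size rs) 5 (map_poly (\<lambda>c. [:c:]) (spec \<alpha> ?p)) (g_poly [:0, 1:] [:[:0, 1:]:])"
    unfolding R_iter_Suc_Suc_sub resultant_sub_def assms(2)
    by (simp only: spec.hom_det[symmetric] map_sylv 1 2)
  also have "\<dots> = resultant_sub (size (image_mset (\<lambda>r. [:r:]) rs)) 5 (smult [:c:] (\<Prod>r\<in>#image_mset (\<lambda>r. [:r:]) rs. [:- r, 1:])) (g_poly [:0, 1:] [:[:0, 1:]:])"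
    by (simp add: assms(1) map_poly_const_prod_linear)
  also have "\<dots> = [:c:] ^ 5 * (\<Prod>r\<in>#rs. poly (g_poly [:0, 1:] [:[:0, 1:]:]) [:r:])"
    by (subst resultant_sub_linear_factors[OF deg]) (simp add: multiset.map_comp o_def)
  also have "[:c:] ^ 5 = [:c ^ 5:]" by (simp add: power_numeral_reduce)
  also have "(\<lambda>r :: 'a. poly (g_poly [:0, 1:] [:[:0, 1:]:]) [:r:]) = (\<lambda>r. g_poly [:r:] [:0, 1:])"
    by (simp add: g_poly_def mult.commute)
  finally show ?thesis by simp
qed

lemma spec_R_iter_1: "spec \<alpha> (R_iter (Suc 0)) = g_poly [:\<alpha>:] [:0, 1:]"
  unfolding R_iter.simps by (subst g_poly_hom[OF spec.comm_ring_hom_axioms]) simp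

lemma degree_g_poly_prod:
  fixes rs :: "'a :: idom multiset"
  shows "degree (\<Prod>r\<in>#rs. g_poly [:r:] [:0, 1:]) = 5 * size rs"
    and "lead_coeff (\<Prod>r\<in>#rs. g_poly [:r:] [:0, 1:]) = (-1) ^ size rs"
proof -
  have g: "degree (g_poly [:r:] [:0, 1:]) = 5" "lead_coeff (g_poly [:r:] [:0, 1:]) = -1" "g_poly [:r:] [:0, 1:] \<noteq> 0" for r :: 'a
    by (simp_all add: g_poly_const_var)
  have "(\<Prod>r\<in>#rs. g_poly [:r:] [:0, 1:]) \<noteq> 0" for rs :: "'a multiset"
    using g by (auto simp: prod_mset_zero_iff)
  then show "degree (\<Prod>r\<in>#rs. g_poly [:r:] [:0, 1:]) = 5 * size rs"
    using g by (induction rs) (auto simp: degree_mult_eq)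
  show "lead_coeff (\<Prod>r\<in>#rs. g_poly [:r:] [:0, 1:]) = (-1) ^ size rs"
  proof (induction rs)
    case (add r rs)
    show ?case
      by (simp only: image_mset_add_mset prod_mset.add_mset lead_coeff_mult g(2) add size_add_mset power_Suc)
  qed simp
qed

text \<open>Degrees are measured at a transcendental point: \<open>t\<close> is x itself inside the
  algebraic closure of Q(x). There every polynomial splits, and specialising at \<open>t\<close> is
  injective, so neither degree nor leading coefficient is lost.\<close>

lemma R_iter_degree_lead_coeff:
  "degree (R_iter (Suc n)) = 5 ^ Suc n \<and> lead_coeff (R_iter (Suc n)) = (-1) ^ Suc n"
proof -
  define t :: "int poly fract alg_closure" where "t = to_ac (to_fract [:0, 1:])"
  have t: "poly (of_int_poly c) t = to_ac (to_fract c)" for c :: "int poly"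
  proof (induction c)
    case 0
    then show ?case by simp
  next
    case (pCons a c)
    have "pCons a c = of_int a + [:0, 1:] * c" by (simp add: of_int_poly)
    then have "to_fract (pCons a c) = of_int a + to_fract [:0, 1:] * to_fract c"
      by (simp only: to_fract_hom.hom_of_int to_fract_add to_fract_mult)
    then show ?case using pCons by (simp add: t_def map_poly_pCons)
  qed
  interpret inj: inj_comm_ring_hom "\<lambda>c :: int poly. poly (of_int_poly c) t"
    by unfold_locales (auto simp: t)
  have deg: "degree (spec t F) = degree F" for F by (simp add: spec_def)
  have lc: "lead_coeff (spec t F) = poly (of_int_poly (lead_coeff F)) t" for F
    by (simp add: deg coeff_spec)
  have "degree (spec t (R_iter (Suc n))) = 5 ^ Suc n \<and> lead_coeff (spec t (R_iter (Suc n))) = (-1) ^ Suc n"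
  proof (induction n)
    case 0
    then show ?case by (simp only: spec_R_iter_1 g_poly_const_var) simp
  next
    case (Suc n)
    let ?p = "spec t (R_iter (Suc n))"
    from Suc have "?p \<noteq> 0" by auto
    then obtain rs where rs: "size rs = degree ?p" "?p = smult (lead_coeff ?p) (\<Prod>r\<in>#rs. [:- r, 1:])"
      using alg_closed_imp_factorization by blast
    from spec_R_iter_step[OF rs(2)] rs(1) deg
    have "spec t (R_iter (Suc (Suc n))) = smult (lead_coeff ?p ^ 5) (\<Prod>r\<in>#rs. g_poly [:r:] [:0, 1:])"
      by simp
    with Suc have eq: "spec t (R_iter (Suc (Suc n))) =
        smult (((-1) ^ Suc n) ^ 5) (\<Prod>r\<in>#rs. g_poly [:r:] [:0, 1:])" by metis
    \<comment> \<open>Both 5 and \<open>size rs\<close>, a power of 5, are odd.\<close>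
    have "((-1) ^ Suc n) ^ 5 * (-1) ^ size rs = ((-1) ^ Suc (Suc n) :: int poly fract alg_closure)"
      using Suc rs(1) by (simp add: minus_one_power_iff)
    then have "lead_coeff (spec t (R_iter (Suc (Suc n)))) = (-1) ^ Suc (Suc n)"
      by (simp only: eq lead_coeff_smult degree_g_poly_prod(2))
    moreover have "degree (spec t (R_iter (Suc (Suc n)))) = 5 ^ Suc (Suc n)"
      using Suc rs(1) by (simp add: eq degree_g_poly_prod(1))
    ultimately show ?case by blast
  qed
  moreover have "poly (of_int_poly ((-1) ^ Suc n)) t = (-1) ^ Suc n"
    by (simp add: inj.hom_power inj.hom_uminus)
  ultimately show ?thesis using inj.eq_iff lc deg by metis
qed

lemma degree_R_iter: "n \<ge> 1 \<Longrightarrow> degree (R_iter n) = 5 ^ n"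
  and lead_coeff_R_iter: "n \<ge> 1 \<Longrightarrow> lead_coeff (R_iter n) = (-1) ^ n"
  using R_iter_degree_lead_coeff[of "n - 1"] by (cases n; simp_all del: R_iter.simps)+

text \<open>The leading coefficient is a sign, so no specialisation lowers the degree.\<close>

lemma degree_spec_R_iter:
  fixes \<alpha> :: "'a :: comm_ring_1"
  assumes "n \<ge> 1"
  shows "degree (spec \<alpha> (R_iter n)) = 5 ^ n" "lead_coeff (spec \<alpha> (R_iter n)) = (-1) ^ n"
proof -
  have "coeff (spec \<alpha> (R_iter n)) (5 ^ n) = poly (of_int_poly ((-1) ^ n)) \<alpha>"
    using lead_coeff_R_iter[OF assms] degree_R_iter[OF assms] by (simp add: coeff_spec)
  also have "\<dots> = (-1) ^ n"
    by (cases "even n") (auto simp: of_int_poly_hom.hom_uminus)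
  finally have 1: "coeff (spec \<alpha> (R_iter n)) (5 ^ n) = (-1) ^ n" .
  moreover have "degree (spec \<alpha> (R_iter n)) \<le> 5 ^ n"
    unfolding spec_def using degree_map_poly_le[of _ "R_iter n"] degree_R_iter[OF assms] by metis
  moreover have "(-1 :: 'a) ^ n \<noteq> 0" by (cases "even n") auto
  ultimately show "degree (spec \<alpha> (R_iter n)) = 5 ^ n" using le_degree by (metis antisym)
  with 1 show "lead_coeff (spec \<alpha> (R_iter n)) = (-1) ^ n" by simp
qed

text \<open>By the product formula the roots of the next polynomial are the solutions y of g(r, y) =
  0 with r a root of the previous one. As the leading coefficients are signs, no resultant vanishes
  merely through a drop of degrees.\<close>

lemma spec_R_iter_zero_iff:
  fixes a b :: "'a :: alg_closed_field"
  assumes "n \<ge> 1"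
  shows "poly (spec a (R_iter n)) b = 0 \<longleftrightarrow>
    (\<exists>c. c 0 = a \<and> c n = b \<and> (\<forall>i<n. g_poly (c i) (c (Suc i)) = 0))"
  using assms
proof (induction n arbitrary: b rule: nat_induct_at_least)
  case base
  have "poly (spec a (R_iter 1)) b = g_poly a b"
    by (simp only: One_nat_def spec_R_iter_1) (simp add: g_poly_def mult.commute)
  moreover have "g_poly a b = 0 \<longleftrightarrow> (\<exists>c. c 0 = a \<and> c (1::nat) = b \<and> (\<forall>i<1. g_poly (c i) (c (Suc i)) = 0))"
    by (auto intro!: exI[of _ "\<lambda>i. if i = 0 then a else b"])
  ultimately show ?case by simp
next
  case (Suc n)
  then obtain m where m: "n = Suc m" using Suc_le_D[of 0 n] by auto
  let ?p = "spec a (R_iter n)"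
  have "?p \<noteq> 0" using degree_spec_R_iter[OF Suc(1), of a] by auto
  then obtain rs where rs: "size rs = degree ?p" "?p = smult (lead_coeff ?p) (\<Prod>r\<in>#rs. [:- r, 1:])"
    using alg_closed_imp_factorization by blast
  have "spec a (R_iter (Suc n)) = smult (lead_coeff ?p ^ 5) (\<Prod>r\<in>#rs. g_poly [:r:] [:0, 1:])"
    using spec_R_iter_step[of a m, OF rs(2)[unfolded m]] rs(1) degree_spec_R_iter[OF Suc(1), of a]
      degree_R_iter[OF Suc(1)] m by metis
  moreover have "poly (\<Prod>r\<in>#rs. g_poly [:r:] [:0, 1:]) b = (\<Prod>r\<in>#rs. g_poly r b)"
    by (induction rs) (auto simp: g_poly_def mult.commute)
  moreover have "lead_coeff ?p \<noteq> 0" using \<open>?p \<noteq> 0\<close> by simp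
  ultimately have "poly (spec a (R_iter (Suc n))) b = 0 \<longleftrightarrow> (\<exists>r\<in>#rs. g_poly r b = 0)"
    by (auto simp: prod_mset_zero_iff)
  moreover have "poly ?p r = 0 \<longleftrightarrow> r \<in># rs" for r
  proof -
    have "poly ?p r = lead_coeff ?p * (\<Prod>x\<in>#rs. r - x)"
      by (subst rs(2)) (simp add: poly_prod_mset multiset.map_comp o_def)
    then show ?thesis using \<open>lead_coeff ?p \<noteq> 0\<close> by (auto simp: prod_mset_zero_iff)
  qed
  ultimately have "poly (spec a (R_iter (Suc n))) b = 0 \<longleftrightarrow> (\<exists>r. poly ?p r = 0 \<and> g_poly r b = 0)"
    by auto
  also have "\<dots> \<longleftrightarrow> (\<exists>r c. c 0 = a \<and> c n = r \<and> (\<forall>i<n. g_poly (c i) (c (Suc i)) = 0) \<and> g_poly r b = 0)"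
    by (simp only: Suc.IH) blast
  also have "\<dots> \<longleftrightarrow> (\<exists>c. c 0 = a \<and> c (Suc n) = b \<and> (\<forall>i<Suc n. g_poly (c i) (c (Suc i)) = 0))"
  proof
    assume "\<exists>r c. c 0 = a \<and> c n = r \<and> (\<forall>i<n. g_poly (c i) (c (Suc i)) = 0) \<and> g_poly r b = 0"
    then obtain c where "c 0 = a" "\<forall>i<n. g_poly (c i) (c (Suc i)) = 0" "g_poly (c n) b = 0" by auto
    then show "\<exists>c. c 0 = a \<and> c (Suc n) = b \<and> (\<forall>i<Suc n. g_poly (c i) (c (Suc i)) = 0)"
      by (intro exI[of _ "c(Suc n := b)"]) (auto simp: less_Suc_eq)
  next
    assume "\<exists>c. c 0 = a \<and> c (Suc n) = b \<and> (\<forall>i<Suc n. g_poly (c i) (c (Suc i)) = 0)"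
    then show "\<exists>r c. c 0 = a \<and> c n = r \<and> (\<forall>i<n. g_poly (c i) (c (Suc i)) = 0) \<and> g_poly r b = 0"
      by (metis lessI less_SucI)
  qed
  finally show ?case .
qed

lemma poly_R_diag: "poly (of_int_poly (R_diag n)) \<alpha> = poly (spec \<alpha> (R_iter n)) \<alpha>"
  for \<alpha> :: "'a :: comm_ring_1"
proof -
  interpret c: comm_ring_hom "\<lambda>c :: int poly. poly (of_int_poly c) \<alpha>"
    by unfold_locales (auto simp: of_int_poly_hom.hom_add of_int_poly_hom.hom_mult)
  show ?thesis unfolding R_diag_def spec_def by (simp add: c.poly_map_poly[symmetric])
qed

lemma on_cycle_iff_R_diag:
  "n \<ge> 1 \<Longrightarrow> on_cycle n a \<longleftrightarrow> poly (of_int_poly (R_diag n)) a = 0"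
  by (simp add: on_cycle_def poly_R_diag spec_R_iter_zero_iff)


text \<open>Each root r passes to r^5 and four copies of 2. Since 2^5 = 2 in characteristic 5, the
  \<open>N - 1\<close> copies of 2 become 5 (N - 1) copies, and the root \<alpha>^N adds
  \<alpha>^(5N) and four more, in total 5 N - 1 copies of 2.\<close>

lemma spec_R_iter_char_5:
  fixes \<alpha> :: "'a :: idom"
  assumes "(5 :: 'a) = 0"
  shows "spec \<alpha> (R_iter (Suc n)) =
    smult ((-1) ^ Suc n) ([:- (\<alpha> ^ 5 ^ Suc n), 1:] * [:- 2, 1:] ^ (5 ^ Suc n - 1))"
proof (induction n)
  have g: "g_poly [:r:] [:0, 1:] = - ([:- (r ^ 5), 1:] * [:-2, 1:] ^ 4)" for r :: 'a
  proof -
    \<comment> \<open>An identity over every commutative ring; the listed coefficients are the exact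
      quotient by 5.\<close>
    have "g_poly [:r:] [:0, 1:] + [:- (r ^ 5), 1:] * [:-2, 1:] ^ 4 =
      smult 5 [:- 3 * r ^ 5, 3 + 7 * r ^ 5, - 6 - 4 * r ^ 5, 4 + 2 * r ^ 5, - 1 :: 'a:]"
      unfolding g_poly_const_var by (simp add: power_numeral_reduce algebra_simps)
    also have "\<dots> = 0" using assms by simp
    finally show ?thesis by (simp only: eq_neg_iff_add_eq_0)
  qed
  {
    case 0
    show ?case unfolding spec_R_iter_1 g by simp
  next
    case (Suc n)
    define N where "N = (5 :: nat) ^ Suc n"
    define rs where "rs = add_mset (\<alpha> ^ N) (replicate_mset (N - 1) 2)"
    have N: "N \<ge> 1" "odd N" by (auto simp: N_def)
    have rs: "size rs = N" using N by (simp add: rs_def)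
    have "(\<Prod>r\<in>#rs. [:- r, 1:]) = [:- (\<alpha> ^ N), 1:] * [:- 2, 1:] ^ (N - 1)"
      by (simp add: rs_def)
    then have "spec \<alpha> (R_iter (Suc n)) = smult ((-1) ^ Suc n) (\<Prod>r\<in>#rs. [:- r, 1:])"
      using Suc by (simp only: N_def)
    from spec_R_iter_step[OF this] have step:
      "spec \<alpha> (R_iter (Suc (Suc n))) = smult (((-1) ^ Suc n) ^ 5) (\<Prod>r\<in>#rs. g_poly [:r:] [:0, 1:])"
      using rs by (simp add: degree_R_iter N_def del: R_iter.simps)
    have "(2 :: 'a) ^ 5 = 2"
    proof -
      have "(2 :: 'a) ^ 5 = 2 + 5 * 6" by simp
      then show ?thesis using assms by simp
    qed
    then have "g_poly [:2:] [:0, 1:] = - ([:- 2, 1 :: 'a:] ^ 5)"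
      unfolding g by (simp only: power_Suc[symmetric]) simp
    moreover have "g_poly [:\<alpha> ^ N:] [:0, 1:] = - ([:- (\<alpha> ^ (N * 5)), 1:] * [:- 2, 1:] ^ 4)"
      unfolding g power_mult ..
    ultimately have "(\<Prod>r\<in>#rs. g_poly [:r:] [:0, 1:]) =
        - ([:- (\<alpha> ^ (N * 5)), 1:] * [:- 2, 1:] ^ 4) * (- ([:- 2, 1:] ^ 5)) ^ (N - 1)"
      unfolding rs_def by (simp only: image_mset_add_mset image_replicate_mset prod_mset.add_mset prod_mset_replicate_mset)
    also have "\<dots> = - ([:- (\<alpha> ^ (N * 5)), 1:] * [:- 2, 1:] ^ (4 + 5 * (N - 1)))"
      using N by (simp only: power_mult power_add mult.assoc power_minus_even even_diff_nat mult_minus_left) simp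
    also have "4 + 5 * (N - 1) = 5 ^ Suc (Suc n) - 1"
      using N by (simp add: N_def diff_mult_distrib2)
    finally have prod: "(\<Prod>r\<in>#rs. g_poly [:r:] [:0, 1:]) =
      - ([:- (\<alpha> ^ 5 ^ Suc (Suc n)), 1:] * [:- 2, 1:] ^ (5 ^ Suc (Suc n) - 1))"
      by (simp only: N_def power_Suc mult_ac)
    have "smult (((-1) ^ Suc n) ^ 5) (- p) = smult ((-1) ^ Suc (Suc n)) p" for p :: "'a poly"
      by (simp add: minus_one_power_iff)
    then show ?case unfolding step prod .
  }
qed

text \<open>In the Leibniz formula every product takes one entry from each row, so bounds that
  depend on the row alone add up.\<close>

lemma degree_det_le:
  fixes A :: "int poly poly mat"
  assumes A: "A \<in> carrier_mat N N"
    and d: "\<And>i j k. i < N \<Longrightarrow> j < N \<Longrightarrow> degree (coeff (A $$ (i, j)) k) \<le> d i"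
  shows "degree (coeff (det A) k) \<le> (\<Sum>i<N. d i)"
proof -
  have mult: "degree (coeff (p * q) k) \<le> a + b"
    if "\<And>k. degree (coeff p k) \<le> a" "\<And>k. degree (coeff q k) \<le> b" for p q :: "int poly poly" and a b k
    unfolding coeff_mult
    by (rule degree_sum_le) (use that in \<open>auto intro: order.trans[OF degree_mult_le] add_mono\<close>)
  have prod: "degree (coeff (\<Prod>i<m. F i) k) \<le> (\<Sum>i<m. d i)"
    if "\<And>i k. i < m \<Longrightarrow> degree (coeff (F i) k) \<le> d i" for F :: "nat \<Rightarrow> int poly poly" and m k
    using that
  proof (induction m arbitrary: k)
    case 0
    then show ?case by (simp add: coeff_1 split: if_splits)
  next
    case (Suc m)
    have "degree (coeff ((\<Prod>i<m. F i) * F m) k) \<le> (\<Sum>i<m. d i) + d m"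
      by (rule mult) (use Suc in auto)
    then show ?case by simp
  qed
  have "degree (coeff (signof p * (\<Prod>i = 0..<N. A $$ (i, p i))) k) \<le> (\<Sum>i<N. d i)"
    if "p permutes {0..<N}" for p
  proof -
    have "degree (coeff (\<Prod>i<N. A $$ (i, p i)) k) \<le> (\<Sum>i<N. d i)"
      by (rule prod) (use that d permutes_in_image[OF that] in auto)
    then show ?thesis by (auto simp: sign_def atLeast0LessThan)
  qed
  then show ?thesis
    unfolding det_def'[OF A] coeff_sum
    by (intro degree_sum_le) (auto intro: finite_permutations)
qed

text \<open>The variable x enters the Sylvester matrix only through the five rows that hold
  coefficients of the previous polynomial; the rows of g are free of it. So the degree in x grows at
  most by the factor 5.\<close>

lemma degree_coeff_R_iter: "degree (coeff (R_iter (Suc n)) k) \<le> 5 ^ Suc n"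
proof (induction n arbitrary: k)
  case 0
  have "degree ([:0, 1 :: int:] ^ 5) \<le> 5"
    using degree_power_le[of "[:0, 1 :: int:]" 5] by simp
  then have X: "degree (c * [:0, 1 :: int:] ^ 5) \<le> 5" if "degree c = 0" for c
    using degree_mult_le[of c "[:0, 1 :: int:] ^ 5"] that by simp
  have "degree (coeff (g_poly [:[:0, 1 :: int:]:] [:0, 1:]) k) \<le> 5"
    unfolding g_poly_const_var
    using \<open>degree ([:0, 1 :: int:] ^ 5) \<le> 5\<close>
    by (auto simp: coeff_pCons X split: nat.split intro!: degree_diff_le degree_add_le X)
  then show ?case by simp
next
  case (Suc n)
  define N where "N = (5 :: nat) ^ Suc n"
  let ?A = "map_poly (\<lambda>c. [:c:]) (R_iter (Suc n))"
  let ?g = "g_poly [:0, 1:] [:[:0, 1:]:] :: int poly poly poly"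
  have g: "degree (coeff (coeff ?g i) k) = 0" for i k
  proof -
    have 1: "degree (coeff ([:0, 1:] ^ 4 + 2 * [:0, 1:] ^ 3 + 4 * [:0, 1:]\<^sup>2 + 3 * [:0, 1:] + 1 :: int poly poly) k) = 0"
      by (simp add: power_numeral_reduce numeral_poly one_pCons coeff_pCons split: nat.split)
    have 2: "degree (coeff (- [:0, 1:] * ([:0, 1:] ^ 4 - 3 * [:0, 1:] ^ 3 + 4 * [:0, 1:]\<^sup>2 - 2 * [:0, 1:] + 1) :: int poly poly) k) = 0"
      by (simp add: power_numeral_reduce numeral_poly one_pCons coeff_pCons split: nat.split)
    show ?thesis unfolding g_poly_var_const using 1 2
      by (auto simp: coeff_pCons[where ?'a = "int poly poly"] split: nat.split simp del: mult_minus_left)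
  qed
  have "R_iter (Suc (Suc n)) = det (sylvester_mat_sub N 5 ?A ?g)"
    unfolding R_iter_Suc_Suc_sub resultant_sub_def by (simp add: degree_R_iter N_def del: R_iter.simps)
  also have "degree (coeff (det (sylvester_mat_sub N 5 ?A ?g)) k) \<le> (\<Sum>i<N + 5. if i < 5 then N else 0)"
  proof (rule degree_det_le[OF sylvester_mat_sub_carrier])
    fix i j k assume "i < N + 5" "j < N + 5"
    then show "degree (coeff (sylvester_mat_sub N 5 ?A ?g $$ (i, j)) k) \<le> (if i < 5 then N else 0)"
      using Suc by (auto simp: sylvester_mat_sub_index coeff_map_poly coeff_pCons g N_def simp del: R_iter.simps power_Suc split: nat.split)
  qed
  also have "\<dots> = (\<Sum>i<(5::nat). N)"
    by (rule sum.mono_neutral_cong_right[of "{..<N + 5}" "{..<5}"]) auto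
  finally show ?case by (simp add: N_def)
qed

text \<open>Setting x_n = x could give degree 2 * 5^n only from the product of x^(5^n) and
  x_n^(5^n), which is absent because the coefficient of x_n^(5^n) is a sign. The count of roots
  needs exactly this improvement by one.\<close>

lemma degree_R_diag:
  assumes "n \<ge> 1"
  shows "degree (R_diag n) \<le> 2 * 5 ^ n - 1"
proof -
  let ?N = "5 ^ n :: nat"
  have "R_diag n = (\<Sum>i\<le>?N. coeff (R_iter n) i * [:0, 1:] ^ i)"
    unfolding R_diag_def poly_altdef degree_R_iter[OF assms] ..
  also have "degree \<dots> \<le> 2 * ?N - 1"
  proof (rule degree_sum_le)
    fix i assume i: "i \<in> {..?N}"
    have deg: "degree (coeff (R_iter n) i) \<le> (if i = ?N then 0 else ?N)"
    proof (cases "i = ?N")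
      case True
      have "coeff (R_iter n) ?N = (-1) ^ n"
        using lead_coeff_R_iter[OF assms] degree_R_iter[OF assms] by simp
      then show ?thesis using True by (cases "even n") auto
    next
      case False
      then show ?thesis using degree_coeff_R_iter[of "n - 1" i] assms by (cases n) auto
    qed
    have "degree (coeff (R_iter n) i * [:0, 1:] ^ i) \<le> degree (coeff (R_iter n) i) + degree ([:0, 1 :: int:] ^ i)"
      by (rule degree_mult_le)
    also have "degree ([:0, 1 :: int:] ^ i) \<le> i"
      using degree_power_le[of "[:0, 1 :: int:]" i] by simp
    finally show "degree (coeff (R_iter n) i * [:0, 1:] ^ i) \<le> 2 * ?N - 1"
      using deg i by (auto split: if_splits)
  qed simp
  finally show ?thesis .
qed


section \<open>The 5-adic integers\<close>

lemma z5_res_0 [simp]: "z5_res x 0 = 0"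
  using z5_res_mod_self[of x 0] by simp

lemma z5_res_of_int: "z5_res (of_int a) n = a mod 5 ^ n"
proof (induction a)
  case (nonneg m)
  then show ?case by (induction m) (simp_all add: z5_ops mod_add_eq)
next
  case (neg m)
  have "z5_res (of_nat m) n = int m mod 5 ^ n" for m
    by (induction m) (simp_all add: z5_ops mod_add_eq)
  from this[of "Suc m"] show ?case
    by (simp only: of_int_minus of_int_of_nat_eq uminus_z5.rep_eq mod_minus_eq)
qed

text \<open>Division by 5^k acts on residue sequences: shift by \<open>k\<close> places and divide
  each entry.\<close>

lemma pow5_dvd_z5_iff: "5 ^ k dvd c \<longleftrightarrow> z5_res c k = 0"
proof
  assume "5 ^ k dvd c"
  then obtain d where "c = of_int (5 ^ k) * d" by (auto elim: dvdE)
  then show "z5_res c k = 0" by (simp only: times_z5.rep_eq z5_res_of_int) simp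
next
  assume c: "z5_res c k = 0"
  have dvd: "5 ^ k dvd z5_res c (n + k)" for n
    using z5_res_mod[of c k n] c by (simp add: dvd_eq_mod_eq_0 add.commute)
  have step: "z5_res c (n + k) div 5 ^ k = z5_res c (Suc n + k) div 5 ^ k mod 5 ^ n" for n
  proof -
    have "z5_res c (n + k) = z5_res c (Suc n + k) mod (5 ^ k * 5 ^ n)"
      using z5_res_step[of c "n + k"] by (simp add: power_add mult.commute)
    also have "\<dots> = 5 ^ k * (z5_res c (Suc n + k) div 5 ^ k mod 5 ^ n) + z5_res c (Suc n + k) mod 5 ^ k"
      by (rule zmod_zmult2_eq) simp
    finally show ?thesis using dvd[of "Suc n"] by (simp add: dvd_eq_mod_eq_0)
  qed
  define d where "d = Abs_z5 (\<lambda>n. z5_res c (n + k) div 5 ^ k)"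
  have d: "z5_res d n = z5_res c (n + k) div 5 ^ k" for n
    unfolding d_def by (subst Abs_z5_inverse) (intro CollectI allI step, rule refl)
  have "c = of_int (5 ^ k) * d"
  proof (rule z5_eqI)
    fix n
    have "z5_res (of_int (5 ^ k) * d) n = (5 ^ k * (z5_res c (n + k) div 5 ^ k)) mod 5 ^ n"
      by (simp only: times_z5.rep_eq z5_res_of_int d mod_mult_left_eq)
    also have "\<dots> = z5_res c (n + k) mod 5 ^ n" using dvd[of n] by simp
    also have "\<dots> = z5_res c n" by (rule z5_res_mod)
    finally show "z5_res c n = z5_res (of_int (5 ^ k) * d) n" by simp
  qed
  then show "5 ^ k dvd c" by simp
qed

lemma z5_eq_0_if_pow5_dvd: "(\<And>k. 5 ^ k dvd c) \<Longrightarrow> c = (0 :: z5)"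
  by (rule z5_eqI) (simp add: pow5_dvd_z5_iff z5_ops)

text \<open>Completeness in the shape used later: the n-th residue of the sum is read off the n-th
  partial sum, which later terms no longer change modulo 5^n.\<close>

lemma z5_series_limit: "\<exists>S :: z5. \<forall>k. 5 ^ k dvd (S - (\<Sum>i<k. 5 ^ i * c i))"
proof -
  define s where "s k = (\<Sum>i<k. 5 ^ i * c i)" for k
  have res_diff: "z5_res x k = z5_res y k" if "5 ^ k dvd x - y" for x y k
  proof -
    have "(z5_res x k - z5_res y k) mod 5 ^ k = 0"
      using that by (simp add: pow5_dvd_z5_iff z5_ops)
    then show ?thesis
      by (metis mod_eq_dvd_iff mod_0_imp_dvd z5_res_mod_self)
  qed
  define S where "S = Abs_z5 (\<lambda>n. z5_res (s n) n)"
  have S: "z5_res S n = z5_res (s n) n" for n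
    unfolding S_def
  proof (subst Abs_z5_inverse)
    have coherent: "z5_res (s n) n = z5_res (s (Suc n)) (Suc n) mod 5 ^ n" for n
      using z5_res_step[of "s (Suc n)" n] res_diff[of n "s (Suc n)" "s n"] by (simp add: s_def)
    show "(\<lambda>n. z5_res (s n) n) \<in> {f. \<forall>n. f n = f (Suc n) mod 5 ^ n}"
      by (intro CollectI allI coherent)
  qed simp
  have "5 ^ k dvd S - s k" for k
    by (simp add: pow5_dvd_z5_iff minus_z5.rep_eq S)
  then show ?thesis unfolding s_def by blast
qed

lemma z5_res_1: "5 dvd c - of_int (z5_res c 1)"
  using pow5_dvd_z5_iff[of 1 "c - of_int (z5_res c 1)"]
  by (simp add: minus_z5.rep_eq z5_res_of_int)

text \<open>An integer inverse modulo 5 brings \<open>c\<close> to the form 1 - 5 w, which is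
  inverted by the geometric series.\<close>

lemma z5_unit:
  assumes "\<not> 5 dvd (c :: z5)"
  shows "c dvd 1"
proof -
  have "\<not> 5 dvd z5_res c 1"
    using assms pow5_dvd_z5_iff[of 1 c] z5_res_mod_self[of c 1] by (simp add: dvd_eq_mod_eq_0)
  moreover have "0 \<le> z5_res c 1" "z5_res c 1 < 5"
    using z5_res_mod_self[of c 1] by (metis pos_mod_sign pos_mod_bound power_one_right zero_less_numeral)+
  ultimately have "z5_res c 1 \<in> {1, 2, 3, 4}" by (cases "z5_res c 1 = 0") auto
  \<comment> \<open>The inverses of 1, 2, 3, 4 modulo 5 are 1, 3, 2, 4.\<close>
  then have "z5_res c 1 * 1 - 1 = 5 * 0 \<or> z5_res c 1 * 3 - 1 = 5 * 1 \<or> z5_res c 1 * 2 - 1 = 5 * 1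
      \<or> z5_res c 1 * 4 - 1 = 5 * 3" by auto
  then obtain a b where b: "z5_res c 1 * a - 1 = 5 * b" by blast
  obtain d where d: "c - of_int (z5_res c 1) = 5 * d" using z5_res_1[of c] ..
  define w where "w = - (of_int b + d * of_int a)"
  have "c * of_int a = (of_int (z5_res c 1) + 5 * d) * of_int a" using d by (simp add: algebra_simps)
  also have "\<dots> = of_int (z5_res c 1 * a) + 5 * d * of_int a" by (simp add: algebra_simps)
  also have "z5_res c 1 * a = 1 + 5 * b" using b by simp
  finally have w: "c * of_int a = 1 - 5 * w" by (simp add: w_def algebra_simps)
  obtain S where S: "5 ^ k dvd S - (\<Sum>i<k. 5 ^ i * w ^ i)" for k
    using z5_series_limit[of "\<lambda>i. w ^ i"] by blast
  have "(1 - 5 * w) * S - 1 = 0"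
  proof (rule z5_eq_0_if_pow5_dvd)
    fix k
    have "(1 - 5 * w) * (\<Sum>i<k. 5 ^ i * w ^ i) = 1 - (5 * w) ^ k"
      by (simp only: power_mult_distrib[symmetric] one_diff_power_eq)
    then have "(1 - 5 * w) * S - 1 = (1 - 5 * w) * (S - (\<Sum>i<k. 5 ^ i * w ^ i)) - (5 * w) ^ k"
      by (simp add: algebra_simps)
    moreover have "5 ^ k dvd (5 * w) ^ k" by (simp add: power_mult_distrib)
    ultimately show "5 ^ k dvd (1 - 5 * w) * S - 1" using S[of k] by auto
  qed
  then have "1 = c * (of_int a * S)" by (simp add: w[symmetric] mult.assoc)
  then show ?thesis ..
qed

text \<open>Every nonzero element is a unit times a power of 5. Hence inverting the single element 5
  already yields a field; later passages from rings to fields rest on this.\<close>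

lemma z5_dvd_pow5:
  assumes "(c :: z5) \<noteq> 0"
  shows "\<exists>k. c dvd 5 ^ k"
proof -
  define k where "k = (LEAST k. \<not> 5 ^ k dvd c)"
  have ex: "\<exists>k. \<not> 5 ^ k dvd c" using assms z5_eq_0_if_pow5_dvd by blast
  have k: "\<not> 5 ^ k dvd c" unfolding k_def by (rule LeastI_ex[OF ex])
  then have "k \<noteq> 0" by (cases k) auto
  then obtain j where j: "k = Suc j" using not0_implies_Suc by blast
  have "5 ^ j dvd c" using not_less_Least[of j "\<lambda>k. \<not> 5 ^ k dvd c"] j k_def by auto
  then obtain u where u: "c = 5 ^ j * u" ..
  have "\<not> 5 dvd u" using k unfolding j u by (metis mult_dvd_mono dvd_refl power_Suc2)
  from z5_unit[OF this] obtain v where "1 = u * v" by (rule dvdE)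
  then have "5 ^ j = c * v" by (simp add: u mult.assoc)
  then have "c dvd 5 ^ j" by (rule dvdI)
  then show ?thesis ..
qed

section \<open>The copy of the 5-adic integers in the algebraic closure; subrings and Taylor
  expansion\<close>

definition emb :: "z5 \<Rightarrow> qbar5" where
  "emb c = to_ac (Fract c 1)"

lemma emb_to_fract: "emb c = to_ac (to_fract c)"
  by (simp add: emb_def to_fract_def)

interpretation emb: inj_idom_hom emb
  by unfold_locales (auto simp: emb_to_fract)

lemma emb_numeral [simp]: "emb (numeral k) = numeral k"
  using emb.hom_of_int[of "numeral k"] by simp

lemma five_neq_0 [simp]: "(5 :: qbar5) \<noteq> 0"
proof -
  have "(5 :: z5) \<noteq> 0"
  proof
    assume "(5 :: z5) = 0"
    then have "z5_res (of_int 5) 2 = z5_res 0 2" by simp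
    then show False by (simp only: z5_res_of_int zero_z5.rep_eq) simp
  qed
  then have "emb 5 \<noteq> 0" by (simp only: emb.hom_0_iff not_False_eq_True)
  then show ?thesis by (simp only: emb_numeral not_False_eq_True)
qed

lemma inverse_5_not_emb: "inverse 5 \<noteq> emb c"
proof
  assume "inverse 5 = emb c"
  then have "emb (5 * c) = emb 1" by (simp add: emb.hom_mult field_simps)
  then have "5 * c = 1" by simp
  then have "5 dvd (1 :: z5)" by (metis dvd_triv_left)
  then show False using pow5_dvd_z5_iff[of 1 1] by (simp add: one_z5.rep_eq)
qed

definition is_subring :: "'a :: comm_ring_1 set \<Rightarrow> bool" where
  "is_subring A \<longleftrightarrow> 1 \<in> A \<and> (\<forall>x\<in>A. \<forall>y\<in>A. x - y \<in> A \<and> x * y \<in> A)"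

lemma is_subringD:
  assumes "is_subring A"
  shows "1 \<in> A" "0 \<in> A" "x \<in> A \<Longrightarrow> y \<in> A \<Longrightarrow> x - y \<in> A" "x \<in> A \<Longrightarrow> y \<in> A \<Longrightarrow> x * y \<in> A"
    "x \<in> A \<Longrightarrow> - x \<in> A" "x \<in> A \<Longrightarrow> y \<in> A \<Longrightarrow> x + y \<in> A" "x \<in> A \<Longrightarrow> x ^ n \<in> A"
    "of_nat n \<in> A" "of_int k \<in> A" "numeral m \<in> A"
proof -
  show 1: "1 \<in> A" and d: "\<And>x y. x \<in> A \<Longrightarrow> y \<in> A \<Longrightarrow> x - y \<in> A"
    and m: "\<And>x y. x \<in> A \<Longrightarrow> y \<in> A \<Longrightarrow> x * y \<in> A"
    using assms by (auto simp: is_subring_def)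
  show 0: "0 \<in> A" using d[OF 1 1] by simp
  show u: "\<And>x. x \<in> A \<Longrightarrow> - x \<in> A" using d[OF 0] by simp
  show a: "\<And>x y. x \<in> A \<Longrightarrow> y \<in> A \<Longrightarrow> x + y \<in> A" using d[OF _ u] by fastforce
  show "x \<in> A \<Longrightarrow> x ^ n \<in> A" by (induction n) (auto intro: 1 m)
  show n: "of_nat n \<in> A" for n by (induction n) (auto intro: 0 1 a)
  show "of_int k \<in> A" by (cases k) (auto intro: n u simp del: of_nat_Suc)
  show "numeral m \<in> A" using n[of "numeral m"] by simp
qed

lemma is_subring_sum: "is_subring A \<Longrightarrow> (\<And>i. i \<in> I \<Longrightarrow> f i \<in> A) \<Longrightarrow> sum f I \<in> A"
  by (induction I rule: infinite_finite_induct) (auto intro: is_subringD)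

lemma is_subring_poly:
  assumes "is_subring A" "\<And>i. coeff p i \<in> A" "x \<in> A"
  shows "poly p x \<in> A"
  unfolding poly_altdef using assms by (auto intro!: is_subring_sum is_subringD)

text \<open>Induction on the coefficients avoids a division by 2 and keeps the remainder inside the
  subring; both the existence and the uniqueness of Hensel lifts depend on this integrality.\<close>

lemma poly_taylor_2:
  fixes x h :: "'a :: {comm_ring_1, ring_no_zero_divisors}"
  assumes A: "is_subring A" "x \<in> A" "h \<in> A" and p: "\<And>i. coeff p i \<in> A"
  shows "\<exists>r\<in>A. poly p (x + h) = poly p x + h * poly (pderiv p) x + h ^ 2 * r"
  using p
proof (induction p)
  case 0
  then show ?case using is_subringD(2)[OF A(1)] by (auto intro!: bexI[of _ 0])
next
  case (pCons a p)
  have p: "coeff p i \<in> A" for i using pCons.prems[of "Suc i"] by simp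
  then obtain r where r: "r \<in> A" "poly p (x + h) = poly p x + h * poly (pderiv p) x + h ^ 2 * r"
    using pCons.IH by blast
  have "poly (pderiv p) x \<in> A"
    using A p by (intro is_subring_poly) (auto simp: coeff_pderiv intro!: is_subringD simp del: of_nat_Suc)
  then have "x * r + poly (pderiv p) x + h * r \<in> A" using A r by (auto intro!: is_subringD)
  moreover have "poly (pCons a p) (x + h) = poly (pCons a p) x + h * poly (pderiv (pCons a p)) x
      + h ^ 2 * (x * r + poly (pderiv p) x + h * r)"
    unfolding poly_pCons r(2) pderiv_pCons poly_add by (simp add: algebra_simps power2_eq_square)
  ultimately show ?case by blast
qed


section \<open>A valuation ring of the algebraic closure\<close>

definition ring_adjoin :: "qbar5 set \<Rightarrow> qbar5 \<Rightarrow> qbar5 set" where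
  "ring_adjoin A x = {poly p x | p. \<forall>i. coeff p i \<in> A}"

lemma is_subring_ring_adjoin:
  assumes A: "is_subring A"
  shows "is_subring (ring_adjoin A x)" "A \<subseteq> ring_adjoin A x" "x \<in> ring_adjoin A x"
proof -
  note A' = is_subringD[OF A]
  have mem: "poly p x \<in> ring_adjoin A x" if "\<And>i. coeff p i \<in> A" for p
    unfolding ring_adjoin_def by (intro CollectI exI[of _ p]) (simp add: that)
  show "A \<subseteq> ring_adjoin A x"
  proof
    fix a assume "a \<in> A"
    then show "a \<in> ring_adjoin A x"
      using mem[of "[:a:]"] A' by (auto simp: coeff_pCons split: nat.splits)
  qed
  show "x \<in> ring_adjoin A x"
    using mem[of "[:0, 1:]"] A' by (auto simp: coeff_pCons split: nat.splits)
  show "is_subring (ring_adjoin A x)"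
    unfolding is_subring_def
  proof (intro conjI ballI)
    show "1 \<in> ring_adjoin A x"
      using \<open>A \<subseteq> ring_adjoin A x\<close> A' by auto
    fix y z assume "y \<in> ring_adjoin A x" "z \<in> ring_adjoin A x"
    then obtain p q where p: "\<forall>i. coeff p i \<in> A" "y = poly p x" and q: "\<forall>i. coeff q i \<in> A" "z = poly q x"
      unfolding ring_adjoin_def by blast
    show "y - z \<in> ring_adjoin A x"
      using mem[of "p - q"] p q A' by auto
    show "y * z \<in> ring_adjoin A x"
    proof -
      have "coeff (p * q) i \<in> A" for i
        using p q A'(4) by (auto simp: coeff_mult intro!: is_subring_sum[OF A])
      then show ?thesis using mem[of "p * q"] p q by simp
    qed
  qed
qed

text \<open>A substitute for the ring of elements of absolute value at most 1: whichever maximal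
  subring is chosen, maximality alone yields the valuation property.\<close>

definition V5 :: "qbar5 set" where
  "V5 = (SOME V. (is_subring V \<and> range emb \<subseteq> V \<and> inverse 5 \<notin> V) \<and>
     (\<forall>W. is_subring W \<and> range emb \<subseteq> W \<and> inverse 5 \<notin> W \<longrightarrow> V \<subseteq> W \<longrightarrow> W = V))"

lemma V5_maximal_subring:
  "is_subring V5 \<and> range emb \<subseteq> V5 \<and> inverse 5 \<notin> V5"
  "is_subring W \<Longrightarrow> inverse 5 \<notin> W \<Longrightarrow> V5 \<subseteq> W \<Longrightarrow> W = V5"
proof -
  define \<A> where "\<A> = {V. is_subring V \<and> range emb \<subseteq> V \<and> inverse 5 \<notin> V}"
  have "\<exists>V\<in>\<A>. \<forall>W\<in>\<A>. V \<subseteq> W \<longrightarrow> W = V"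
  proof (rule subset_Zorn_nonempty)
    have "is_subring (range emb)"
      unfolding is_subring_def
    proof (intro conjI ballI)
      show "1 \<in> range emb" using rangeI[of emb 1] by simp
      fix x y assume "x \<in> range emb" "y \<in> range emb"
      then obtain a b where "x = emb a" "y = emb b" by blast
      then show "x - y \<in> range emb" "x * y \<in> range emb"
        using rangeI[of emb "a - b"] rangeI[of emb "a * b"] by (simp_all add: emb.hom_minus emb.hom_mult)
    qed
    then have "range emb \<in> \<A>" using inverse_5_not_emb by (auto simp: \<A>_def)
    then show "\<A> \<noteq> {}" by blast
  next
    fix C assume C: "C \<noteq> {}" "subset.chain \<A> C"
    have sub: "is_subring V" "range emb \<subseteq> V" "inverse 5 \<notin> V" if "V \<in> C" for V
      using that C by (auto simp: \<A>_def subset_chain_def)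
    have "is_subring (\<Union>C)"
      unfolding is_subring_def
    proof (intro conjI ballI)
      show "1 \<in> \<Union>C" using C sub is_subringD(1) by blast
      fix x y assume "x \<in> \<Union>C" "y \<in> \<Union>C"
      then obtain V W where VW: "x \<in> V" "V \<in> C" "y \<in> W" "W \<in> C" by blast
      then have "V \<subseteq> W \<or> W \<subseteq> V" using C by (auto simp: subset_chain_def)
      then obtain Z where "Z \<in> C" "x \<in> Z" "y \<in> Z" using VW by blast
      then show "x - y \<in> \<Union>C" "x * y \<in> \<Union>C" using sub is_subringD(3,4) by blast+
    qed
    moreover have "range emb \<subseteq> \<Union>C" using C sub by blast
    moreover have "inverse 5 \<notin> \<Union>C" using sub by blast
    ultimately show "\<Union>C \<in> \<A>" by (simp add: \<A>_def)
  qed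
  then obtain V where V: "V \<in> \<A>" "\<And>W. W \<in> \<A> \<Longrightarrow> V \<subseteq> W \<Longrightarrow> W = V" by blast
  have "\<exists>V. (is_subring V \<and> range emb \<subseteq> V \<and> inverse 5 \<notin> V) \<and>
     (\<forall>W. is_subring W \<and> range emb \<subseteq> W \<and> inverse 5 \<notin> W \<longrightarrow> V \<subseteq> W \<longrightarrow> W = V)"
    using V by (intro exI[of _ V]) (simp add: \<A>_def)
  from someI_ex[OF this, folded V5_def]
  have *: "is_subring V5 \<and> range emb \<subseteq> V5 \<and> inverse 5 \<notin> V5"
    "\<And>W. is_subring W \<Longrightarrow> range emb \<subseteq> W \<Longrightarrow> inverse 5 \<notin> W \<Longrightarrow> V5 \<subseteq> W \<Longrightarrow> W = V5"
    by simp_all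
  show "is_subring V5 \<and> range emb \<subseteq> V5 \<and> inverse 5 \<notin> V5" by (rule *(1))
  show "W = V5" if "is_subring W" "inverse 5 \<notin> W" "V5 \<subseteq> W"
    by (rule *(2)) (use that *(1) in \<open>simp_all add: subset_trans[of "range emb" V5 W]\<close>)
qed

lemma is_subring_V5: "is_subring V5" and emb_in_V5: "emb c \<in> V5" and inverse_5_notin_V5: "inverse 5 \<notin> V5"
  using V5_maximal_subring(1) by auto

lemmas V5_ring = is_subringD[OF is_subring_V5]

lemma inverse_5_in_adjoin: "x \<notin> V5 \<Longrightarrow> inverse 5 \<in> ring_adjoin V5 x"
  using V5_maximal_subring(2)[of "ring_adjoin V5 x"] is_subring_ring_adjoin[OF is_subring_V5, of x] by blast

text \<open>If the inverse of w = 1 - 5 a were missing, maximality would give 1/5 as a polynomial in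
  1/w. Clearing denominators puts w^m / 5 into \<open>V5\<close>, and since w^m is 1 modulo 5, the
  same follows for 1/5.\<close>

lemma inverse_one_minus_5_in_V5:
  assumes "a \<in> V5"
  shows "1 - 5 * a \<noteq> 0" "inverse (1 - 5 * a) \<in> V5"
proof -
  show nz: "1 - 5 * a \<noteq> 0"
  proof
    assume "1 - 5 * a = 0"
    then have "a = inverse 5" by (simp add: field_simps)
    with assms inverse_5_notin_V5 show False by simp
  qed
  define w where "w = 1 - 5 * a"
  have w: "w \<noteq> 0" "w \<in> V5" using nz assms by (auto simp: w_def intro!: V5_ring)
  show "inverse (1 - 5 * a) \<in> V5"
  proof (rule ccontr)
    assume "inverse (1 - 5 * a) \<notin> V5"
    from inverse_5_in_adjoin[OF this] obtain p where
      p: "\<forall>i. coeff p i \<in> V5" "inverse 5 = poly p (inverse w)"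
      unfolding ring_adjoin_def w_def by blast
    define m where "m = degree p"
    have "inverse 5 * w ^ m = (\<Sum>i\<le>m. coeff p i * w ^ (m - i))"
      unfolding p(2) poly_altdef m_def[symmetric] sum_distrib_right
    proof (intro sum.cong refl)
      fix i assume "i \<in> {..m}"
      then have "w ^ m = w ^ i * w ^ (m - i)" by (simp flip: power_add)
      moreover have "inverse w ^ i * w ^ i = 1" using w(1) by (simp flip: power_mult_distrib)
      ultimately show "coeff p i * inverse w ^ i * w ^ m = coeff p i * w ^ (m - i)"
        by (simp add: mult.assoc)
    qed
    also have "\<dots> \<in> V5" using p w by (intro is_subring_sum[OF is_subring_V5]) (auto intro!: V5_ring)
    finally have 1: "inverse 5 * w ^ m \<in> V5" .
    have "\<exists>b\<in>V5. w ^ m = 1 + 5 * b"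
    proof (induction m)
      case 0
      then show ?case using V5_ring(2) by (intro bexI[of _ 0]) auto
    next
      case (Suc m)
      then obtain b where b: "b \<in> V5" "w ^ m = 1 + 5 * b" by blast
      have "w ^ Suc m = w * (1 + 5 * b)" by (simp add: b(2))
      also have "\<dots> = (1 - 5 * a) * (1 + 5 * b)" by (simp add: w_def)
      also have "\<dots> = 1 + 5 * (b - a - 5 * a * b)" by (simp add: algebra_simps)
      finally show ?case using b assms by (intro bexI[of _ "b - a - 5 * a * b"]) (auto intro!: V5_ring)
    qed
    then obtain b where b: "b \<in> V5" "w ^ m = 1 + 5 * b" by blast
    have "inverse 5 * w ^ m - b = inverse 5"
      by (simp add: b(2) distrib_left mult.assoc[symmetric])
    with V5_ring(3)[OF 1 b(1)] inverse_5_notin_V5 show False by (simp only: not_True_eq_False)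
  qed
qed

text \<open>If neither \<open>x\<close> nor \<open>1/x\<close> lay in the ring, \<open>1/5\<close> would be a polynomial of minimal degree in each;
  the relation for one of them shortens the one for the other.\<close>

lemma valuation_ring_aux:
  fixes x y :: qbar5 and p q :: "qbar5 poly"
  assumes xy: "x * y = 1"
    and p: "\<forall>i. coeff p i \<in> V5" "poly p x = inverse 5"
    and p_min: "\<And>r. \<forall>i. coeff r i \<in> V5 \<Longrightarrow> poly r x = inverse 5 \<Longrightarrow> degree p \<le> degree r"
    and q: "\<forall>i. coeff q i \<in> V5" "poly q y = inverse 5"
    and le: "degree q \<le> degree p"
  shows False
proof -
  define n where "n = degree p"
  define m where "m = degree q"
  define u where "u = inverse (1 - 5 * coeff q 0)"
  have u: "u \<in> V5" "u * (1 - 5 * coeff q 0) = 1"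
    using inverse_one_minus_5_in_V5[of "coeff q 0"] q(1) left_inverse unfolding u_def by blast+
  have n: "n > 0"
  proof (rule ccontr)
    assume "\<not> n > 0"
    then have "degree p = 0" by (simp add: n_def)
    then obtain c where c: "p = [:c:]" by (rule degree_eq_zeroE)
    have e: "inverse 5 = coeff p 0" unfolding p(2)[symmetric] unfolding c by simp
    show False using spec[OF p(1), of 0] inverse_5_notin_V5 unfolding e by blast
  qed
  \<comment> \<open>The relation for \<open>y\<close> reads 1 = 5 u (sum of q_j y^j over j \<ge> 1),
    where \<open>u\<close> absorbs the constant term of \<open>q\<close>. Multiplied by x^n it
    becomes x^n = \<open>poly r x\<close> with \<open>degree r < n\<close>, which removes the top
    term of \<open>p\<close>.\<close>
  define r where "r = (\<Sum>j = 1..m. monom (5 * u * coeff q j) (n - j))"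
  have r_coeff: "coeff r i \<in> V5" for i
    unfolding r_def coeff_sum using q u
    by (intro is_subring_sum[OF is_subring_V5]) (auto intro!: V5_ring)
  have r_deg: "degree r < n"
    unfolding r_def
  proof (rule degree_sum_less[OF _ n])
    fix j assume "j \<in> {1..m}"
    then show "degree (monom (5 * u * coeff q j) (n - j)) < n"
      using n by (intro le_less_trans[OF degree_monom_le]) auto
  qed
  have xpow: "y ^ j * x ^ n = x ^ (n - j)" if "j \<le> n" for j
  proof -
    have "x ^ n = x ^ j * x ^ (n - j)" using that by (simp flip: power_add)
    then have "y ^ j * x ^ n = (x * y) ^ j * x ^ (n - j)" by (simp add: power_mult_distrib mult_ac)
    then show ?thesis by (simp add: xy)
  qed
  have "inverse 5 = (\<Sum>j\<le>m. coeff q j * y ^ j)" using q(2) by (simp add: poly_altdef m_def)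
  also have "{..m} = insert 0 {1..m}" by auto
  also have "(\<Sum>j\<in>\<dots>. coeff q j * y ^ j) = coeff q 0 + (\<Sum>j = 1..m. coeff q j * y ^ j)"
    by (subst sum.insert) auto
  finally have "1 - 5 * coeff q 0 = 5 * (\<Sum>j = 1..m. coeff q j * y ^ j)"
    by (simp add: field_simps)
  then have "1 = 5 * u * (\<Sum>j = 1..m. coeff q j * y ^ j)" using u(2) by (simp add: mult_ac)
  then have "x ^ n = 5 * u * (\<Sum>j = 1..m. coeff q j * y ^ j) * x ^ n" by (metis mult_1)
  also have "\<dots> = (\<Sum>j = 1..m. 5 * u * coeff q j * x ^ (n - j))"
    unfolding sum_distrib_left sum_distrib_right
    using le by (intro sum.cong) (simp_all add: mult.assoc xpow[unfolded n_def] n_def m_def)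
  also have "\<dots> = poly r x" by (simp add: r_def poly_sum poly_monom)
  finally have rx: "poly r x = x ^ n" by simp
  define p' where "p' = p - monom (coeff p n) n + smult (coeff p n) r"
  have "poly p' x = inverse 5" by (simp add: p'_def rx p poly_monom)
  moreover have "\<forall>i. coeff p' i \<in> V5"
    using p r_coeff V5_ring(2) by (auto simp: p'_def intro!: V5_ring)
  ultimately have "n \<le> degree p'" using p_min n_def by blast
  moreover have "degree p' < n"
  proof -
    have "coeff p' i = 0" if "i \<ge> n" for i
      using that r_deg coeff_eq_0[of r i] coeff_eq_0[of p i] by (cases "i = n") (auto simp: p'_def n_def)
    then show ?thesis using n by (intro degree_lessI) auto
  qed
  ultimately show False by simp
qed

lemma V5_valuation_ring: "x \<in> V5 \<or> inverse x \<in> V5"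
proof (rule ccontr)
  assume "\<not> ?thesis"
  then have x: "x \<notin> V5" "inverse x \<notin> V5" by auto
  have ex: "\<exists>p. (\<forall>i. coeff p i \<in> V5) \<and> poly p x = inverse 5 \<and>
      (\<forall>r. (\<forall>i. coeff r i \<in> V5) \<longrightarrow> poly r x = inverse 5 \<longrightarrow> degree p \<le> degree r)" if nx: "x \<notin> V5" for x
  proof -
    obtain p where "\<forall>i. coeff p i \<in> V5" "inverse 5 = poly p x"
      using inverse_5_in_adjoin[OF nx] unfolding ring_adjoin_def mem_Collect_eq by blast
    then have "(\<lambda>p. (\<forall>i. coeff p i \<in> V5) \<and> poly p x = inverse 5) p" by simp
    from ex_has_least_nat[of "\<lambda>p. (\<forall>i. coeff p i \<in> V5) \<and> poly p x = inverse 5", OF this, of degree]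
    obtain p where "(\<forall>i. coeff p i \<in> V5) \<and> poly p x = inverse 5"
      "\<forall>r. (\<forall>i. coeff r i \<in> V5) \<and> poly r x = inverse 5 \<longrightarrow> degree p \<le> degree r"
      by (elim exE conjE) simp
    then show ?thesis by blast
  qed
  obtain p where p: "\<forall>i. coeff p i \<in> V5" "poly p x = inverse 5"
    "\<And>r. \<forall>i. coeff r i \<in> V5 \<Longrightarrow> poly r x = inverse 5 \<Longrightarrow> degree p \<le> degree r"
    using ex[OF x(1)] by (elim exE conjE) simp
  obtain q where q: "\<forall>i. coeff q i \<in> V5" "poly q (inverse x) = inverse 5"
    "\<And>r. \<forall>i. coeff r i \<in> V5 \<Longrightarrow> poly r (inverse x) = inverse 5 \<Longrightarrow> degree q \<le> degree r"
    using ex[OF x(2)] by (elim exE conjE) simp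
  have "x \<noteq> 0" using x V5_ring(2) by auto
  then have xx: "x * inverse x = 1" "inverse x * x = 1" by auto
  show False
  proof (cases "degree q \<le> degree p")
    case True
    show False by (rule valuation_ring_aux[OF xx(1) p(1,2) _ q(1,2) True]) (rule p(3))
  next
    case False
    then have le: "degree p \<le> degree q" by simp
    show False by (rule valuation_ring_aux[OF xx(2) q(1,2) _ p(1,2) le]) (rule q(3))
  qed
qed

definition M5 :: "qbar5 set" where
  "M5 = {x \<in> V5. x = 0 \<or> inverse x \<notin> V5}"

lemma M5_subset: "x \<in> M5 \<Longrightarrow> x \<in> V5" and zero_in_M5: "0 \<in> M5" and one_notin_M5: "1 \<notin> M5"
  and five_in_M5: "5 \<in> M5"
  using V5_ring(1,2,10) inverse_5_notin_V5 by (simp_all add: M5_def)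

lemma unit_in_V5: "x \<in> V5 \<Longrightarrow> x \<notin> M5 \<Longrightarrow> inverse x \<in> V5 \<and> x \<noteq> 0"
  by (auto simp: M5_def)

lemma inverse_in_M5: "x \<notin> V5 \<Longrightarrow> inverse x \<in> M5"
  using V5_valuation_ring[of x] by (auto simp: M5_def)

lemma M5_mult: "x \<in> M5 \<Longrightarrow> a \<in> V5 \<Longrightarrow> a * x \<in> M5"
proof -
  assume x: "x \<in> M5" and a: "a \<in> V5"
  show ?thesis
  proof (rule ccontr)
    assume n: "a * x \<notin> M5"
    have "a * x \<in> V5" using x a M5_subset by (auto intro: V5_ring)
    with n have 1: "inverse (a * x) \<in> V5" "a * x \<noteq> 0" using unit_in_V5 by blast+
    have "inverse x = a * inverse (a * x)" using 1 by (simp add: field_simps)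
    then have "inverse x \<in> V5" using 1 a V5_ring(4) by metis
    then show False using x 1 by (auto simp: M5_def)
  qed
qed

text \<open>In a valuation ring one of the two quotients lies in the ring, so the sum is a multiple
  of one of the summands.\<close>

lemma M5_add:
  assumes "x \<in> M5" "y \<in> M5"
  shows "x + y \<in> M5"
proof -
  have *: "x + y \<in> M5" if "x \<in> M5" "y \<in> M5" "x * inverse y \<in> V5" "y \<noteq> 0" for x y
  proof -
    have "x + y = (x * inverse y + 1) * y" using that by (simp add: field_simps)
    then show ?thesis using that M5_mult[of y "x * inverse y + 1"] by (auto intro: V5_ring)
  qed
  show ?thesis
  proof (cases "x = 0 \<or> y = 0")
    case True
    then show ?thesis using assms by auto
  next
    case False
    then have "x * inverse y \<in> V5 \<or> y * inverse x \<in> V5"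
      using V5_valuation_ring[of "x * inverse y"] by (metis inverse_mult_distrib inverse_inverse_eq mult.commute)
    then show ?thesis using *[of x y] *[of y x] assms False by (metis add.commute)
  qed
qed

lemma M5_uminus: "x \<in> M5 \<Longrightarrow> - x \<in> M5"
  using M5_mult[of x "- 1"] V5_ring(5)[OF V5_ring(1)] by (metis mult_minus1)

lemma M5_diff: "x \<in> M5 \<Longrightarrow> y \<in> M5 \<Longrightarrow> x - y \<in> M5"
  using M5_add[of x "- y"] M5_uminus[of y] by (metis diff_conv_add_uminus)

lemma M5_prime: "x \<in> V5 \<Longrightarrow> y \<in> V5 \<Longrightarrow> x * y \<in> M5 \<Longrightarrow> x \<in> M5 \<or> y \<in> M5"
proof -
  assume xy: "x \<in> V5" "y \<in> V5" "x * y \<in> M5"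
  show ?thesis
  proof (cases "x \<in> M5")
    case False
    then have "inverse x \<in> V5" "x \<noteq> 0" using unit_in_V5 xy by blast+
    then have "y = inverse x * (x * y)" by (simp add: mult.assoc[symmetric])
    then show ?thesis using M5_mult[OF xy(3) \<open>inverse x \<in> V5\<close>] by metis
  qed simp
qed

text \<open>A root outside the ring has its inverse \<open>y\<close> in \<open>M5\<close>; dividing
  the equation by the top power of the root writes 1 as a combination of positive powers of
  \<open>y\<close>.\<close>

lemma monic_root_in_V5:
  assumes "lead_coeff p = 1" "\<And>i. coeff p i \<in> V5" "poly p x = 0"
  shows "x \<in> V5"
proof (rule ccontr)
  assume x: "x \<notin> V5"
  define y where "y = inverse x"
  define d where "d = degree p"
  have x0: "x \<noteq> 0" using x V5_ring(2) by auto
  have y: "y \<in> M5" unfolding y_def by (rule inverse_in_M5[OF x])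
  then have yV: "y \<in> V5" by (rule M5_subset)
  have "0 = y ^ d * poly p x" using assms by simp
  also have "\<dots> = (\<Sum>i\<le>d. coeff p i * y ^ (d - i))"
    unfolding poly_altdef d_def[symmetric] sum_distrib_left
  proof (intro sum.cong refl)
    fix i assume "i \<in> {..d}"
    then have "y ^ d = y ^ (d - i) * y ^ i" by (simp flip: power_add)
    moreover have "y ^ i * x ^ i = 1" using x0 by (simp add: y_def flip: power_mult_distrib)
    ultimately show "y ^ d * (coeff p i * x ^ i) = coeff p i * y ^ (d - i)" by (simp add: mult_ac)
  qed
  also have "{..d} = insert d {..<d}" by auto
  also have "(\<Sum>i\<in>\<dots>. coeff p i * y ^ (d - i)) = 1 + (\<Sum>i<d. coeff p i * y ^ (d - i))"
    using assms by (simp add: d_def)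
  finally have "1 = - (\<Sum>i<d. coeff p i * y ^ (d - i))" by (simp add: eq_neg_iff_add_eq_0)
  moreover have "(\<Sum>i<d. coeff p i * y ^ (d - i)) \<in> M5"
  proof -
    have "coeff p i * y ^ (d - i) \<in> M5" if "i < d" for i
    proof -
      have "y ^ (d - i) = y ^ (d - i - 1) * y" using that
        by (simp flip: power_Suc2 add: Suc_diff_Suc)
      then have "coeff p i * y ^ (d - i) = (coeff p i * y ^ (d - i - 1)) * y" by (simp add: mult_ac)
      then show ?thesis using M5_mult[OF y V5_ring(4)[OF assms(2) V5_ring(7)[OF yV]]] by metis
    qed
    then have "sum (\<lambda>i. coeff p i * y ^ (d - i)) {..<k} \<in> M5" if "k \<le> d" for k
      using that by (induction k) (auto intro: zero_in_M5 M5_add)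
    then show ?thesis by simp
  qed
  ultimately show False using M5_uminus[of "\<Sum>i<d. coeff p i * y ^ (d - i)"] one_notin_M5 by simp
qed

lemma integral_over_z5_iff:
  "integral_over_z5 a \<longleftrightarrow> (\<exists>p. lead_coeff p = 1 \<and> poly (map_poly emb p) a = 0)"
proof -
  have "emb = (\<lambda>c. to_ac (Fract c 1))" by (rule ext) (rule emb_def)
  then show ?thesis by (simp only: integral_over_z5_def)
qed

lemma integral_in_V5:
  assumes "integral_over_z5 a"
  shows "a \<in> V5"
proof -
  obtain p :: "z5 poly" where p: "lead_coeff p = 1" "poly (map_poly emb p) a = 0"
    using assms integral_over_z5_iff by auto
  show ?thesis
  proof (rule monic_root_in_V5[OF _ _ p(2)])
    show "lead_coeff (map_poly emb p) = 1" using p(1) by (simp add: coeff_map_poly)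
    show "coeff (map_poly emb p) i \<in> V5" for i by (simp add: coeff_map_poly emb_in_V5)
  qed
qed


section \<open>The residue field\<close>

\<comment> \<open>The residue field of \<open>V5\<close>; the quotient is partial because elements
  outside \<open>V5\<close> have no residue. As a type it can be an instance of
  \<open>field\<close>, so that root counts for polynomials apply to it.\<close>
quotient_type rf = "qbar5" / partial: "\<lambda>x y. x \<in> V5 \<and> y \<in> V5 \<and> x - y \<in> M5"
proof (rule part_equivpI)
  show "\<exists>x. x \<in> V5 \<and> x \<in> V5 \<and> x - x \<in> M5"
    using V5_ring(1) zero_in_M5 by (intro exI[of _ 1]) simp
  show "symp (\<lambda>x y. x \<in> V5 \<and> y \<in> V5 \<and> x - y \<in> M5)"
    by (rule sympI) (metis M5_uminus minus_diff_eq)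
  show "transp (\<lambda>x y. x \<in> V5 \<and> y \<in> V5 \<and> x - y \<in> M5)"
  proof (rule transpI)
    fix x y z assume "x \<in> V5 \<and> y \<in> V5 \<and> x - y \<in> M5" "y \<in> V5 \<and> z \<in> V5 \<and> y - z \<in> M5"
    then show "x \<in> V5 \<and> z \<in> V5 \<and> x - z \<in> M5" using M5_add[of "x - y" "y - z"] by simp
  qed
qed

lemma M5_iff_diff: "x - y \<in> M5 \<Longrightarrow> x \<in> M5 \<longleftrightarrow> y \<in> M5"
  using M5_add[of "x - y" y] M5_diff[of x "x - y"] by auto

instantiation rf :: field
begin

lift_definition zero_rf :: rf is 0 by (simp add: V5_ring(2) zero_in_M5)

lift_definition one_rf :: rf is 1 by (simp add: V5_ring(1) zero_in_M5)

lift_definition plus_rf :: "rf \<Rightarrow> rf \<Rightarrow> rf" is "(+)"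
proof -
  fix x x' y y' :: qbar5
  assume "x \<in> V5 \<and> x' \<in> V5 \<and> x - x' \<in> M5" "y \<in> V5 \<and> y' \<in> V5 \<and> y - y' \<in> M5"
  then show "x + y \<in> V5 \<and> x' + y' \<in> V5 \<and> x + y - (x' + y') \<in> M5"
    using M5_add[of "x - x'" "y - y'"] by (simp add: V5_ring(6) algebra_simps)
qed

lift_definition minus_rf :: "rf \<Rightarrow> rf \<Rightarrow> rf" is "(-)"
proof -
  fix x x' y y' :: qbar5
  assume "x \<in> V5 \<and> x' \<in> V5 \<and> x - x' \<in> M5" "y \<in> V5 \<and> y' \<in> V5 \<and> y - y' \<in> M5"
  then show "x - y \<in> V5 \<and> x' - y' \<in> V5 \<and> x - y - (x' - y') \<in> M5"
    using M5_diff[of "x - x'" "y - y'"] by (simp add: V5_ring(3) algebra_simps)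
qed

lift_definition uminus_rf :: "rf \<Rightarrow> rf" is "uminus"
proof -
  fix x x' :: qbar5
  assume "x \<in> V5 \<and> x' \<in> V5 \<and> x - x' \<in> M5"
  then show "- x \<in> V5 \<and> - x' \<in> V5 \<and> - x - - x' \<in> M5"
    using M5_uminus[of "x - x'"] by (simp add: V5_ring(5))
qed

lift_definition times_rf :: "rf \<Rightarrow> rf \<Rightarrow> rf" is "(*)"
proof -
  fix x x' y y' :: qbar5
  assume *: "x \<in> V5 \<and> x' \<in> V5 \<and> x - x' \<in> M5" "y \<in> V5 \<and> y' \<in> V5 \<and> y - y' \<in> M5"
  have "x * y - x' * y' = y * (x - x') + x' * (y - y')" by (simp add: algebra_simps)
  then show "x * y \<in> V5 \<and> x' * y' \<in> V5 \<and> x * y - x' * y' \<in> M5"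
    using * M5_add[OF M5_mult[of "x - x'" y] M5_mult[of "y - y'" x']] by (simp add: V5_ring(4))
qed

lift_definition inverse_rf :: "rf \<Rightarrow> rf" is "\<lambda>x. if x \<in> M5 then 0 else inverse x"
proof -
  fix x y :: qbar5
  assume *: "x \<in> V5 \<and> y \<in> V5 \<and> x - y \<in> M5"
  then have iff: "x \<in> M5 \<longleftrightarrow> y \<in> M5" using M5_iff_diff by blast
  have "inverse x - inverse y \<in> M5" "inverse x \<in> V5" "inverse y \<in> V5" if "x \<notin> M5"
  proof -
    have u: "inverse x \<in> V5" "inverse y \<in> V5" "x \<noteq> 0" "y \<noteq> 0"
      using unit_in_V5 * iff that by blast+
    then show "inverse x \<in> V5" "inverse y \<in> V5" by blast+
    have "inverse x - inverse y = - ((inverse x * inverse y) * (x - y))"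
    proof -
      have "(inverse x * inverse y) * (x - y) = (inverse x * x) * inverse y - (inverse y * y) * inverse x"
        by (simp add: algebra_simps)
      then show ?thesis using u by simp
    qed
    then show "inverse x - inverse y \<in> M5"
      using M5_uminus[OF M5_mult[of "x - y" "inverse x * inverse y"]] u * V5_ring(4) by simp
  qed
  then show "(if x \<in> M5 then 0 else inverse x) \<in> V5 \<and> (if y \<in> M5 then 0 else inverse y) \<in> V5 \<and>
      (if x \<in> M5 then 0 else inverse x) - (if y \<in> M5 then 0 else inverse y) \<in> M5"
    using iff V5_ring(2) zero_in_M5 by auto
qed

definition divide_rf :: "rf \<Rightarrow> rf \<Rightarrow> rf" where "divide_rf x y = x * inverse y"

instance
proof
  fix a b c :: rf
  show "a + b + c = a + (b + c)"
    by transfer (simp add: V5_ring(6) zero_in_M5 add.assoc)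
  show "a + b = b + a"
    by transfer (simp add: V5_ring(6) zero_in_M5 add.commute)
  show "0 + a = a" by transfer simp
  show "- a + a = 0" by transfer (simp add: V5_ring(2) zero_in_M5)
  show "a - b = a + - b" by transfer (simp add: V5_ring(3) zero_in_M5)
  show "a * b * c = a * (b * c)" by transfer (simp add: V5_ring(4) zero_in_M5 mult.assoc)
  show "a * b = b * a" by transfer (simp add: V5_ring(4) zero_in_M5 mult.commute)
  show "1 * a = a" by transfer simp
  show "(a + b) * c = a * c + b * c"
    by transfer (simp add: V5_ring(4,6) zero_in_M5 distrib_right)
  show "(0 :: rf) \<noteq> 1" by transfer (use M5_uminus[of "- 1"] one_notin_M5 in auto)
  show "inverse (0 :: rf) = 0" by transfer (simp add: V5_ring(2) zero_in_M5)
  show "a \<noteq> 0 \<Longrightarrow> inverse a * a = 1"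
  proof transfer
    fix a assume *: "a \<in> V5 \<and> a \<in> V5 \<and> a - a \<in> M5" "\<not> (a \<in> V5 \<and> 0 \<in> V5 \<and> a - 0 \<in> M5)"
    then have "a \<notin> M5" using V5_ring(2) by simp
    then show "(if a \<in> M5 then 0 else inverse a) * a \<in> V5 \<and> 1 \<in> V5 \<and>
       (if a \<in> M5 then 0 else inverse a) * a - 1 \<in> M5"
      using * unit_in_V5[of a] zero_in_M5 V5_ring(1) by simp
  qed
  show "a div b = a * inverse b" by (rule divide_rf_def)
qed

end

definition red :: "qbar5 \<Rightarrow> rf" where "red = abs_rf"

lemma red_ring:
  "red 0 = 0" "red 1 = 1"
  "x \<in> V5 \<Longrightarrow> y \<in> V5 \<Longrightarrow> red (x + y) = red x + red y"
  "x \<in> V5 \<Longrightarrow> y \<in> V5 \<Longrightarrow> red (x - y) = red x - red y"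
  "x \<in> V5 \<Longrightarrow> y \<in> V5 \<Longrightarrow> red (x * y) = red x * red y"
  "x \<in> V5 \<Longrightarrow> red (- x) = - red x"
  unfolding red_def
  by (simp_all add: zero_rf.abs_eq one_rf.abs_eq plus_rf.abs_eq minus_rf.abs_eq times_rf.abs_eq
      uminus_rf.abs_eq zero_in_M5)

lemma red_power: "x \<in> V5 \<Longrightarrow> red (x ^ n) = red x ^ n"
  by (induction n) (simp_all add: red_ring V5_ring)

lemma red_sum: "(\<And>i. i \<in> I \<Longrightarrow> f i \<in> V5) \<Longrightarrow> red (sum f I) = (\<Sum>i\<in>I. red (f i))"
  by (induction I rule: infinite_finite_induct)
     (simp_all add: red_ring is_subring_sum[OF is_subring_V5])

lemma red_of_nat: "red (of_nat n) = of_nat n"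
  by (induction n) (simp_all add: red_ring V5_ring)

lemma red_of_int: "red (of_int k) = of_int k"
  by (cases k) (simp_all add: red_ring V5_ring red_of_nat del: of_nat_Suc)

lemma red_numeral: "red (numeral k) = numeral k"
  using red_of_nat[of "numeral k"] by simp

lemma red_eq_iff: "x \<in> V5 \<Longrightarrow> y \<in> V5 \<Longrightarrow> red x = red y \<longleftrightarrow> x - y \<in> M5"
  using Quotient_rel[OF Quotient_rf, of x y] unfolding red_def by (simp add: zero_in_M5)

lemma red_eq_0_iff: "x \<in> V5 \<Longrightarrow> red x = 0 \<longleftrightarrow> x \<in> M5"
  using red_eq_iff[of x 0] by (simp add: red_ring V5_ring)

lemma red_surj: "\<exists>x\<in>V5. red x = \<xi>"
proof (rule bexI)
  show "red (rep_rf \<xi>) = \<xi>" unfolding red_def by (rule Quotient_abs_rep[OF Quotient_rf])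
  show "rep_rf \<xi> \<in> V5" using Quotient_rep_reflp[OF Quotient_rf, of \<xi>] by simp
qed

lemma red_poly:
  assumes "x \<in> V5"
  shows "poly (of_int_poly p) x \<in> V5 \<and> red (poly (of_int_poly p) x) = poly (of_int_poly p) (red x)"
  by (induction p)
     (simp_all add: V5_ring red_ring map_poly_pCons assms red_of_int)

lemma pderiv_of_int_poly: "pderiv (of_int_poly p :: 'a :: {comm_ring_1, ring_no_zero_divisors} poly) = of_int_poly (pderiv p)"
  by (rule poly_eqI) (simp add: coeff_pderiv coeff_map_poly)

section \<open>Characteristic 5 and the Frobenius map\<close>

lemma rf_five: "(5 :: rf) = 0"
  using red_eq_0_iff[of 5] five_in_M5 V5_ring(10) by (simp add: red_numeral)

lemma CHAR_rf: "CHAR(rf) = 5"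
proof -
  have "CHAR(rf) dvd 5" using of_nat_eq_0_iff_char_dvd[of 5, where ?'a = rf] rf_five by simp
  moreover have "prime (5 :: nat)" by simp
  ultimately have "CHAR(rf) = 1 \<or> CHAR(rf) = 5" using prime_nat_iff by blast
  then show ?thesis by simp
qed

lemma of_int_rf_eq_0_iff: "of_int k = (0 :: rf) \<longleftrightarrow> 5 dvd k"
proof
  assume "5 dvd k"
  then obtain j where "k = 5 * j" by (rule dvdE)
  then show "of_int k = (0 :: rf)" using rf_five by simp
next
  assume k: "of_int k = (0 :: rf)"
  have "k = 5 * (k div 5) + k mod 5" by simp
  then have "(of_int k :: rf) = 5 * of_int (k div 5) + of_int (k mod 5)"
    by (metis of_int_add of_int_mult of_int_numeral)
  then have "of_nat (nat (k mod 5)) = (0 :: rf)" using k rf_five by simp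
  then have "5 dvd nat (k mod 5)" by (simp only: of_nat_eq_0_iff_char_dvd CHAR_rf)
  moreover have "nat (k mod 5) < 5" by (simp add: nat_less_iff)
  ultimately have "nat (k mod 5) = 0" by (meson dvd_imp_le linorder_not_le not_gr_zero)
  then have "k mod 5 \<le> 0" by simp
  then have "k mod 5 = 0" using pos_mod_sign[of 5 k] by simp
  then show "5 dvd k" by (rule mod_0_imp_dvd)
qed

lemma frobenius_add: "(x + y :: rf) ^ 5 ^ n = x ^ 5 ^ n + y ^ 5 ^ n"
  by (rule freshmans_dream') (simp_all add: CHAR_rf)

lemma frobenius_of_int: "(of_int k :: rf) ^ 5 ^ n = of_int k"
proof -
  have nat: "(of_nat m :: rf) ^ 5 ^ n = of_nat m" for m
    by (induction m) (simp_all add: frobenius_add)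
  have "(of_int k :: rf) = of_nat (nat (k mod 5))"
  proof -
    have "5 dvd k - int (nat (k mod 5))" by simp
    then have "of_int (k - int (nat (k mod 5))) = (0 :: rf)" by (simp only: of_int_rf_eq_0_iff)
    then show ?thesis by (simp only: of_int_diff of_int_of_nat_eq) simp
  qed
  then show ?thesis using nat by metis
qed

lemma frobenius_poly: "poly (of_int_poly p) (x :: rf) ^ 5 ^ n = poly (of_int_poly p) (x ^ 5 ^ n)"
  by (induction p) (simp_all add: map_poly_pCons frobenius_add frobenius_of_int power_mult_distrib)

lemma frobenius_inj: "x ^ 5 ^ n = y ^ 5 ^ n \<Longrightarrow> x = (y :: rf)"
proof -
  assume "x ^ 5 ^ n = y ^ 5 ^ n"
  moreover have "x ^ 5 ^ n = (x - y) ^ 5 ^ n + y ^ 5 ^ n"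
    using frobenius_add[of "x - y" y n] by simp
  ultimately show "x = y" by simp
qed

text \<open>With \<open>h = y - x\<close> the Taylor expansion gives 0 = h (p'(x) + r h). If
  \<open>h\<close> is nonzero, then p'(x) = - r h lies in \<open>M5\<close>, against the simplicity
  of the residue as a root.\<close>

lemma root_lift_unique:
  assumes xy: "x \<in> V5" "y \<in> V5" "red x = red y"
    and p: "poly (of_int_poly p) x = 0" "poly (of_int_poly p) y = 0"
    and p': "poly (of_int_poly (pderiv p)) (red x) \<noteq> 0"
  shows "x = y"
proof (rule ccontr)
  assume "x \<noteq> y"
  define h where "h = y - x"
  have h: "h \<noteq> 0" "h \<in> V5" "h \<in> M5" "y = x + h"
    using \<open>x \<noteq> y\<close> xy V5_ring(3) red_eq_iff[of y x] by (auto simp: h_def)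
  obtain r where r: "r \<in> V5" "poly (of_int_poly p) (x + h) = poly (of_int_poly p) x
      + h * poly (pderiv (of_int_poly p)) x + h ^ 2 * r"
    using poly_taylor_2[OF is_subring_V5 xy(1) h(2), of "of_int_poly p"] V5_ring(9)
    by (auto simp: coeff_map_poly)
  have "h * (poly (pderiv (of_int_poly p)) x + r * h) = 0"
    using r(2) p h(4) by (simp add: algebra_simps power2_eq_square)
  then have "poly (pderiv (of_int_poly p)) x + r * h = 0" using h(1) by simp
  then have "poly (pderiv (of_int_poly p)) x = - (r * h)" by (simp add: eq_neg_iff_add_eq_0)
  moreover have "- (r * h) \<in> M5" using M5_uminus[OF M5_mult[OF h(3) r(1)]] .
  ultimately have "poly (of_int_poly (pderiv p)) x \<in> M5" by (simp add: pderiv_of_int_poly)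
  then show False using red_poly[OF xy(1), of "pderiv p"] red_eq_0_iff p' by metis
qed

text \<open>The field with 5^n elements as the fixed points of a Frobenius power. For
  \<open>n = 0\<close> the condition is void and the set is all of \<open>rf\<close>, a convention
  that makes the reduction of exponents in \<open>Fq_mod\<close> true.\<close>

definition Fq :: "nat \<Rightarrow> rf set" where
  "Fq n = {\<xi>. \<xi> ^ 5 ^ n = \<xi>}"

lemma card_Fq_le: "n \<ge> 1 \<Longrightarrow> finite (Fq n) \<and> card (Fq n) \<le> 5 ^ n"
proof -
  assume n: "n \<ge> 1"
  let ?p = "monom 1 (5 ^ n) - [:0, 1:] :: rf poly"
  have gt: "(5 :: nat) ^ n > 1" using n one_less_power[of "5 :: nat" n] by simp
  then have "coeff ?p (5 ^ n) = 1" using n by (simp add: coeff_pCons split: nat.split)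
  then have p: "?p \<noteq> 0" by force
  have "degree ?p \<le> 5 ^ n"
    by (rule degree_diff_le) (use gt in \<open>auto simp: degree_monom_eq\<close>)
  moreover have "Fq n = {x. poly ?p x = 0}" by (simp add: Fq_def poly_monom)
  ultimately show ?thesis using poly_roots_finite[OF p] card_poly_roots_bound[OF p] by simp
qed

text \<open>The lower bound is transported from characteristic 0: X^(5^n) - X has 5^n distinct roots
  in the algebraic closure, all in \<open>V5\<close>, and reduction is injective on them because the
  derivative reduces to -1.\<close>

lemma card_Fq: "n \<ge> 1 \<Longrightarrow> card (Fq n) = 5 ^ n"
proof -
  assume n: "n \<ge> 1"
  define P :: "int poly" where "P = monom 1 (5 ^ n) - [:0, 1:]"
  let ?p = "of_int_poly P :: qbar5 poly"
  have gt: "(5 :: nat) ^ n > 1" using n one_less_power[of "5 :: nat" n] by simp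
  have p_eq: "?p = monom 1 (5 ^ n) - [:0, 1:]"
    by (simp add: P_def of_int_poly_hom.hom_minus map_poly_pCons)
  have c1: "coeff ?p (5 ^ n) = 1" using gt n by (simp add: p_eq coeff_pCons split: nat.split)
  then have p: "?p \<noteq> 0" by force
  have "degree ?p \<le> 5 ^ n" unfolding p_eq
    by (rule degree_diff_le) (use gt in \<open>auto simp: degree_monom_eq\<close>)
  with c1 have deg: "degree ?p = 5 ^ n" by (simp add: le_antisym le_degree)
  have V: "x \<in> V5" if "poly ?p x = 0" for x
  proof (rule monic_root_in_V5[OF _ _ that])
    show "lead_coeff ?p = 1" unfolding deg by (rule c1)
    show "coeff ?p i \<in> V5" for i by (simp add: coeff_map_poly V5_ring(9))
  qed
  have der: "poly (of_int_poly (pderiv P)) \<xi> = - 1" for \<xi> :: rf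
  proof -
    have "(of_nat (5 ^ n) :: rf) = 0" using n rf_five by (cases n) simp_all
    then show ?thesis
      by (simp add: P_def pderiv_diff pderiv_monom pderiv_pCons of_int_poly_hom.hom_minus poly_monom map_poly_monom)
  qed
  have der0: "poly (pderiv ?p) x \<noteq> 0" if "poly ?p x = 0" for x
    using red_poly[OF V[OF that], of "pderiv P"] der[of "red x"] by (auto simp: pderiv_of_int_poly red_ring)
  obtain A where A: "size A = 5 ^ n" "?p = (\<Prod>x\<in>#A. [:- x, 1:])"
    using alg_closed_imp_factorization[OF p] c1 deg by auto
  have roots: "poly ?p x = 0 \<longleftrightarrow> x \<in># A" for x
    by (subst A(2)) (auto simp: poly_prod_mset prod_mset_zero_iff)
  have "count A x = 1" if "x \<in># A" for x
  proof (rule ccontr)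
    assume "count A x \<noteq> 1"
    with that obtain B where B: "A = add_mset x B" "x \<in># B"
      by (metis One_nat_def count_add_mset count_greater_zero_iff mset_add not_gr_zero)
    then obtain C where C: "A = add_mset x (add_mset x C)" by (metis mset_add)
    have "?p = [:- x, 1:] * ([:- x, 1:] * (\<Prod>x\<in>#C. [:- x, 1:]))"
      by (subst A(2)) (simp add: C)
    then have "poly (pderiv ?p) x = 0" by (simp only: pderiv_mult) simp
    then show False using der0[of x] roots[of x] that by blast
  qed
  then have "size A = card (set_mset A)" by (simp add: size_multiset_overloaded_eq)
  then have Z: "card {x. poly ?p x = 0} = 5 ^ n" using A(1) roots by simp
  have inj: "inj_on red {x. poly ?p x = 0}"
  proof (rule inj_onI)
    fix x y assume *: "x \<in> {x. poly ?p x = 0}" "y \<in> {x. poly ?p x = 0}" "red x = red y"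
    show "x = y"
      by (rule root_lift_unique[of x y P]) (use * V der in auto)
  qed
  have "red ` {x. poly ?p x = 0} \<subseteq> Fq n"
  proof
    fix \<xi> assume "\<xi> \<in> red ` {x. poly ?p x = 0}"
    then obtain x where x: "\<xi> = red x" "poly ?p x = 0" by auto
    then have "poly (of_int_poly P) (red x) = 0" using red_poly[OF V[OF x(2)], of P] by (simp add: red_ring)
    then show "\<xi> \<in> Fq n"
      by (simp add: Fq_def x P_def of_int_poly_hom.hom_minus map_poly_pCons poly_monom map_poly_monom)
  qed
  from card_mono[OF _ this] card_image[OF inj] Z card_Fq_le[OF n] show ?thesis by simp
qed

definition exact_degree :: "nat \<Rightarrow> rf \<Rightarrow> bool" where
  "exact_degree n \<xi> \<longleftrightarrow> \<xi> \<in> Fq n \<and> (\<forall>d. 1 \<le> d \<and> d < n \<longrightarrow> \<xi> \<notin> Fq d)"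

text \<open>The sets \<open>Fq d\<close> with smaller \<open>d\<close> are too small to cover
  \<open>Fq n\<close>: 5 + ... + 5^(n-1) < 5^n.\<close>

lemma ex_exact_degree: "n \<ge> 1 \<Longrightarrow> \<exists>\<xi>. exact_degree n \<xi>"
proof (rule ccontr)
  assume n: "n \<ge> 1" and "\<nexists>\<xi>. exact_degree n \<xi>"
  have "Fq n \<subseteq> (\<Union>d\<in>{1..<n}. Fq d)"
  proof
    fix \<xi> assume "\<xi> \<in> Fq n"
    then obtain d where "1 \<le> d \<and> d < n" "\<xi> \<in> Fq d"
      using \<open>\<nexists>\<xi>. exact_degree n \<xi>\<close> unfolding exact_degree_def by blast
    then show "\<xi> \<in> (\<Union>d\<in>{1..<n}. Fq d)" by auto
  qed
  then have "card (Fq n) \<le> card (\<Union>d\<in>{1..<n}. Fq d)"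
    using card_Fq_le by (intro card_mono) auto
  also have "\<dots> \<le> (\<Sum>d\<in>{1..<n}. card (Fq d))" by (rule card_UN_le) simp
  also have "\<dots> \<le> (\<Sum>d\<in>{1..<n}. 5 ^ d)" by (intro sum_mono) (use card_Fq_le in auto)
  also have "\<dots> < (5 :: nat) ^ n"
    using n by (induction n rule: nat_induct_at_least) (auto simp: sum.atLeastLessThan_Suc)
  finally show False using card_Fq[OF n] by simp
qed

text \<open>The elements \<xi>^(5^i) for i < n are distinct, and all are roots along with \<xi>
  because the coefficients lie in the prime field; a degree below n then leaves only the zero
  polynomial. Stated with nonmembership only, the lemma also covers residues lying in no
  \<open>Fq d\<close> at all.\<close>

lemma exact_degree_independent:
  fixes p :: "int poly"
  assumes \<xi>: "\<And>d. 1 \<le> d \<Longrightarrow> d < n \<Longrightarrow> \<xi> \<notin> Fq d"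
    and p: "degree p < n" "poly (of_int_poly p) \<xi> = 0"
  shows "5 dvd coeff p i"
proof -
  have inj: "inj_on (\<lambda>i. \<xi> ^ 5 ^ i) {..<n}"
  proof (rule linorder_inj_onI')
    fix i j assume ij: "i \<in> {..<n}" "j \<in> {..<n}" "i < j"
    show "\<xi> ^ 5 ^ i \<noteq> \<xi> ^ 5 ^ j"
    proof
      assume "\<xi> ^ 5 ^ i = \<xi> ^ 5 ^ j"
      also have "(5 :: nat) ^ j = 5 ^ (j - i) * 5 ^ i" using ij by (simp flip: power_add)
      also have "\<xi> ^ (5 ^ (j - i) * 5 ^ i) = (\<xi> ^ 5 ^ (j - i)) ^ 5 ^ i" by (rule power_mult)
      finally have "\<xi> = \<xi> ^ 5 ^ (j - i)" by (rule frobenius_inj)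
      then have "\<xi> \<in> Fq (j - i)" unfolding Fq_def by simp
      moreover have "1 \<le> j - i" "j - i < n" using ij by auto
      ultimately show False using \<xi> by blast
    qed
  qed
  let ?q = "of_int_poly p :: rf poly"
  have "?q = 0"
  proof (rule ccontr)
    assume nz: "?q \<noteq> 0"
    have "(\<lambda>i. \<xi> ^ 5 ^ i) ` {..<n} \<subseteq> {x. poly ?q x = 0}"
    proof (rule image_subsetI)
      fix i
      show "\<xi> ^ 5 ^ i \<in> {x. poly ?q x = 0}" using frobenius_poly[of p \<xi> i] p(2) by (simp add: zero_power)
    qed
    from card_mono[OF poly_roots_finite[OF nz] this] have "n \<le> card {x. poly ?q x = 0}"
      by (simp add: card_image[OF inj])
    also have "\<dots> \<le> degree ?q" by (rule card_poly_roots_bound[OF nz])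
    also have "\<dots> \<le> degree p" by (rule degree_map_poly_le)
    finally show False using p by simp
  qed
  then have "coeff ?q i = 0" by simp
  then show ?thesis by (simp add: coeff_map_poly of_int_rf_eq_0_iff)
qed

lemma degree_sum_monom_less:
  assumes "n \<ge> 1"
  shows "degree (\<Sum>i<n. monom (c i) i) < n"
proof (rule degree_sum_less)
  show "degree (monom (c i) i) < n" if "i \<in> {..<n}" for i
    using that le_less_trans[OF degree_monom_le[of "c i" i]] by simp
qed (use assms in simp)

text \<open>A count: the 5^n combinations with digits from 0 to 4 are distinct by independence and
  lie in \<open>Fq n\<close>, so they exhaust it.\<close>

lemma exact_degree_spans:
  assumes n: "n \<ge> 1" and \<xi>: "exact_degree n \<xi>" and \<beta>: "\<beta> \<in> Fq n"
  shows "\<exists>c :: nat \<Rightarrow> int. \<beta> = (\<Sum>i<n. of_int (c i) * \<xi> ^ i)"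
proof -
  define S where "S = ({..<n} \<rightarrow>\<^sub>E {0..<5 :: int})"
  define ev where "ev c = (\<Sum>i<n. of_int (c i) * \<xi> ^ i)" for c :: "nat \<Rightarrow> int"
  have ev_poly: "ev c = poly (of_int_poly (\<Sum>i<n. monom (c i) i)) \<xi>" for c
    by (simp add: ev_def of_int_poly_hom.hom_sum poly_sum poly_monom map_poly_monom)
  have "card S = 5 ^ n" by (simp add: S_def card_PiE)
  moreover have "inj_on ev S"
  proof (rule inj_onI)
    fix c d assume cd: "c \<in> S" "d \<in> S" "ev c = ev d"
    let ?p = "\<Sum>i<n. monom (c i - d i) i"
    have "poly (of_int_poly ?p) \<xi> = ev (\<lambda>i. c i - d i)" by (rule ev_poly[symmetric])
    also have "\<dots> = ev c - ev d" by (simp add: ev_def left_diff_distrib sum_subtractf)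
    finally have p0: "poly (of_int_poly ?p) \<xi> = 0" using cd(3) by simp
    have deg: "degree ?p < n" by (rule degree_sum_monom_less[OF n])
    have dvd: "5 dvd coeff ?p i" for i
      by (rule exact_degree_independent[OF _ deg p0]) (use \<xi> in \<open>simp add: exact_degree_def\<close>)
    have dvd': "5 dvd c i - d i" if "i < n" for i
    proof -
      have "coeff ?p i = c i - d i" using that by (simp add: coeff_sum)
      then show ?thesis using dvd[of i] by simp
    qed
    show "c = d"
    proof (rule PiE_ext[OF cd(1,2)[unfolded S_def]])
      fix i assume i: "i \<in> {..<n}"
      have "c i \<in> {0..<5}" "d i \<in> {0..<5}"
        using PiE_mem[OF cd(1)[unfolded S_def] i] PiE_mem[OF cd(2)[unfolded S_def] i] .
      then have "c i mod 5 = c i" "d i mod 5 = d i" by (simp_all add: mod_pos_pos_trivial)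
      moreover have "c i mod 5 = d i mod 5" using i unfolding mod_eq_dvd_iff by (intro dvd') simp
      ultimately show "c i = d i" by metis
    qed
  qed
  ultimately have "card (ev ` S) = 5 ^ n" by (simp add: card_image)
  moreover have sub: "ev ` S \<subseteq> Fq n"
  proof -
    have "ev c ^ 5 ^ n = ev c" for c
      unfolding ev_poly frobenius_poly using \<xi> by (simp add: exact_degree_def Fq_def)
    then have "ev c \<in> Fq n" for c unfolding Fq_def by (rule CollectI)
    then show ?thesis by (rule image_subsetI)
  qed
  ultimately have "ev ` S = Fq n" using card_Fq[OF n] card_Fq_le[OF n] by (intro card_subset_eq) auto
  with \<beta> obtain c where "\<beta> = ev c" by blast
  then show ?thesis unfolding ev_def by (rule exI[of _ c])
qed


section \<open>Integral elements\<close>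

text \<open>The condition \<open>\<theta> ^ n \<in> zspan \<theta> n\<close>, which recurs below,
  says that \<theta> is a root of a monic polynomial of degree \<open>n\<close> over the 5-adic
  integers; it makes this module a ring.\<close>

definition zspan :: "qbar5 \<Rightarrow> nat \<Rightarrow> qbar5 set" where
  "zspan \<theta> n = range (\<lambda>c. \<Sum>i<n. emb (c i) * \<theta> ^ i)"

lemma map_poly_emb_pCons [simp]: "map_poly emb (pCons a p) = pCons (emb a) (map_poly emb p)"
  by (rule poly_eqI) (simp add: coeff_map_poly coeff_pCons split: nat.split)

lemma zspanI: "(\<Sum>i<n. emb (c i) * \<theta> ^ i) \<in> zspan \<theta> n"
  unfolding zspan_def by (rule rangeI)

lemma zspanE:
  assumes "x \<in> zspan \<theta> n"
  obtains c where "x = (\<Sum>i<n. emb (c i) * \<theta> ^ i)"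
  using assms unfolding zspan_def by (rule rangeE)

lemma zspan_diff: "x \<in> zspan \<theta> n \<Longrightarrow> y \<in> zspan \<theta> n \<Longrightarrow> x - y \<in> zspan \<theta> n"
proof (elim zspanE)
  fix c d assume "x = (\<Sum>i<n. emb (c i) * \<theta> ^ i)" "y = (\<Sum>i<n. emb (d i) * \<theta> ^ i)"
  then have "x - y = (\<Sum>i<n. emb (c i - d i) * \<theta> ^ i)"
    by (simp add: emb.hom_minus left_diff_distrib sum_subtractf)
  then show ?thesis using zspanI by metis
qed

lemma zspan_emb_mult: "x \<in> zspan \<theta> n \<Longrightarrow> emb a * x \<in> zspan \<theta> n"
proof (elim zspanE)
  fix c assume "x = (\<Sum>i<n. emb (c i) * \<theta> ^ i)"
  then have "emb a * x = (\<Sum>i<n. emb (a * c i) * \<theta> ^ i)"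
    by (simp add: emb.hom_mult sum_distrib_left mult.assoc)
  then show ?thesis using zspanI by metis
qed

lemma zspan_zero: "0 \<in> zspan \<theta> n"
  using zspanI[where c = "\<lambda>_. 0" and \<theta> = \<theta> and n = n] by simp

lemma zspan_add: "x \<in> zspan \<theta> n \<Longrightarrow> y \<in> zspan \<theta> n \<Longrightarrow> x + y \<in> zspan \<theta> n"
  using zspan_diff[of x \<theta> n "0 - y"] zspan_diff[OF zspan_zero, of y \<theta> n] by simp

lemma zspan_sum: "(\<And>i. i \<in> I \<Longrightarrow> f i \<in> zspan \<theta> n) \<Longrightarrow> sum f I \<in> zspan \<theta> n"
  by (induction I rule: infinite_finite_induct) (simp_all add: zspan_zero zspan_add)

lemma zspan_power_less: "i < n \<Longrightarrow> \<theta> ^ i \<in> zspan \<theta> n"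
proof -
  assume i: "i < n"
  have "(\<Sum>j<n. emb (if j = i then 1 else 0) * \<theta> ^ j) = (\<Sum>j<n. if j = i then \<theta> ^ j else 0)"
    by (intro sum.cong) simp_all
  also have "\<dots> = \<theta> ^ i" using i by (simp add: sum.delta)
  finally show ?thesis using zspanI[where c = "\<lambda>j. if j = i then 1 else 0" and \<theta> = \<theta> and n = n] by metis
qed

lemma zspan_power:
  assumes "\<theta> ^ n \<in> zspan \<theta> n"
  shows "\<theta> ^ k \<in> zspan \<theta> n"
proof -
  have step: "\<theta> * x \<in> zspan \<theta> n" if x: "x \<in> zspan \<theta> n" for x
  proof -
    obtain c where c: "x = (\<Sum>i<n. emb (c i) * \<theta> ^ i)" using x by (rule zspanE)
    have "\<theta> * x = (\<Sum>i<n. emb (c i) * \<theta> ^ Suc i)"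
      by (simp add: c sum_distrib_left mult_ac)
    moreover have "\<theta> ^ Suc i \<in> zspan \<theta> n" if "i < n" for i
      using that assms zspan_power_less[of "Suc i" n \<theta>] by (cases "Suc i = n") auto
    ultimately show ?thesis by (simp only:) (rule zspan_sum, rule zspan_emb_mult, simp)
  qed
  show ?thesis
  proof (induction k)
    case 0
    show ?case
    proof (cases "n = 0")
      case True
      then show ?thesis using assms by simp
    next
      case False
      then show ?thesis using zspan_power_less[of 0 n \<theta>] by simp
    qed
  next
    case (Suc k)
    then show ?case using step by simp
  qed
qed

lemma zspan_mult:
  assumes "\<theta> ^ n \<in> zspan \<theta> n" "x \<in> zspan \<theta> n" "y \<in> zspan \<theta> n"
  shows "x * y \<in> zspan \<theta> n"
proof -
  obtain c where c: "x = (\<Sum>i<n. emb (c i) * \<theta> ^ i)" using assms(2) by (rule zspanE)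
  obtain d where d: "y = (\<Sum>i<n. emb (d i) * \<theta> ^ i)" using assms(3) by (rule zspanE)
  have "x * y = (\<Sum>i<n. \<Sum>j<n. emb (c i * d j) * \<theta> ^ (i + j))"
    unfolding c d sum_product by (intro sum.cong refl) (simp add: emb.hom_mult power_add mult.assoc mult.left_commute)
  then show ?thesis
    by (simp only:) (intro zspan_sum zspan_emb_mult zspan_power[OF assms(1)])
qed

lemma is_subring_zspan:
  assumes "\<theta> ^ n \<in> zspan \<theta> n"
  shows "is_subring (zspan \<theta> n)"
  unfolding is_subring_def
  using zspan_power[OF assms, of 0] zspan_mult[OF assms] zspan_diff by simp

lemma emb_in_zspan:
  assumes "\<theta> ^ n \<in> zspan \<theta> n"
  shows "emb a \<in> zspan \<theta> n"
  using zspan_emb_mult[OF zspan_power[OF assms, of 0], of a] by simp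

text \<open>Multiplication by an element of the ring is an endomorphism of the spanned module; the
  characteristic polynomial of its matrix witnesses integrality.\<close>

lemma zspan_integral:
  assumes n: "n \<ge> 1" and \<theta>: "\<theta> ^ n \<in> zspan \<theta> n" and x: "x \<in> zspan \<theta> n"
  shows "integral_over_z5 x"
proof -
  have "\<forall>i. \<exists>c. x * \<theta> ^ i = (\<Sum>j<n. emb (c j) * \<theta> ^ j)"
  proof
    fix i
    from zspan_mult[OF \<theta> x zspan_power[OF \<theta>, of i]] obtain c where "x * \<theta> ^ i = (\<Sum>j<n. emb (c j) * \<theta> ^ j)"
      by (rule zspanE)
    then show "\<exists>c. x * \<theta> ^ i = (\<Sum>j<n. emb (c j) * \<theta> ^ j)" by (rule exI[of _ c])
  qed
  then obtain C where C: "x * \<theta> ^ i = (\<Sum>j<n. emb (C i j) * \<theta> ^ j)" for i by metis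
  define A where "A = mat n n (\<lambda>(i, j). C i j)"
  have A: "A \<in> carrier_mat n n" by (simp add: A_def)
  define v where "v = vec n (\<lambda>i. \<theta> ^ i)"
  have "map_mat emb A *\<^sub>v v = x \<cdot>\<^sub>v v"
    by (rule eq_vecI) (auto simp: A_def v_def scalar_prod_def C atLeast0LessThan)
  moreover have "v \<noteq> 0\<^sub>v n"
  proof
    assume "v = 0\<^sub>v n"
    then have "v $ 0 = 0" using n by simp
    then show False using n by (simp add: v_def)
  qed
  moreover have "v \<in> carrier_vec n" by (simp add: v_def)
  ultimately have "eigenvector (map_mat emb A) v x"
    by (simp add: eigenvector_def A_def)
  then have "eigenvalue (map_mat emb A) x" unfolding eigenvalue_def by (rule exI)
  then have "poly (char_poly (map_mat emb A)) x = 0"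
    using eigenvalue_root_char_poly[of "map_mat emb A" n x] A by simp
  then have "poly (map_poly emb (char_poly A)) x = 0"
    using comm_ring_hom.char_poly_hom[OF emb.comm_ring_hom_axioms A] by simp
  then show ?thesis unfolding integral_over_z5_iff
    using degree_monic_char_poly[OF A] by (intro exI[of _ "char_poly A"]) simp
qed

lemma integral_power_in_zspan:
  assumes "integral_over_z5 a"
  shows "\<exists>n\<ge>1. a ^ n \<in> zspan a n"
proof -
  obtain p where p: "lead_coeff p = 1" "poly (map_poly emb p) a = 0"
    using assms integral_over_z5_iff by auto
  define n where "n = degree p"
  have "n \<noteq> 0"
  proof
    assume "n = 0"
    then have "degree p = 0" by (simp add: n_def)
    then obtain c where c: "p = [:c:]" by (rule degree_eq_zeroE)
    then show False using p by (simp add: map_poly_pCons)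
  qed
  have "0 = (\<Sum>i\<le>n. emb (coeff p i) * a ^ i)"
    using p(2) by (simp add: poly_altdef coeff_map_poly n_def)
  also have "{..n} = insert n {..<n}" by auto
  also have "(\<Sum>i\<in>\<dots>. emb (coeff p i) * a ^ i) = a ^ n + (\<Sum>i<n. emb (coeff p i) * a ^ i)"
    using p(1) by (simp add: n_def)
  finally have "a ^ n = 0 - (\<Sum>i<n. emb (coeff p i) * a ^ i)"
    by (simp add: eq_neg_iff_add_eq_0)
  then have "a ^ n \<in> zspan a n" using zspan_diff[OF zspan_zero zspanI] by metis
  then show ?thesis using \<open>n \<noteq> 0\<close> by (intro exI[of _ n]) simp
qed

lemma integral_over_z5_poly:
  assumes "integral_over_z5 a"
  shows "integral_over_z5 (poly (map_poly emb q) a)"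
proof -
  obtain n where n: "n \<ge> 1" "a ^ n \<in> zspan a n" using integral_power_in_zspan[OF assms] by blast
  have "poly (map_poly emb q) a \<in> zspan a n"
    unfolding poly_altdef
    by (intro zspan_sum) (simp add: coeff_map_poly zspan_emb_mult zspan_power[OF n(2)])
  then show ?thesis by (rule zspan_integral[OF n])
qed

section \<open>Clearing denominators by powers of 5\<close>

lemma root_of_z5_poly: "\<exists>p :: z5 poly. p \<noteq> 0 \<and> poly (map_poly emb p) a = 0"
proof -
  obtain p :: "q5 poly" where p: "p \<noteq> 0" "poly (map_poly to_ac p) a = 0"
    by (rule alg_closure_algebraic)
  have "\<exists>d q. d \<noteq> 0 \<and> smult (to_fract d) p = map_poly to_fract q" for p :: "q5 poly"
  proof (induction p)
    case 0
    show ?case by (intro exI[of _ 1] exI[of _ 0]) simp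
  next
    case (pCons x p)
    then obtain d q where d: "d \<noteq> 0" "smult (to_fract d) p = map_poly to_fract q" by blast
    obtain u v where x: "x = Fract u v" "v \<noteq> 0" by (cases x) auto
    then have xv: "to_fract v * x = to_fract u" by (simp add: to_fract_def eq_fract)
    have "smult (to_fract (v * d)) (pCons x p) = pCons (to_fract d * (to_fract v * x)) (smult (to_fract v) (smult (to_fract d) p))"
      by (simp add: mult_ac)
    also have "\<dots> = map_poly to_fract (pCons (d * u) (smult v q))"
      unfolding xv d(2) by (rule poly_eqI) (simp add: coeff_map_poly coeff_pCons split: nat.split)
    finally show ?case using x d by (intro exI[of _ "v * d"] exI[of _ "pCons (d * u) (smult v q)"]) simp
  qed
  then obtain d q where d: "d \<noteq> 0" "smult (to_fract d) p = map_poly to_fract q" by blast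
  have "q \<noteq> 0" using d p(1) by auto
  moreover have "map_poly emb q = map_poly to_ac (map_poly to_fract q)"
    by (rule poly_eqI) (simp add: coeff_map_poly emb_to_fract)
  moreover have "\<dots> = smult (to_ac (to_fract d)) (map_poly to_ac p)"
    unfolding d(2)[symmetric] by (rule poly_eqI) (simp add: coeff_map_poly)
  ultimately show ?thesis using p(2) by (intro exI[of _ q]) simp
qed

text \<open>An annihilating polynomial with nonzero constant term x exhibits x as \<open>a\<close>
  times a polynomial in \<open>a\<close>, and x divides a power of 5. So 1/a lies in the ring
  generated by \<open>a\<close> once 5 is inverted.\<close>

lemma pow5_quotient_poly:
  assumes "a \<noteq> 0"
  shows "\<exists>c k. a * poly (map_poly emb c) a = 5 ^ k"
proof -
  have "\<exists>q :: z5 poly. coeff q 0 \<noteq> 0 \<and> poly (map_poly emb q) a = 0"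
    if "p \<noteq> 0" "poly (map_poly emb p) a = 0" for p :: "z5 poly"
    using that
  proof (induction p)
    case (pCons x p)
    show ?case
    proof (cases "x = 0")
      case True
      then show ?thesis using pCons assms by simp
    next
      case False
      then show ?thesis using pCons.prems by (intro exI[of _ "pCons x p"]) simp
    qed
  qed simp
  then obtain q where q: "coeff q 0 \<noteq> 0" "poly (map_poly emb q) a = 0"
    using root_of_z5_poly[of a] by blast
  obtain x r where xr: "q = pCons x r" by (cases q)
  have "x \<noteq> 0" using q(1) unfolding xr by simp
  from z5_dvd_pow5[OF this] obtain k where "x dvd 5 ^ k" by blast
  then obtain e where "5 ^ k = x * e" by (rule dvdE)
  then have e: "5 ^ k = emb x * emb e" using emb.hom_mult emb.hom_power emb_numeral by metis
  have "emb x = a * (- poly (map_poly emb r) a)"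
    using q(2) unfolding xr by (simp add: eq_neg_iff_add_eq_0)
  then have "5 ^ k = a * (emb (- e) * poly (map_poly emb r) a)"
    unfolding e by (simp add: emb.hom_uminus)
  also have "emb (- e) * poly (map_poly emb r) a = poly (map_poly emb (smult (- e) r)) a"
  proof -
    have "map_poly emb (smult (- e) r) = smult (emb (- e)) (map_poly emb r)"
      by (rule poly_eqI) (simp add: coeff_map_poly emb.hom_mult emb.hom_uminus)
    then show ?thesis by simp
  qed
  finally show ?thesis by metis
qed

text \<open>Scaling by the leading coefficient \<open>c\<close> makes a root integral: multiply the
  equation by c^(n-1) and read it as monic in b = c a. Then replace \<open>c\<close> by a power of 5
  that it divides.\<close>

lemma pow5_mult_integral: "\<exists>k. integral_over_z5 (5 ^ k * a)"
proof -
  obtain p :: "z5 poly" where p: "p \<noteq> 0" "poly (map_poly emb p) a = 0" using root_of_z5_poly by blast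
  define n where "n = degree p"
  define c where "c = lead_coeff p"
  have c: "c \<noteq> 0" using p(1) by (simp add: c_def)
  have "n \<noteq> 0"
  proof
    assume "n = 0"
    then have "degree p = 0" by (simp add: n_def)
    then obtain d where d: "p = [:d:]" by (rule degree_eq_zeroE)
    then show False using p by (simp add: map_poly_pCons)
  qed
  define b where "b = emb c * a"
  have "b ^ n \<in> zspan b n"
  proof -
    have "0 = emb c ^ (n - 1) * (\<Sum>i\<le>n. emb (coeff p i) * a ^ i)"
      using p(2) by (simp add: poly_altdef coeff_map_poly n_def)
    also have "{..n} = insert n {..<n}" by auto
    also have "(\<Sum>i\<in>\<dots>. emb (coeff p i) * a ^ i) = emb c * a ^ n + (\<Sum>i<n. emb (coeff p i) * a ^ i)"
      by (simp add: n_def c_def)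
    also have "emb c ^ (n - 1) * \<dots> = b ^ n + (\<Sum>i<n. emb (coeff p i * c ^ (n - 1 - i)) * b ^ i)"
    proof -
      have "emb c ^ (n - 1) * (emb c * a ^ n) = b ^ n"
      proof -
        have "emb c ^ n = emb c ^ (n - 1) * emb c" using \<open>n \<noteq> 0\<close> by (simp flip: power_Suc2)
        then show ?thesis by (simp add: b_def power_mult_distrib mult.assoc)
      qed
      moreover have "emb c ^ (n - 1) * (emb (coeff p i) * a ^ i) = emb (coeff p i * c ^ (n - 1 - i)) * b ^ i"
        if "i < n" for i
      proof -
        have "emb c ^ (n - 1) = emb c ^ (n - 1 - i) * emb c ^ i" using that by (simp flip: power_add)
        then show ?thesis by (simp add: b_def power_mult_distrib emb.hom_mult emb.hom_power mult_ac)
      qed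
      ultimately show ?thesis unfolding distrib_left sum_distrib_left by simp
    qed
    finally have "b ^ n = 0 - (\<Sum>i<n. emb (coeff p i * c ^ (n - 1 - i)) * b ^ i)"
      by (simp add: eq_neg_iff_add_eq_0)
    then show ?thesis using zspan_diff[OF zspan_zero zspanI] by metis
  qed
  moreover from z5_dvd_pow5[OF c] obtain k where "c dvd 5 ^ k" by blast
  then obtain d where "5 ^ k = c * d" by (rule dvdE)
  then have "5 ^ k = emb c * emb d" using emb.hom_mult emb.hom_power emb_numeral by metis
  then have "5 ^ k * a = emb d * b" by (simp add: b_def mult_ac)
  ultimately have "5 ^ k * a \<in> zspan b n"
    using zspan_emb_mult[OF zspan_power[of b n 1]] by simp
  then have "integral_over_z5 (5 ^ k * a)"
    using zspan_integral[of n b] \<open>n \<noteq> 0\<close> \<open>b ^ n \<in> zspan b n\<close> by simp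
  then show ?thesis by (rule exI)
qed


section \<open>Subfields and spans of powers\<close>

interpretation Qb: cring qbar5_ring
  by (rule cring_from_type_algebra)

lemma field_qbar5_ring: "Ring.field qbar5_ring"
  by (rule field_from_type_algebra)

lemma Qb_simps [simp]:
  "carrier qbar5_ring = UNIV" "monoid.mult qbar5_ring x y = x * y" "add qbar5_ring x y = x + y"
  "zero qbar5_ring = 0" "one qbar5_ring = 1"
  by (simp_all add: ring_of_type_algebra_def)

lemma Qb_a_inv [simp]: "a_inv qbar5_ring x = - x"
  by (rule Qb.minus_equality) simp_all

lemma Qb_m_inv: "x \<noteq> 0 \<Longrightarrow> m_inv qbar5_ring x = inverse x"
  by (rule Qb.comm_inv_char) simp_all

lemma subfield_setI:
  assumes "is_subring K" "\<And>x. x \<in> K \<Longrightarrow> x \<noteq> 0 \<Longrightarrow> inverse x \<in> K"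
  shows "subfield K qbar5_ring"
proof (rule field.subfieldI'[OF field_qbar5_ring])
  show "subring K qbar5_ring"
    by (rule Qb.subringI) (simp_all add: is_subringD[OF assms(1)])
  show "m_inv qbar5_ring k \<in> K" if "k \<in> K - {zero qbar5_ring}" for k
    using that assms(2)[of k] by (simp add: Qb_m_inv)
qed

lemma subfield_setD:
  assumes "subfield K qbar5_ring"
  shows "is_subring K" "x \<in> K \<Longrightarrow> inverse x \<in> K"
proof -
  note sr = subringE[OF subfieldE(1)[OF assms]]
  show 1: "is_subring K"
    unfolding is_subring_def
  proof (intro conjI ballI)
    show "1 \<in> K" using sr(3) by simp
    fix x y assume xy: "x \<in> K" "y \<in> K"
    show "x * y \<in> K" using sr(6)[OF xy] by simp
    have "- y \<in> K" using sr(5)[OF xy(2)] by simp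
    from sr(7)[OF xy(1) this] show "x - y \<in> K" by simp
  qed
  show "inverse x \<in> K" if x: "x \<in> K"
  proof (cases "x = 0")
    case True
    then show ?thesis using is_subringD(2)[OF 1] by simp
  next
    case False
    then show ?thesis using Qb.subfield_m_inv(1)[OF assms, of x] x by (simp add: Qb_m_inv)
  qed
qed

text \<open>Inverses come from \<open>pow5_quotient_poly\<close>: after inverting 5 they are
  polynomials in the element itself. The lemma serves both for a single unramified ring and for the
  ring generated by all of them.\<close>

lemma subfield_pow5_localization:
  assumes A: "is_subring A" and emb: "\<And>c. emb c \<in> A"
  shows "subfield {x. \<exists>k. 5 ^ k * x \<in> A} qbar5_ring" (is "subfield ?K _")
proof (rule subfield_setI)
  note R = is_subringD[OF A]
  show "is_subring ?K"
    unfolding is_subring_def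
  proof (intro conjI ballI)
    show "1 \<in> ?K" using R(1) by (intro CollectI exI[of _ 0]) simp
    fix x y assume "x \<in> ?K" "y \<in> ?K"
    then obtain j k where jk: "5 ^ j * x \<in> A" "5 ^ k * y \<in> A" by blast
    have "5 ^ (j + k) * (x - y) = 5 ^ k * (5 ^ j * x) - 5 ^ j * (5 ^ k * y)"
      by (simp add: power_add left_diff_distrib right_diff_distrib mult_ac)
    also have "\<dots> \<in> A" by (intro R(3) R(4)[OF _ jk(1)] R(4)[OF _ jk(2)] R(7) R(10))
    finally show "x - y \<in> ?K" by blast
    have "5 ^ (j + k) * (x * y) = (5 ^ j * x) * (5 ^ k * y)" by (simp add: power_add mult_ac)
    also have "\<dots> \<in> A" by (rule R(4)[OF jk])
    finally show "x * y \<in> ?K" by blast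
  qed
  fix x assume x: "x \<in> ?K" "x \<noteq> 0"
  obtain j where j: "5 ^ j * x \<in> A" using x(1) by blast
  have nz: "5 ^ j * x \<noteq> 0" using x(2) by simp
  obtain c k where ck: "5 ^ j * x * poly (map_poly emb c) (5 ^ j * x) = 5 ^ k"
    using pow5_quotient_poly[OF nz] by blast
  have "poly (map_poly emb c) (5 ^ j * x) \<in> A"
    by (rule is_subring_poly[OF A _ j]) (simp add: coeff_map_poly emb)
  then have "5 ^ j * poly (map_poly emb c) (5 ^ j * x) \<in> A" by (intro R(4) R(7) R(10))
  moreover have "5 ^ k * inverse x = 5 ^ j * poly (map_poly emb c) (5 ^ j * x)"
    using x(2) unfolding ck[symmetric] by (simp add: mult_ac)
  ultimately have "5 ^ k * inverse x \<in> A" by simp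
  then show "inverse x \<in> ?K" by blast
qed

lemma generate_field_subset:
  "subfield K qbar5_ring \<Longrightarrow> H \<subseteq> K \<Longrightarrow> generate_field qbar5_ring H \<subseteq> K"
  using field.generate_field_min_subfield1[OF field_qbar5_ring, of H K] by simp

lemma subfield_generate: "subfield (generate_field qbar5_ring H) qbar5_ring"
  using field.generate_field_is_subfield[OF field_qbar5_ring, of H] by simp

lemma subfield_adjoin: "subfield (field_adjoin F a) qbar5_ring" "F \<subseteq> field_adjoin F a" "a \<in> field_adjoin F a"
  unfolding field_adjoin_def using subfield_generate by (auto intro: generate_field.incl)

lemma field_adjoin_subset: "subfield K qbar5_ring \<Longrightarrow> F \<subseteq> K \<Longrightarrow> a \<in> K \<Longrightarrow> field_adjoin F a \<subseteq> K"
  unfolding field_adjoin_def by (rule generate_field_subset) simp_all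

section \<open>Spans and linear independence of powers\<close>

lemma Qb_combine:
  "Qb.combine Ks Us = (\<Sum>i<length Us. (if i < length Ks then Ks ! i else 0) * Us ! i)"
proof (induction Us arbitrary: Ks)
  case Nil
  show ?case by simp
next
  case (Cons u Us)
  show ?case
  proof (cases Ks)
    case Nil
    then show ?thesis by simp
  next
    case (Cons k Ks')
    show ?thesis unfolding Cons Qb.combine.simps Cons.IH length_Cons sum.lessThan_Suc_shift
      by (auto intro!: sum.cong)
  qed
qed

lemma Span_powers:
  assumes K: "subfield K qbar5_ring"
  shows "Qb.Span K (map (\<lambda>i. a ^ i) [0..<n]) = {x. \<exists>c. (\<forall>i. c i \<in> K) \<and> x = (\<Sum>i<n. c i * a ^ i)}"
proof -
  let ?Us = "map (\<lambda>i. a ^ i) [0..<n]"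
  have eq: "Qb.Span K ?Us = {Qb.combine Ks ?Us | Ks. length Ks = length ?Us \<and> set Ks \<subseteq> K}"
    using Qb.Span_eq_combine_set_length_version[OF K, of ?Us] by simp
  show ?thesis unfolding eq
  proof (intro equalityI subsetI)
    fix x assume "x \<in> {Qb.combine Ks ?Us | Ks. length Ks = length ?Us \<and> set Ks \<subseteq> K}"
    then obtain Ks where Ks: "x = Qb.combine Ks ?Us" "length Ks = n" "set Ks \<subseteq> K" by auto
    define c where "c i = (if i < n then Ks ! i else 0)" for i
    have "c i \<in> K" for i
      using Ks is_subringD(2)[OF subfield_setD(1)[OF K]] nth_mem[of i Ks] by (auto simp: c_def)
    moreover have "x = (\<Sum>i<n. c i * a ^ i)"
      unfolding Ks(1) Qb_combine by (simp add: Ks(2) c_def)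
    ultimately show "x \<in> {x. \<exists>c. (\<forall>i. c i \<in> K) \<and> x = (\<Sum>i<n. c i * a ^ i)}" by blast
  next
    fix x assume "x \<in> {x. \<exists>c. (\<forall>i. c i \<in> K) \<and> x = (\<Sum>i<n. c i * a ^ i)}"
    then obtain c where c: "\<forall>i. c i \<in> K" "x = (\<Sum>i<n. c i * a ^ i)" by blast
    have "x = Qb.combine (map c [0..<n]) ?Us" unfolding c(2) Qb_combine by simp
    moreover have "set (map c [0..<n]) \<subseteq> K" using c(1) by auto
    ultimately show "x \<in> {Qb.combine Ks ?Us | Ks. length Ks = length ?Us \<and> set Ks \<subseteq> K}"
      by (intro CollectI exI[of _ "map c [0..<n]"]) simp
  qed
qed

lemma independent_powers:
  assumes K: "subfield K qbar5_ring"
    and ind: "\<And>c i. \<forall>i. c i \<in> K \<Longrightarrow> (\<Sum>i<n. c i * a ^ i) = 0 \<Longrightarrow> i < n \<Longrightarrow> c i = 0"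
  shows "Qb.independent K (map (\<lambda>i. a ^ i) [0..<n])"
proof (rule Qb.trivial_combine_imp_independent[OF K])
  let ?Us = "map (\<lambda>i. a ^ i) [0..<n]"
  show "set ?Us \<subseteq> carrier qbar5_ring" by simp
  fix Ks assume Ks: "set Ks \<subseteq> K" "Qb.combine Ks ?Us = zero qbar5_ring"
  define c where "c i = (if i < length Ks then Ks ! i else 0)" for i
  have "\<forall>i. c i \<in> K"
    using Ks is_subringD(2)[OF subfield_setD(1)[OF K]] nth_mem[of _ Ks] by (auto simp: c_def)
  moreover have "(\<Sum>i<n. c i * a ^ i) = 0"
    using Ks(2) unfolding Qb_combine by (simp add: c_def)
  ultimately have c0: "c i = 0" if "i < n" for i using ind that by blast
  show "set (take (length ?Us) Ks) \<subseteq> {zero qbar5_ring}"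
  proof
    fix k assume "k \<in> set (take (length ?Us) Ks)"
    then obtain i where "i < n" "i < length Ks" "k = Ks ! i" by (auto simp: in_set_conv_nth)
    then show "k \<in> {zero qbar5_ring}" using c0[of i] by (simp add: c_def)
  qed
qed

section \<open>Reduction of combinations of powers with 5-adic coefficients\<close>

lemma red_emb: "red (emb c) = of_int (z5_res c 1)"
proof -
  obtain d where d: "c - of_int (z5_res c 1) = 5 * d" using z5_res_1[of c] by (rule dvdE)
  have "emb c - of_int (z5_res c 1) = emb (c - of_int (z5_res c 1))"
    by (simp add: emb.hom_minus emb.hom_of_int)
  also have "\<dots> = emb d * 5" unfolding d by (simp add: emb.hom_mult)
  finally have "emb c - of_int (z5_res c 1) \<in> M5"
    using M5_mult[OF five_in_M5 emb_in_V5[of d]] by simp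
  then have "red (emb c) = red (of_int (z5_res c 1))"
    using red_eq_iff[OF emb_in_V5 V5_ring(9)] by blast
  then show ?thesis by (simp add: red_of_int)
qed

lemma zspan_red:
  assumes "\<theta> \<in> V5"
  shows "red (\<Sum>i<n. emb (c i) * \<theta> ^ i) = poly (of_int_poly (\<Sum>i<n. monom (z5_res (c i) 1) i)) (red \<theta>)"
proof -
  have "red (\<Sum>i<n. emb (c i) * \<theta> ^ i) = (\<Sum>i<n. red (emb (c i) * \<theta> ^ i))"
    by (rule red_sum) (intro V5_ring(4) V5_ring(7) emb_in_V5 assms)
  also have "\<dots> = (\<Sum>i<n. of_int (z5_res (c i) 1) * red \<theta> ^ i)"
    using assms by (intro sum.cong refl) (simp add: red_ring(5) emb_in_V5 V5_ring(7) red_emb red_power)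
  finally show ?thesis
    by (simp add: of_int_poly_hom.hom_sum poly_sum poly_monom map_poly_monom)
qed

lemma zspan_subset_V5: "\<theta> \<in> V5 \<Longrightarrow> zspan \<theta> n \<subseteq> V5"
proof
  fix x assume \<theta>: "\<theta> \<in> V5" and "x \<in> zspan \<theta> n"
  then obtain c where "x = (\<Sum>i<n. emb (c i) * \<theta> ^ i)" by (auto elim: zspanE)
  then show "x \<in> V5"
    by (simp only:) (intro is_subring_sum[OF is_subring_V5] V5_ring(4) V5_ring(7) emb_in_V5 \<theta>)
qed

text \<open>This makes 5 a uniformiser: modulo \<open>M5\<close> the combination is a polynomial of
  degree below \<open>n\<close> over the prime field evaluated at the residue of \<theta>; if it
  vanishes, independence makes every coordinate divisible by 5.\<close>

lemma zspan_M5_coeff: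
  assumes n: "n \<ge> 1" and \<theta>: "\<theta> \<in> V5" "\<And>d. 1 \<le> d \<Longrightarrow> d < n \<Longrightarrow> red \<theta> \<notin> Fq d"
    and M: "(\<Sum>i<n. emb (c i) * \<theta> ^ i) \<in> M5" and i: "i < n"
  shows "5 dvd c i"
proof -
  let ?p = "\<Sum>i<n. monom (z5_res (c i) 1) i"
  have "red (\<Sum>i<n. emb (c i) * \<theta> ^ i) = 0" using red_eq_0_iff[OF M5_subset[OF M]] M by blast
  then have p0: "poly (of_int_poly ?p) (red \<theta>) = 0" by (simp only: zspan_red[OF \<theta>(1)])
  have deg: "degree ?p < n" by (rule degree_sum_monom_less[OF n])
  have "5 dvd coeff ?p i" by (rule exact_degree_independent[OF \<theta>(2) deg p0])
  moreover have "coeff ?p i = z5_res (c i) 1" using i by (simp add: coeff_sum)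
  ultimately have "5 dvd z5_res (c i) 1" by simp
  then have "z5_res (c i) 1 = 0" using z5_res_mod_self[of "c i" 1] by (simp add: dvd_eq_mod_eq_0)
  then show ?thesis using pow5_dvd_z5_iff[of 1 "c i"] by simp
qed

text \<open>Descent: in a relation all coordinates are divisible by 5, and dividing by 5 gives
  another relation.\<close>

lemma zspan_independent:
  assumes n: "n \<ge> 1" and \<theta>: "\<theta> \<in> V5" "\<And>d. 1 \<le> d \<Longrightarrow> d < n \<Longrightarrow> red \<theta> \<notin> Fq d"
    and 0: "(\<Sum>i<n. emb (c i) * \<theta> ^ i) = 0" and i: "i < n"
  shows "c i = 0"
proof -
  have "5 ^ k dvd c i" if "(\<Sum>i<n. emb (c i) * \<theta> ^ i) = 0" "i < n" for k c i
    using that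
  proof (induction k arbitrary: c i)
    case 0
    show ?case by simp
  next
    case (Suc k)
    have "\<forall>i. i < n \<longrightarrow> (\<exists>d. c i = 5 * d)"
      using zspan_M5_coeff[OF n \<theta>, of c] Suc.prems(1) zero_in_M5 by (auto simp: dvd_def)
    then obtain d where d: "\<And>i. i < n \<Longrightarrow> c i = 5 * d i" by metis
    have "5 * (\<Sum>i<n. emb (d i) * \<theta> ^ i) = (\<Sum>i<n. emb (c i) * \<theta> ^ i)"
      unfolding sum_distrib_left by (intro sum.cong refl) (simp add: d emb.hom_mult mult.assoc)
    then have "(\<Sum>i<n. emb (d i) * \<theta> ^ i) = 0" using Suc.prems(1) by simp
    from Suc.IH[OF this Suc.prems(2)] show ?case using d[OF Suc.prems(2)] by simp
  qed
  then show ?thesis using 0 i z5_eq_0_if_pow5_dvd by metis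
qed

section \<open>From 5-adic integers to 5-adic numbers\<close>

lemma Q5_pow5: "q \<in> Q5 \<Longrightarrow> \<exists>k c. 5 ^ k * q = emb c"
proof -
  assume "q \<in> Q5"
  then obtain f where f: "q = to_ac f" unfolding Q5_def by (rule rangeE)
  obtain u v where uv: "f = Fract u v" "v \<noteq> 0" by (cases f) simp
  from z5_dvd_pow5[OF uv(2)] obtain k where "v dvd 5 ^ k" by blast
  then obtain d where d: "5 ^ k = v * d" by (rule dvdE)
  have "emb v * q = emb u"
    unfolding f uv(1) emb_def to_ac_mult[symmetric] using uv(2) by (simp add: eq_fract)
  moreover have "5 ^ k = emb v * emb d"
    using d emb.hom_mult emb.hom_power emb_numeral by metis
  ultimately have "5 ^ k * q = emb (u * d)" by (simp add: emb.hom_mult mult_ac)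
  then show ?thesis by blast
qed

lemma emb_in_Q5: "emb c \<in> Q5"
  unfolding Q5_def emb_def by (rule rangeI)

lemma subfield_Q5: "subfield Q5 qbar5_ring"
proof (rule subfield_setI)
  show "is_subring Q5"
    unfolding is_subring_def
  proof (intro conjI ballI)
    show "1 \<in> Q5" using emb_in_Q5[of 1] by simp
    fix x y assume "x \<in> Q5" "y \<in> Q5"
    then obtain a b where "x = to_ac a" "y = to_ac b" unfolding Q5_def by blast
    then show "x - y \<in> Q5" "x * y \<in> Q5"
      unfolding Q5_def using rangeI[of to_ac "a - b"] rangeI[of to_ac "a * b"] by simp_all
  qed
  fix x assume "x \<in> Q5"
  then obtain a where "x = to_ac a" unfolding Q5_def by blast
  then show "inverse x \<in> Q5" unfolding Q5_def using rangeI[of to_ac "inverse a"] by simp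
qed

lemma Q5_independent_powers:
  assumes n: "n \<ge> 1" and \<theta>: "\<theta> \<in> V5" "\<And>d. 1 \<le> d \<Longrightarrow> d < n \<Longrightarrow> red \<theta> \<notin> Fq d"
    and c: "\<And>i. c i \<in> Q5" and 0: "(\<Sum>i<n. c i * \<theta> ^ i) = 0" and i: "i < n"
  shows "c i = 0"
proof -
  have "\<forall>i. \<exists>k. \<exists>d. 5 ^ k * c i = emb d" using Q5_pow5[OF c] by blast
  then obtain k where k: "\<And>i. \<exists>d. 5 ^ k i * c i = emb d" by metis
  define K where "K = (\<Sum>i<n. k i)"
  have "\<exists>d. 5 ^ K * c i = emb d" if "i < n" for i
  proof -
    obtain d where d: "5 ^ k i * c i = emb d" using k by blast
    have "k i \<le> K" unfolding K_def using that by (intro member_le_sum) simp_all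
    then have "(5 :: qbar5) ^ K = 5 ^ (K - k i) * 5 ^ k i" by (simp flip: power_add)
    then have "5 ^ K * c i = emb (5 ^ (K - k i) * d)"
      by (simp add: mult.assoc d emb.hom_mult emb.hom_power)
    then show ?thesis by blast
  qed
  then obtain d where d: "\<And>i. i < n \<Longrightarrow> 5 ^ K * c i = emb (d i)" by metis
  have "(\<Sum>i<n. emb (d i) * \<theta> ^ i) = 5 ^ K * (\<Sum>i<n. c i * \<theta> ^ i)"
    unfolding sum_distrib_left by (intro sum.cong refl) (simp add: d[symmetric] mult.assoc)
  then have "d i = 0" using zspan_independent[OF n \<theta> _ i] 0 by simp
  then have "5 ^ K * c i = 0" using d[OF i] by simp
  then show ?thesis by simp
qed


section \<open>Unramified extensions\<close>

text \<open>Here \<theta> lifts a generator of the field with 5^n elements and satisfies a monic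
  equation of the same degree \<open>n\<close>. The module \<open>B\<close> spanned by its powers is
  the ring of Witt vectors of that field in disguise, and \<open>L\<close> is the unramified
  extension of degree \<open>n\<close>.\<close>

locale unram_ring =
  fixes n :: nat and \<theta> :: qbar5
  assumes n: "n \<ge> 1" and theta_V5: "\<theta> \<in> V5" and exact: "exact_degree n (red \<theta>)"
    and theta_power: "\<theta> ^ n \<in> zspan \<theta> n"
begin

definition B :: "qbar5 set" where "B = zspan \<theta> n"

definition L :: "qbar5 set" where "L = {x. \<exists>k. 5 ^ k * x \<in> B}"

lemma is_subring_B: "is_subring B"
  unfolding B_def by (rule is_subring_zspan[OF theta_power])

lemmas B_ring = is_subringD[OF is_subring_B]

lemma B_subset_V5: "x \<in> B \<Longrightarrow> x \<in> V5"
  unfolding B_def using zspan_subset_V5[OF theta_V5] by blast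

lemma emb_in_B: "emb c \<in> B"
  unfolding B_def by (rule emb_in_zspan[OF theta_power])

lemma theta_exact: "1 \<le> d \<Longrightarrow> d < n \<Longrightarrow> red \<theta> \<notin> Fq d"
  using exact unfolding exact_degree_def by blast

lemma B_M5:
  assumes "x \<in> B" "x \<in> M5"
  shows "\<exists>b\<in>B. x = 5 * b"
proof -
  obtain c where c: "x = (\<Sum>i<n. emb (c i) * \<theta> ^ i)" using assms(1) unfolding B_def by (rule zspanE)
  have "\<forall>i. i < n \<longrightarrow> (\<exists>d. c i = 5 * d)"
    using zspan_M5_coeff[OF n theta_V5 theta_exact assms(2)[unfolded c]] by (auto simp: dvd_def)
  then obtain d where d: "\<And>i. i < n \<Longrightarrow> c i = 5 * d i" by metis
  have "5 * (\<Sum>i<n. emb (d i) * \<theta> ^ i) = x"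
    unfolding sum_distrib_left c by (intro sum.cong refl) (simp add: d emb.hom_mult mult.assoc)
  moreover have "(\<Sum>i<n. emb (d i) * \<theta> ^ i) \<in> B" unfolding B_def by (rule zspanI)
  ultimately show ?thesis by metis
qed

lemma red_B: "x \<in> B \<Longrightarrow> red x \<in> Fq n"
proof -
  assume "x \<in> B"
  then obtain c where c: "x = (\<Sum>i<n. emb (c i) * \<theta> ^ i)" unfolding B_def by (rule zspanE)
  have "red \<theta> ^ 5 ^ n = red \<theta>" using exact by (simp add: exact_degree_def Fq_def)
  then show "red x \<in> Fq n" unfolding c zspan_red[OF theta_V5] Fq_def mem_Collect_eq frobenius_poly by simp
qed

lemma red_B_surj: "\<xi> \<in> Fq n \<Longrightarrow> \<exists>x\<in>B. red x = \<xi>"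
proof -
  assume "\<xi> \<in> Fq n"
  then obtain c where c: "\<xi> = (\<Sum>i<n. of_int (c i) * red \<theta> ^ i)"
    using exact_degree_spans[OF n exact] by blast
  define x where "x = (\<Sum>i<n. emb (of_int (c i)) * \<theta> ^ i)"
  have "x \<in> B" unfolding x_def B_def by (rule zspanI)
  moreover have "red x = (\<Sum>i<n. red (emb (of_int (c i)) * \<theta> ^ i))"
    unfolding x_def by (rule red_sum) (intro V5_ring(4) V5_ring(7) emb_in_V5 theta_V5)
  moreover have "\<dots> = \<xi>"
    unfolding c
    by (intro sum.cong refl)
       (simp add: red_ring(5) emb_in_V5 V5_ring(7) V5_ring(9) theta_V5 emb.hom_of_int red_of_int red_power)
  ultimately show ?thesis by metis
qed

lemma B_separated:
  assumes "x \<in> B" "\<And>k. \<exists>b\<in>B. x = 5 ^ k * b"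
  shows "x = 0"
proof -
  obtain c where c: "x = (\<Sum>i<n. emb (c i) * \<theta> ^ i)" using assms(1) unfolding B_def by (rule zspanE)
  have "c i = 0" if i: "i < n" for i
  proof (rule z5_eq_0_if_pow5_dvd)
    fix k
    obtain b where b: "b \<in> B" "x = 5 ^ k * b" using assms(2) by blast
    obtain d where d: "b = (\<Sum>i<n. emb (d i) * \<theta> ^ i)" using b(1) unfolding B_def by (rule zspanE)
    have "(\<Sum>i<n. emb (c i - 5 ^ k * d i) * \<theta> ^ i) = x - 5 ^ k * b"
      unfolding c d sum_distrib_left sum_subtractf[symmetric]
      by (intro sum.cong refl) (simp add: emb.hom_minus emb.hom_mult emb.hom_power left_diff_distrib mult.assoc)
    then have "c i - 5 ^ k * d i = 0"
      using zspan_independent[OF n theta_V5 theta_exact _ i, of "\<lambda>i. c i - 5 ^ k * d i"] b(2) by simp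
    then show "5 ^ k dvd c i" by simp
  qed
  then show ?thesis unfolding c by simp
qed

text \<open>\<open>B\<close> is finitely generated over the 5-adic integers, so series in powers of
  5 converge coordinate by coordinate.\<close>

lemma B_complete:
  assumes "\<And>i. b i \<in> B"
  shows "\<exists>x\<in>B. \<forall>k. \<exists>r\<in>B. x - (\<Sum>i<k. 5 ^ i * b i) = 5 ^ k * r"
proof -
  have "\<forall>i. \<exists>c. b i = (\<Sum>j<n. emb (c j) * \<theta> ^ j)"
  proof
    fix i
    from assms[of i, unfolded B_def] obtain c where "b i = (\<Sum>j<n. emb (c j) * \<theta> ^ j)" by (rule zspanE)
    then show "\<exists>c. b i = (\<Sum>j<n. emb (c j) * \<theta> ^ j)" by (rule exI[of _ c])
  qed
  then obtain c where c: "\<And>i. b i = (\<Sum>j<n. emb (c i j) * \<theta> ^ j)" by metis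
  have "\<forall>j. \<exists>S :: z5. \<forall>k. 5 ^ k dvd (S - (\<Sum>i<k. 5 ^ i * c i j))"
    by (intro allI z5_series_limit)
  then obtain S where S: "\<And>j k. 5 ^ k dvd (S j - (\<Sum>i<k. 5 ^ i * c i j))" by metis
  define x where "x = (\<Sum>j<n. emb (S j) * \<theta> ^ j)"
  have "\<exists>r\<in>B. x - (\<Sum>i<k. 5 ^ i * b i) = 5 ^ k * r" for k
  proof -
    have "\<forall>j. \<exists>d. S j - (\<Sum>i<k. 5 ^ i * c i j) = 5 ^ k * d" using S unfolding dvd_def by blast
    then obtain d where d: "\<And>j. S j - (\<Sum>i<k. 5 ^ i * c i j) = 5 ^ k * d j" by metis
    have "(\<Sum>i<k. 5 ^ i * b i) = (\<Sum>i<k. \<Sum>j<n. 5 ^ i * (emb (c i j) * \<theta> ^ j))"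
      by (simp add: c sum_distrib_left)
    also have "\<dots> = (\<Sum>j<n. \<Sum>i<k. 5 ^ i * (emb (c i j) * \<theta> ^ j))" by (rule sum.swap)
    also have "\<dots> = (\<Sum>j<n. emb (\<Sum>i<k. 5 ^ i * c i j) * \<theta> ^ j)"
      by (simp add: emb.hom_sum emb.hom_mult emb.hom_power sum_distrib_right mult.assoc)
    finally have "x - (\<Sum>i<k. 5 ^ i * b i) = (\<Sum>j<n. emb (S j - (\<Sum>i<k. 5 ^ i * c i j)) * \<theta> ^ j)"
      unfolding x_def by (simp add: emb.hom_minus left_diff_distrib sum_subtractf)
    also have "\<dots> = 5 ^ k * (\<Sum>j<n. emb (d j) * \<theta> ^ j)"
      unfolding d sum_distrib_left by (intro sum.cong refl) (simp add: emb.hom_mult emb.hom_power mult.assoc)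
    finally show ?thesis unfolding B_def using zspanI by blast
  qed
  moreover have "x \<in> B" unfolding x_def B_def by (rule zspanI)
  ultimately show ?thesis by blast
qed

lemma poly_in_B: "x \<in> B \<Longrightarrow> poly (of_int_poly p) x \<in> B"
  by (rule is_subring_poly[OF is_subring_B]) (simp_all add: coeff_map_poly B_ring(9))

text \<open>Newton iteration with the derivative frozen: \<open>y\<close> inverts it up to
  \<open>M5\<close>, so each step gains one factor 5. The limit exists by \<open>B_complete\<close>,
  and it is a root because only 0 is divisible by all powers of 5.\<close>

lemma B_hensel:
  assumes x0: "x0 \<in> B" and p0: "poly (of_int_poly p) (red x0) = 0"
    and p': "poly (of_int_poly (pderiv p)) (red x0) \<noteq> 0"
  shows "\<exists>x\<in>B. poly (of_int_poly p) x = 0 \<and> red x = red x0"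
proof -
  let ?P = "\<lambda>x :: qbar5. poly (of_int_poly p) x"
  let ?D = "\<lambda>x :: qbar5. poly (of_int_poly (pderiv p)) x"
  have taylor: "\<exists>r\<in>B. ?P (x + h) = ?P x + h * ?D x + h ^ 2 * r" if "x \<in> B" "h \<in> B" for x h
    using poly_taylor_2[OF is_subring_B that, of "of_int_poly p"] B_ring(9)
    by (simp add: coeff_map_poly pderiv_of_int_poly)
  have redD: "red (?D x) = poly (of_int_poly (pderiv p)) (red x)" if "x \<in> B" for x
    using red_poly[OF B_subset_V5[OF that]] by blast
  \<comment> \<open>The inverse stays in the residue field of \<open>B\<close>, which allows lifting
    it to \<open>B\<close>.\<close>
  have "inverse (poly (of_int_poly (pderiv p)) (red x0)) \<in> Fq n"
    using red_B[OF poly_in_B[OF x0, of "pderiv p"]] unfolding redD[OF x0] Fq_def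
    by (simp add: power_inverse)
  then obtain y where y: "y \<in> B" "red y = inverse (poly (of_int_poly (pderiv p)) (red x0))"
    using red_B_surj by blast
  define Y where "Y = rec_nat x0 (\<lambda>_ x. x - y * ?P x)"
  have Y0: "Y 0 = x0" and YS: "\<And>k. Y (Suc k) = Y k - y * ?P (Y k)" by (simp_all add: Y_def)
  have inv: "Y k \<in> B \<and> red (Y k) = red x0 \<and> (\<exists>e\<in>B. ?P (Y k) = 5 ^ Suc k * e)" for k
  proof (induction k)
    case 0
    have "?P x0 \<in> M5"
      using red_poly[OF B_subset_V5[OF x0], of p] p0 red_eq_0_iff[of "?P x0"] by simp
    then show ?case using B_M5[OF poly_in_B[OF x0]] x0 Y0 by auto
  next
    case (Suc k)
    then obtain e where Y: "Y k \<in> B" "red (Y k) = red x0" and e: "e \<in> B" "?P (Y k) = 5 ^ Suc k * e" by blast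
    have h: "- (y * ?P (Y k)) \<in> B" using y(1) poly_in_B[OF Y(1)] by (intro B_ring(5) B_ring(4))
    obtain r where r: "r \<in> B" "?P (Y k + - (y * ?P (Y k))) = ?P (Y k) + - (y * ?P (Y k)) * ?D (Y k) + (- (y * ?P (Y k))) ^ 2 * r"
      using taylor[OF Y(1) h] by blast
    have DB: "?D (Y k) \<in> B" by (rule poly_in_B[OF Y(1)])
    have wB: "1 - y * ?D (Y k) \<in> B" using y(1) DB by (intro B_ring(3) B_ring(1) B_ring(4))
    have "red (1 - y * ?D (Y k)) = 1 - red y * red (?D (Y k))"
      using B_subset_V5[OF y(1)] B_subset_V5[OF DB] by (simp add: red_ring V5_ring)
    also have "\<dots> = 0" using y(2) redD[OF Y(1)] Y(2) p' by simp
    finally have "1 - y * ?D (Y k) \<in> M5" using red_eq_0_iff[OF B_subset_V5[OF wB]] by blast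
    then obtain w where w: "w \<in> B" "1 - y * ?D (Y k) = 5 * w" using B_M5[OF wB] by blast
    have "?P (Y (Suc k)) = ?P (Y k) * (1 - y * ?D (Y k)) + (y * ?P (Y k)) ^ 2 * r"
      using r(2) unfolding YS by (simp add: right_diff_distrib mult_ac)
    also have "\<dots> = 5 ^ Suc (Suc k) * (e * w + 5 ^ k * y ^ 2 * e ^ 2 * r)"
      unfolding w(2) e(2) by (simp add: distrib_left power2_eq_square mult_ac)
    finally have "?P (Y (Suc k)) = 5 ^ Suc (Suc k) * (e * w + 5 ^ k * y ^ 2 * e ^ 2 * r)" .
    moreover have "e * w + 5 ^ k * y ^ 2 * e ^ 2 * r \<in> B"
      using e(1) w(1) y(1) r(1) by (intro B_ring(6) B_ring(4) B_ring(7) B_ring(10))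
    moreover have "Y (Suc k) \<in> B" unfolding YS using Y(1) y(1) poly_in_B[OF Y(1)]
      by (intro B_ring(3) B_ring(4))
    moreover have "red (Y (Suc k)) = red x0"
    proof -
      have "red (?P (Y k)) = 0" using red_poly[OF B_subset_V5[OF Y(1)], of p] Y(2) p0 by simp
      then show ?thesis unfolding YS
        using B_subset_V5[OF Y(1)] B_subset_V5[OF y(1)] B_subset_V5[OF poly_in_B[OF Y(1), of p]] Y(2)
        by (simp add: red_ring V5_ring)
    qed
    ultimately show ?case by blast
  qed
  then obtain e where e: "\<And>k. e k \<in> B" "\<And>k. ?P (Y k) = 5 ^ Suc k * e k" by metis
  \<comment> \<open>The increment \<open>Y (Suc k) - Y k\<close> is \<open>5 ^ k * b k\<close>, so
    the iterates are partial sums of a series in powers of 5.\<close>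
  define b where "b k = - (5 * y * e k)" for k
  have b: "b k \<in> B" for k unfolding b_def using y(1) e(1) by (intro B_ring(5) B_ring(4) B_ring(10))
  have sumb: "(\<Sum>i<k. 5 ^ i * b i) = Y k - x0" for k
    by (induction k) (simp_all add: Y0 YS e(2) b_def mult_ac)
  obtain z where z: "z \<in> B" "\<And>k. \<exists>r\<in>B. z - (Y k - x0) = 5 ^ k * r"
    using B_complete[of b, OF b] unfolding sumb by blast
  define x where "x = x0 + z"
  have xB: "x \<in> B" unfolding x_def using x0 z(1) by (rule B_ring(6))
  have xY: "\<exists>r\<in>B. x = Y k + 5 ^ k * r" for k
  proof -
    obtain r where r: "r \<in> B" "z - (Y k - x0) = 5 ^ k * r" using z(2) by blast
    have "x = Y k + (z - (Y k - x0))" by (simp add: x_def)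
    then show ?thesis using r by metis
  qed
  have "?P x = 0"
  proof (rule B_separated[OF poly_in_B[OF xB]])
    fix k
    obtain r where r: "r \<in> B" "x = Y k + 5 ^ k * r" using xY by blast
    have YB: "Y k \<in> B" using inv by blast
    have hB: "5 ^ k * r \<in> B" using r(1) by (intro B_ring(4) B_ring(7) B_ring(10))
    obtain t where t: "t \<in> B" "?P (Y k + 5 ^ k * r) = ?P (Y k) + 5 ^ k * r * ?D (Y k) + (5 ^ k * r) ^ 2 * t"
      using taylor[OF YB hB] by blast
    have "?P x = 5 ^ k * (5 * e k + r * ?D (Y k) + 5 ^ k * r ^ 2 * t)"
      unfolding r(2) t(2) e(2) by (simp add: distrib_left power2_eq_square mult_ac)
    moreover have "5 * e k + r * ?D (Y k) + 5 ^ k * r ^ 2 * t \<in> B"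
      using e(1) r(1) t(1) poly_in_B[OF YB, of "pderiv p"]
      by (intro B_ring(6) B_ring(4) B_ring(7) B_ring(10))
    ultimately show "\<exists>b\<in>B. ?P x = 5 ^ k * b" by blast
  qed
  moreover have "red x = red x0"
  proof -
    obtain r where r: "r \<in> B" "x = Y 1 + 5 ^ 1 * r" using xY by blast
    have "red (Y 1) = red x0" "Y 1 \<in> B" using inv by blast+
    then show ?thesis unfolding r(2)
      using B_subset_V5[OF r(1)] B_subset_V5[of "Y 1"] rf_five by (simp add: red_ring V5_ring red_numeral)
  qed
  ultimately show ?thesis using xB by blast
qed

lemma B_subset_L: "x \<in> B \<Longrightarrow> x \<in> L"
  unfolding L_def by (intro CollectI exI[of _ 0]) simp

lemma subfield_L: "subfield L qbar5_ring"
  unfolding L_def by (rule subfield_pow5_localization[OF is_subring_B emb_in_B])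

lemmas is_subring_L = subfield_setD(1)[OF subfield_L]

lemmas inverse_in_L = subfield_setD(2)[OF subfield_L]

text \<open>For \<open>x\<close> in \<open>V5\<close> the element 5^(k+1) x lies in
  \<open>M5\<close>, so \<open>B_M5\<close> cancels one factor 5 at a time.\<close>

lemma L_Int_V5: "x \<in> L \<Longrightarrow> x \<in> V5 \<Longrightarrow> x \<in> B"
proof -
  assume x: "x \<in> L" "x \<in> V5"
  have "x \<in> B" if "5 ^ k * x \<in> B" for k
    using that
  proof (induction k)
    case 0
    then show ?case by simp
  next
    case (Suc k)
    have "5 ^ k * x \<in> V5" using x(2) by (intro V5_ring(4) V5_ring(7) V5_ring(10))
    from M5_mult[OF five_in_M5 this] have "5 ^ Suc k * x \<in> M5" by (simp add: mult_ac)
    from B_M5[OF Suc.prems this] obtain b where b: "b \<in> B" "5 ^ Suc k * x = 5 * b" by blast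
    then have "5 ^ k * x = b" by simp
    with b(1) have "5 ^ k * x \<in> B" by simp
    then show ?case by (rule Suc.IH)
  qed
  then show "x \<in> B" using x(1) unfolding L_def by blast
qed

lemma ring_of_integers_L: "ring_of_integers L = B"
proof (intro equalityI subsetI)
  fix x assume "x \<in> ring_of_integers L"
  then show "x \<in> B" unfolding ring_of_integers_def using L_Int_V5 integral_in_V5 by blast
next
  fix x assume "x \<in> B"
  then show "x \<in> ring_of_integers L"
    unfolding ring_of_integers_def using B_subset_L zspan_integral[OF n theta_power] B_def by blast
qed

lemma Q5_subset_L: "Q5 \<subseteq> L"
proof
  fix q assume "q \<in> Q5"
  then obtain k c where "5 ^ k * q = emb c" using Q5_pow5 by blast
  then have "5 ^ k * q \<in> B" using emb_in_B[of c] by simp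
  then show "q \<in> L" unfolding L_def by blast
qed

lemma theta_in_B: "\<theta> \<in> B"
  using zspan_power[OF theta_power, of 1] by (simp add: B_def)

lemma L_eq_span: "L = {x. \<exists>c. (\<forall>i. c i \<in> Q5) \<and> x = (\<Sum>i<n. c i * \<theta> ^ i)}"
proof (intro equalityI subsetI)
  fix x assume "x \<in> L"
  then obtain k where "5 ^ k * x \<in> B" unfolding L_def by blast
  then obtain c where c: "5 ^ k * x = (\<Sum>i<n. emb (c i) * \<theta> ^ i)" unfolding B_def by (rule zspanE)
  have five: "inverse (5 ^ k) \<in> Q5"
    using subfield_setD(2)[OF subfield_Q5 emb_in_Q5[of "5 ^ k"]] by (simp add: emb.hom_power)
  have "x = inverse (5 ^ k) * (5 ^ k * x)" by (simp add: mult.assoc[symmetric])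
  then have "x = (\<Sum>i<n. (inverse (5 ^ k) * emb (c i)) * \<theta> ^ i)"
    unfolding c by (simp add: sum_distrib_left mult.assoc)
  moreover have "inverse (5 ^ k) * emb (c i) \<in> Q5" for i
    using is_subringD(4)[OF subfield_setD(1)[OF subfield_Q5] five emb_in_Q5] .
  ultimately show "x \<in> {x. \<exists>c. (\<forall>i. c i \<in> Q5) \<and> x = (\<Sum>i<n. c i * \<theta> ^ i)}"
    by (intro CollectI exI[of _ "\<lambda>i. inverse (5 ^ k) * emb (c i)"] conjI allI)
next
  fix x assume "x \<in> {x. \<exists>c. (\<forall>i. c i \<in> Q5) \<and> x = (\<Sum>i<n. c i * \<theta> ^ i)}"
  then obtain c where c: "\<forall>i. c i \<in> Q5" "x = (\<Sum>i<n. c i * \<theta> ^ i)" by blast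
  have "c i * \<theta> ^ i \<in> L" for i
    using c(1) Q5_subset_L B_subset_L[OF B_ring(7)[OF theta_in_B]] by (intro is_subringD(4)[OF is_subring_L]) blast+
  then show "x \<in> L" unfolding c(2) by (intro is_subring_sum[OF is_subring_L])
qed

lemma finite_unramified_L: "finite_unramified L"
  unfolding finite_unramified_def ring_of_integers_L
proof (intro conjI subfield_L Q5_subset_L)
  have "Qb.independent Q5 (map (\<lambda>i. \<theta> ^ i) [0..<n])"
    using Q5_independent_powers[OF n theta_V5 theta_exact]
    by (intro independent_powers[OF subfield_Q5]) blast
  from Qb.dimension_independent[OF this]
  have "Qb.dimension n Q5 L" unfolding Span_powers[OF subfield_Q5] L_eq_span[symmetric] by simp
  then show "Qb.finite_dimension Q5 L" by (rule Qb.finite_dimensionI)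
  show "{a \<in> B. a = 0 \<or> inverse a \<notin> B} = (\<lambda>b. 5 * b) ` B"
  proof (intro equalityI subsetI)
    fix a assume "a \<in> {a \<in> B. a = 0 \<or> inverse a \<notin> B}"
    then have a: "a \<in> B" "a = 0 \<or> inverse a \<notin> B" by auto
    have "a \<in> M5"
    proof (rule ccontr)
      assume "a \<notin> M5"
      from unit_in_V5[OF B_subset_V5[OF a(1)] this] have "inverse a \<in> V5" "a \<noteq> 0" by blast+
      then show False using a L_Int_V5[OF inverse_in_L[OF B_subset_L]] by blast
    qed
    then show "a \<in> (\<lambda>b. 5 * b) ` B" using B_M5[OF a(1)] by blast
  next
    fix a assume "a \<in> (\<lambda>b. 5 * b) ` B"
    then obtain b where b: "b \<in> B" "a = 5 * b" by blast
    have "a \<in> M5" using M5_mult[OF five_in_M5 B_subset_V5[OF b(1)]] b(2) by (simp add: mult.commute)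
    moreover have "a \<in> B" unfolding b(2) using b(1) by (intro B_ring(4) B_ring(10))
    ultimately show "a \<in> {a \<in> B. a = 0 \<or> inverse a \<notin> B}"
      unfolding M5_def using B_subset_V5 by blast
  qed
qed

lemma L_subset_K5: "L \<subseteq> K5"
  unfolding K5_def using finite_unramified_L by (auto intro: generate_field.incl)

end

text \<open>Hensel lifting in \<open>B\<close> presupposes \<theta>, so the generator is lifted
  differently: its relation over the prime field lifts to a monic integer polynomial, which splits
  in the algebraic closure. The value at any lift \<open>x0\<close> of \<xi> is the product of the
  differences to the roots and lies in the prime ideal \<open>M5\<close>, so some root has residue
  \<xi>.\<close>

lemma ex_unram_ring:
  assumes n: "n \<ge> 1"
  shows "\<exists>\<theta>. unram_ring n \<theta>"
proof -
  obtain \<xi> where \<xi>: "exact_degree n \<xi>" using ex_exact_degree[OF n] by blast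
  have "\<xi> ^ 5 ^ n = \<xi>" using \<xi> by (simp add: exact_degree_def Fq_def)
  then have "(\<xi> ^ n) ^ 5 ^ n = \<xi> ^ n" by (metis power_mult mult.commute)
  then have "\<xi> ^ n \<in> Fq n" by (simp add: Fq_def)
  then obtain c where c: "\<xi> ^ n = (\<Sum>i<n. of_int (c i) * \<xi> ^ i)"
    using exact_degree_spans[OF n \<xi>] by blast
  define s where "s = (\<Sum>i<n. monom (c i) i)"
  define f where "f = monom 1 n - s"
  have sdeg: "degree s < n" unfolding s_def by (rule degree_sum_monom_less[OF n])
  have fpoly: "poly (of_int_poly f) x = x ^ n - (\<Sum>i<n. of_int (c i) * x ^ i)" for x :: "'a :: comm_ring_1"
    by (simp add: f_def s_def of_int_poly_hom.hom_minus of_int_poly_hom.hom_sum poly_sum poly_monom map_poly_monom)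
  let ?f = "of_int_poly f :: qbar5 poly"
  have cf: "coeff ?f n = 1" using sdeg by (simp add: f_def coeff_map_poly coeff_eq_0)
  have "degree ?f \<le> n"
  proof (rule order.trans[OF degree_map_poly_le])
    show "degree f \<le> n" unfolding f_def
      by (rule degree_diff_le) (use sdeg in \<open>simp_all add: degree_monom_eq\<close>)
  qed
  with cf have fdeg: "degree ?f = n" by (metis le_antisym le_degree zero_neq_one)
  have fnz: "?f \<noteq> 0" using cf by force
  obtain A where A: "?f = (\<Prod>x\<in>#A. [:- x, 1:])"
    using alg_closed_imp_factorization[OF fnz] cf fdeg by auto
  have rootV: "x \<in> V5" if "poly ?f x = 0" for x
  proof (rule monic_root_in_V5[OF _ _ that])
    show "lead_coeff ?f = 1" unfolding fdeg by (rule cf)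
    show "coeff ?f i \<in> V5" for i by (simp add: coeff_map_poly V5_ring(9))
  qed
  have rootA: "poly ?f x = 0" if "x \<in># A" for x
    using that by (subst A) (auto simp: poly_prod_mset prod_mset_zero_iff)
  obtain x0 where x0: "x0 \<in> V5" "red x0 = \<xi>" using red_surj by blast
  have "red (poly ?f x0) = 0" using red_poly[OF x0(1), of f] x0(2) fpoly[of \<xi>] c by simp
  then have M: "poly ?f x0 \<in> M5" using red_poly[OF x0(1), of f] red_eq_0_iff by blast
  have fx: "poly ?f x0 = (\<Prod>x\<in>#A. x0 - x)"
    by (subst A) (simp add: poly_prod_mset multiset.map_comp o_def)
  have "\<exists>x\<in>#C. x0 - x \<in> M5" if "(\<Prod>x\<in>#C. x0 - x) \<in> M5" "\<And>x. x \<in># C \<Longrightarrow> x \<in> V5" for C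
    using that
  proof (induction C)
    case empty
    then show ?case using one_notin_M5 by simp
  next
    case (add x C)
    have xV: "x0 - x \<in> V5" using x0(1) add.prems(2)[of x] by (intro V5_ring(3)) simp_all
    have "\<And>x. x \<in># C \<Longrightarrow> x \<in> V5" using add.prems(2) by simp
    then have "(\<Prod>x\<in>#C. x0 - x) \<in> V5"
    proof (induction C)
      case empty
      then show ?case using V5_ring(1) by simp
    next
      case (add y C)
      then have "(\<Prod>x\<in>#C. x0 - x) \<in> V5" by simp
      moreover have "x0 - y \<in> V5" using x0(1) add.prems[of y] by (intro V5_ring(3)) simp_all
      ultimately show ?case using V5_ring(4) by simp
    qed
    from M5_prime[OF xV this] add show ?case by auto
  qed
  then obtain \<theta> where \<theta>: "\<theta> \<in># A" "x0 - \<theta> \<in> M5" using M rootA rootV unfolding fx by blast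
  have \<theta>V: "\<theta> \<in> V5" using rootV rootA \<theta>(1) by blast
  have "red \<theta> = \<xi>" using red_eq_iff[OF x0(1) \<theta>V] \<theta>(2) x0(2) by simp
  moreover have "\<theta> ^ n = (\<Sum>i<n. emb (of_int (c i)) * \<theta> ^ i)"
    using rootA[OF \<theta>(1)] unfolding fpoly by (simp add: emb.hom_of_int)
  then have "\<theta> ^ n \<in> zspan \<theta> n" using zspanI by metis
  ultimately have "unram_ring n \<theta>" by unfold_locales (use n \<theta>V \<xi> in auto)
  then show ?thesis by (rule exI)
qed


section \<open>Ramification of the square root of 5\<close>

text \<open>The ring generated by all unramified rings of integers. Working in it avoids proving
  that a compositum of unramified extensions is unramified; the inductive form serves the induction
  for the Frobenius map.\<close>

inductive_set UR :: "qbar5 set" where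
  one: "1 \<in> UR"
| incl: "finite_unramified L \<Longrightarrow> x \<in> ring_of_integers L \<Longrightarrow> x \<in> UR"
| diff: "x \<in> UR \<Longrightarrow> y \<in> UR \<Longrightarrow> x - y \<in> UR"
| mult: "x \<in> UR \<Longrightarrow> y \<in> UR \<Longrightarrow> x * y \<in> UR"

lemma is_subring_UR: "is_subring UR"
  unfolding is_subring_def using UR.one UR.diff UR.mult by blast

lemmas UR_ring = is_subringD[OF is_subring_UR]

lemma UR_subset_V5: "x \<in> UR \<Longrightarrow> x \<in> V5"
proof (induction rule: UR.induct)
  case (incl L x)
  then show ?case using integral_in_V5 unfolding ring_of_integers_def by blast
qed (simp_all add: V5_ring)

text \<open>Congruence modulo the ideal 5 \<open>UR\<close> rather than modulo \<open>M5\<close>: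
  the descent for \<open>s\<close> divides by 5 inside \<open>UR\<close>.\<close>

definition ucong :: "qbar5 \<Rightarrow> qbar5 \<Rightarrow> bool" where
  "ucong x y \<longleftrightarrow> (\<exists>b\<in>UR. x = y + 5 * b)"

lemma ucongI: "b \<in> UR \<Longrightarrow> x = y + 5 * b \<Longrightarrow> ucong x y"
  unfolding ucong_def by blast

lemma ucong_refl: "ucong x x"
  by (rule ucongI[OF UR_ring(2)]) simp

lemma ucong_trans: "ucong x y \<Longrightarrow> ucong y z \<Longrightarrow> ucong x z"
proof -
  assume "ucong x y" "ucong y z"
  then obtain b c where "b \<in> UR" "x = y + 5 * b" "c \<in> UR" "y = z + 5 * c" unfolding ucong_def by blast
  then show ?thesis by (intro ucongI[of "b + c"] UR_ring(6)) (simp_all add: distrib_left)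
qed

lemma ucong_diff: "ucong x y \<Longrightarrow> ucong x' y' \<Longrightarrow> ucong (x - x') (y - y')"
proof -
  assume "ucong x y" "ucong x' y'"
  then obtain b c where "b \<in> UR" "x = y + 5 * b" "c \<in> UR" "x' = y' + 5 * c" unfolding ucong_def by blast
  then show ?thesis by (intro ucongI[of "b - c"] UR_ring(3)) (simp_all add: right_diff_distrib)
qed

lemma ucong_mult: "y \<in> UR \<Longrightarrow> y' \<in> UR \<Longrightarrow> ucong x y \<Longrightarrow> ucong x' y' \<Longrightarrow> ucong (x * x') (y * y')"
proof -
  assume y: "y \<in> UR" "y' \<in> UR" and "ucong x y" "ucong x' y'"
  then obtain b c where bc: "b \<in> UR" "x = y + 5 * b" "c \<in> UR" "x' = y' + 5 * c" unfolding ucong_def by blast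
  show ?thesis
  proof (rule ucongI)
    show "y * c + b * y' + 5 * b * c \<in> UR" using y bc by (intro UR_ring(6) UR_ring(4) UR_ring(10))
    show "x * x' = y * y' + 5 * (y * c + b * y' + 5 * b * c)"
      unfolding bc(2,4) by (simp add: algebra_simps)
  qed
qed

lemma ucong_power: "y \<in> UR \<Longrightarrow> ucong x y \<Longrightarrow> ucong (x ^ k) (y ^ k)"
  by (induction k) (simp_all add: ucong_refl ucong_mult UR_ring(7))

lemma ucong_frob_diff:
  assumes "x \<in> UR" "y \<in> UR"
  shows "ucong ((x - y) ^ 5 ^ k) (x ^ 5 ^ k - y ^ 5 ^ k)"
proof (induction k)
  case 0
  show ?case by (simp add: ucong_refl)
next
  case (Suc k)
  let ?u = "x ^ 5 ^ k" and ?v = "y ^ 5 ^ k"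
  have uv: "?u \<in> UR" "?v \<in> UR" using assms by (simp_all add: UR_ring(7))
  have pow: "z ^ 5 ^ Suc k = (z ^ 5 ^ k) ^ 5" for z :: qbar5
    by (simp add: power_mult[symmetric] mult.commute)
  have "ucong (((x - y) ^ 5 ^ k) ^ 5) ((?u - ?v) ^ 5)"
    by (rule ucong_power[OF UR_ring(3)[OF uv] Suc.IH])
  moreover have "ucong ((u - v) ^ 5) (u ^ 5 - v ^ 5)" if "u \<in> UR" "v \<in> UR" for u v
  proof (rule ucongI)
    show "2 * u ^ 3 * v ^ 2 - 2 * u ^ 2 * v ^ 3 + u * v ^ 4 - u ^ 4 * v \<in> UR"
      using that by (intro UR_ring(3) UR_ring(6) UR_ring(4) UR_ring(7) UR_ring(10))
    show "(u - v) ^ 5 = u ^ 5 - v ^ 5 + 5 * (2 * u ^ 3 * v ^ 2 - 2 * u ^ 2 * v ^ 3 + u * v ^ 4 - u ^ 4 * v)"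
      by (simp add: power_numeral_reduce algebra_simps)
  qed
  ultimately show ?case unfolding pow using uv ucong_trans by blast
qed

lemma ucong_frob_iterate:
  assumes "x \<in> UR" "ucong (x ^ 5 ^ m) x"
  shows "ucong (x ^ 5 ^ (m * k)) x"
proof (induction k)
  case 0
  show ?case by (simp add: ucong_refl)
next
  case (Suc k)
  have "x ^ 5 ^ (m * Suc k) = (x ^ 5 ^ (m * k)) ^ 5 ^ m"
    by (simp add: power_mult[symmetric] power_add mult.commute)
  then show ?case using ucong_trans[OF ucong_power[OF assms(1) Suc.IH] assms(2)] by simp
qed

text \<open>Otherwise no power of Frobenius fixes the residue, its powers are independent in the
  sense of \<open>zspan_M5_coeff\<close>, and the leading coefficient 1 of the integral equation
  would be divisible by 5.\<close>

lemma integral_red_Fq: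
  assumes "integral_over_z5 x"
  shows "\<exists>m\<ge>1. red x \<in> Fq m"
proof (rule ccontr)
  assume no: "\<not> ?thesis"
  obtain p where p: "lead_coeff p = 1" "poly (map_poly emb p) x = 0"
    using assms integral_over_z5_iff by auto
  have "(\<Sum>i<Suc (degree p). emb (coeff p i) * x ^ i) = 0"
    using p(2) by (simp add: poly_altdef coeff_map_poly lessThan_Suc_atMost)
  then have "(\<Sum>i<Suc (degree p). emb (coeff p i) * x ^ i) \<in> M5" using zero_in_M5 by simp
  from zspan_M5_coeff[OF _ integral_in_V5[OF assms] _ this, of "degree p"]
  have "5 dvd coeff p (degree p)" using no by simp
  then have "5 dvd (1 :: z5)" using p(1) by simp
  then show False using pow5_dvd_z5_iff[of 1 1] by (simp add: one_z5.rep_eq)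
qed

text \<open>The defining property of unramified extensions enters here: x^(5^m) - x has residue
  zero, so it is no unit, so it is 5 times an integer of \<open>L\<close>.\<close>

lemma ring_of_integers_frobenius:
  assumes L: "finite_unramified L" and x: "x \<in> ring_of_integers L"
  shows "\<exists>m\<ge>1. \<exists>b\<in>ring_of_integers L. x ^ 5 ^ m = x + 5 * b"
proof -
  have xi: "integral_over_z5 x" and xL: "x \<in> L" using x unfolding ring_of_integers_def by blast+
  obtain m where m: "m \<ge> 1" "red x \<in> Fq m" using integral_red_Fq[OF xi] by blast
  have xV: "x \<in> V5" by (rule integral_in_V5[OF xi])
  define y where "y = x ^ 5 ^ m - x"
  have Lsub: "is_subring L" using L unfolding finite_unramified_def using subfield_setD(1) by blast
  have "y = poly (map_poly emb (monom 1 (5 ^ m) - [:0, 1:])) x"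
  proof -
    have "map_poly emb (monom 1 (5 ^ m) - [:0, 1:]) = monom 1 (5 ^ m) - [:0, 1:]"
      by (rule poly_eqI) (simp add: coeff_map_poly emb.hom_minus coeff_pCons split: nat.split)
    then show ?thesis by (simp add: y_def poly_monom)
  qed
  then have "integral_over_z5 y" using integral_over_z5_poly[OF xi] by simp
  moreover have "y \<in> L" unfolding y_def using xL by (intro is_subringD(3)[OF Lsub] is_subringD(7)[OF Lsub])
  ultimately have yO: "y \<in> ring_of_integers L" unfolding ring_of_integers_def by blast
  have "red y = red x ^ 5 ^ m - red x" unfolding y_def
    using xV by (simp add: red_ring V5_ring red_power)
  then have "red y = 0" using m(2) by (simp add: Fq_def)
  then have "y \<in> M5" using red_eq_0_iff[of y] xV by (simp add: y_def V5_ring)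
  then have "y = 0 \<or> inverse y \<notin> ring_of_integers L"
    unfolding M5_def using integral_in_V5 unfolding ring_of_integers_def by blast
  with yO have "y \<in> (\<lambda>b. 5 * b) ` ring_of_integers L"
    using L unfolding finite_unramified_def by blast
  then obtain b where b: "b \<in> ring_of_integers L" "y = 5 * b" by blast
  then have "x ^ 5 ^ m = x + 5 * b" by (simp add: y_def algebra_simps)
  then show ?thesis using b(1) m(1) by blast
qed

text \<open>Two elements share the exponent \<open>m * k\<close>, and Frobenius respects differences
  and products modulo 5.\<close>

lemma UR_frobenius: "x \<in> UR \<Longrightarrow> \<exists>m\<ge>1. ucong (x ^ 5 ^ m) x"
proof (induction rule: UR.induct)
  case one
  show ?case by (intro exI[of _ 1]) (simp add: ucong_refl)
next
  case (incl L x)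
  then show ?case using ring_of_integers_frobenius[OF incl] UR.incl[OF incl(1)] ucongI by blast
next
  case (diff x y)
  then obtain m k where mk: "m \<ge> 1" "ucong (x ^ 5 ^ m) x" "k \<ge> 1" "ucong (y ^ 5 ^ k) y" by blast
  have "ucong (x ^ 5 ^ (m * k)) x" "ucong (y ^ 5 ^ (m * k)) y"
    using ucong_frob_iterate[OF diff.hyps(1) mk(2), of k] ucong_frob_iterate[OF diff.hyps(2) mk(4), of m]
    by (simp_all add: mult.commute)
  from ucong_trans[OF ucong_frob_diff[OF diff.hyps] ucong_diff[OF this]]
  have "ucong ((x - y) ^ 5 ^ (m * k)) (x - y)" .
  moreover have "m * k \<ge> 1" using mk by simp
  ultimately show ?case by blast
next
  case (mult x y)
  then obtain m k where mk: "m \<ge> 1" "ucong (x ^ 5 ^ m) x" "k \<ge> 1" "ucong (y ^ 5 ^ k) y" by blast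
  have "ucong (x ^ 5 ^ (m * k)) x" "ucong (y ^ 5 ^ (m * k)) y"
    using ucong_frob_iterate[OF mult.hyps(1) mk(2), of k] ucong_frob_iterate[OF mult.hyps(2) mk(4), of m]
    by (simp_all add: mult.commute)
  from ucong_mult[OF mult.hyps this]
  have "ucong ((x * y) ^ 5 ^ (m * k)) (x * y)" by (simp add: power_mult_distrib)
  moreover have "m * k \<ge> 1" using mk by simp
  ultimately show ?case by blast
qed

text \<open>If x^2 is divisible by 5, so is the higher power x^(5^m), which is congruent to
  x.\<close>

lemma UR_reduced:
  assumes x: "x \<in> UR" and sq: "b \<in> UR" "x ^ 2 = 5 * b"
  shows "\<exists>b\<in>UR. x = 5 * b"
proof -
  obtain m where m: "m \<ge> 1" "ucong (x ^ 5 ^ m) x" using UR_frobenius[OF x] by blast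
  obtain c where c: "c \<in> UR" "x ^ 5 ^ m = x + 5 * c" using m(2) unfolding ucong_def by blast
  have "(5 :: nat) ^ 1 \<le> 5 ^ m" using m(1) by (intro power_increasing) simp_all
  then have "5 ^ m = 2 + (5 ^ m - 2 :: nat)" by simp
  then have "x ^ 5 ^ m = x ^ 2 * x ^ (5 ^ m - 2)" by (metis power_add)
  then have "x = 5 * (b * x ^ (5 ^ m - 2) - c)" using c(2) sq(2) by (simp add: algebra_simps)
  moreover have "b * x ^ (5 ^ m - 2) - c \<in> UR" using x sq c by (intro UR_ring(3) UR_ring(4) UR_ring(7))
  ultimately show ?thesis by blast
qed

lemma emb_in_UR: "emb c \<in> UR"
proof -
  obtain \<theta> where "unram_ring 1 \<theta>" using ex_unram_ring[of 1] by auto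
  then interpret unram_ring 1 \<theta> .
  have "emb c \<in> ring_of_integers L" using emb_in_B ring_of_integers_L by simp
  then show ?thesis by (rule UR.incl[OF finite_unramified_L])
qed

lemma K5_subset: "x \<in> K5 \<Longrightarrow> \<exists>k. 5 ^ k * x \<in> UR"
proof -
  let ?K = "{x. \<exists>k. 5 ^ k * x \<in> UR}"
  have "subfield ?K qbar5_ring" by (rule subfield_pow5_localization[OF is_subring_UR emb_in_UR])
  moreover have "\<Union>{L. finite_unramified L} \<subseteq> ?K"
  proof
    fix x assume "x \<in> \<Union>{L. finite_unramified L}"
    then obtain L where L: "finite_unramified L" "x \<in> L" by blast
    have Lsub: "is_subring L" using L(1) unfolding finite_unramified_def using subfield_setD(1) by blast
    obtain k where k: "integral_over_z5 (5 ^ k * x)" using pow5_mult_integral by blast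
    have "5 ^ k * x \<in> L" by (intro is_subringD(4)[OF Lsub _ L(2)] is_subringD(7)[OF Lsub] is_subringD(10)[OF Lsub])
    with k have "5 ^ k * x \<in> UR" by (intro UR.incl[OF L(1)]) (simp add: ring_of_integers_def)
    then show "x \<in> ?K" by blast
  qed
  ultimately have "K5 \<subseteq> ?K" unfolding K5_def by (rule generate_field_subset)
  then show "x \<in> K5 \<Longrightarrow> \<exists>k. 5 ^ k * x \<in> UR" by blast
qed

lemma subfield_K5: "subfield K5 qbar5_ring"
  unfolding K5_def by (rule subfield_generate)

text \<open>Descent on k: for k > 0 the square of 5^k s is divisible by 5 in \<open>UR\<close>, so
  by \<open>UR_reduced\<close> 5^k s = 5 b, which lowers k. At k = 0 the equation s = 5 b gives 1/5
  = b^2 in \<open>V5\<close>.\<close>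

lemma sqrt5_notin_K5:
  assumes s: "s ^ 2 = (5 :: qbar5)"
  shows "s \<notin> K5"
proof
  assume "s \<in> K5"
  then obtain k where "5 ^ k * s \<in> UR" using K5_subset by blast
  moreover have "5 ^ k * s \<notin> UR" for k
  proof (induction k)
    case 0
    show ?case
    proof
      assume "5 ^ 0 * s \<in> UR"
      then have "s \<in> UR" by simp
      moreover have "s ^ 2 = 5 * 1" using s by simp
      ultimately obtain b where b: "b \<in> UR" "s = 5 * b" using UR_reduced[OF _ UR_ring(1)] by blast
      have "5 * (5 * b ^ 2) = 5 * 1" using s unfolding b(2) by (simp add: power2_eq_square mult_ac)
      then have "5 * b ^ 2 = 1" by (simp only: mult_cancel_left five_neq_0 simp_thms)
      then have e: "inverse 5 = b ^ 2" by (rule inverse_unique)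
      have "inverse 5 \<in> V5" unfolding e by (rule UR_subset_V5[OF UR_ring(7)[OF b(1)]])
      then show False using inverse_5_notin_V5 by blast
    qed
  next
    case (Suc k)
    show ?case
    proof
      assume *: "5 ^ Suc k * s \<in> UR"
      have "(5 ^ Suc k * s) ^ 2 = 5 * (5 * 5 ^ (2 * k) * 5)"
        unfolding power_mult_distrib s by (simp add: power_mult power2_eq_square mult_ac)
      moreover have "5 * 5 ^ (2 * k) * 5 \<in> UR" by (intro UR_ring(4) UR_ring(7) UR_ring(10))
      ultimately obtain b where b: "b \<in> UR" "5 ^ Suc k * s = 5 * b" using UR_reduced[OF *] by blast
      have "5 * (5 ^ k * s) = 5 * b" using b(2) by (simp add: mult.assoc)
      then have "5 ^ k * s = b" by (simp only: mult_cancel_left five_neq_0 simp_thms)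
      then show False using b(1) Suc.IH by simp
    qed
  qed
  ultimately show False by blast
qed


section \<open>The involution reversing cycles\<close>

text \<open>\<open>g(a / b, c / d)\<close>, multiplied by \<open>b\<^sup>5 d\<^sup>5\<close>.\<close>

definition g_hom :: "'a :: comm_ring_1 \<Rightarrow> 'a \<Rightarrow> 'a \<Rightarrow> 'a \<Rightarrow> 'a" where
  "g_hom a b c d = (c^4*d + 2*c^3*d^2 + 4*c^2*d^3 + 3*c*d^4 + d^5) * a^5
     - b^5 * (c^5 - 3*c^4*d + 4*c^3*d^2 - 2*c^2*d^3 + c*d^4)"

lemma g_hom_scale: "g_hom (u * b) b (v * d) d = b^5 * d^5 * g_poly u v"
  unfolding g_hom_def g_poly_def by (simp add: power_numeral_reduce algebra_simps)

definition T_num :: "'a :: comm_ring_1 \<Rightarrow> 'a \<Rightarrow> 'a" where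
  "T_num s x = 2 - (1 + s) * x"

definition T_den :: "'a :: comm_ring_1 \<Rightarrow> 'a \<Rightarrow> 'a" where
  "T_den s x = 2 * x + (1 + s)"

text \<open>Under \<open>T\<close> the two quintic forms in \<open>c, d\<close> become linear in \<open>x\<^sup>5\<close>, which splits the identity
  into identities in \<open>x\<close> alone and in \<open>y\<close> alone.\<close>

lemma g_hom_T:
  fixes s :: "'a :: comm_ring_1"
  assumes "s ^ 2 = 5"
  shows "g_hom (T_num s y) (T_den s y) (T_num s x) (T_den s x) = (320000 + 140800 * s) * g_poly x y"
proof -
  have s: "s * s = 5" "s * (s * z) = 5 * z" for z
    using assms by (simp_all add: power2_eq_square mult.assoc[symmetric])
  define a where "a = T_num s x"
  define b where "b = T_den s x"
  \<comment> \<open>\<open>880 + 400 * s\<close> is 160 times the fifth power of (1 + s) /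
    2.\<close>
  have 1: "a^4*b + 2*a^3*b^2 + 4*a^2*b^3 + 3*a*b^4 + b^5 = 160 * x^5 + (880 + 400 * s)"
    unfolding a_def b_def T_num_def T_den_def by (simp add: power_numeral_reduce algebra_simps s)
  have 2: "a^5 - 3*a^4*b + 4*a^3*b^2 - 2*a^2*b^3 + a*b^4 = 160 - (880 + 400 * s) * x^5"
    unfolding a_def b_def T_num_def T_den_def by (simp add: power_numeral_reduce algebra_simps s)
  \<comment> \<open>\<open>320000 + 140800 * s\<close> is the fifth power of
    \<open>4 + (1 + s) * (1 + s)\<close>, which is minus the determinant of T.\<close>
  have 3: "160 * T_num s y ^ 5 + (880 + 400 * s) * T_den s y ^ 5 =
      (320000 + 140800 * s) * (y^4 + 2*y^3 + 4*y^2 + 3*y + 1)"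
    unfolding T_num_def T_den_def by (simp add: power_numeral_reduce algebra_simps s)
  have 4: "160 * T_den s y ^ 5 - (880 + 400 * s) * T_num s y ^ 5 =
      (320000 + 140800 * s) * (y * (y^4 - 3*y^3 + 4*y^2 - 2*y + 1))"
    unfolding T_num_def T_den_def by (simp add: power_numeral_reduce algebra_simps s)
  have "g_hom (T_num s y) (T_den s y) a b =
      (160 * x^5 + (880 + 400 * s)) * T_num s y ^ 5 - T_den s y ^ 5 * (160 - (880 + 400 * s) * x^5)"
    unfolding g_hom_def 1 2 ..
  also have "\<dots> = (160 * T_num s y ^ 5 + (880 + 400 * s) * T_den s y ^ 5) * x^5
      - (160 * T_den s y ^ 5 - (880 + 400 * s) * T_num s y ^ 5)"
    by (simp add: algebra_simps)
  also have "\<dots> = (320000 + 140800 * s) * g_poly x y"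
    unfolding 3 4 g_poly_def by (simp add: right_diff_distrib mult.assoc)
  finally show ?thesis unfolding a_def b_def .
qed

text \<open>The matrix of T squares to the scalar \<open>4 + (1 + s) * (1 + s)\<close>, so T is an
  involution where defined.\<close>

lemma T_den_T: "(1 + s) * T_den s x + 2 * T_num s x = 4 + (1 + s) * (1 + s)"
  and T_num_T: "2 * T_den s x - (1 + s) * T_num s x = (4 + (1 + s) * (1 + s)) * x"
  for s :: "'a :: comm_ring_1"
  unfolding T_num_def T_den_def by (simp_all add: algebra_simps)

text \<open>Two factors matter: \<open>tau\<close> is a root of \<open>x^2 + x - 1\<close>, and the
  roots of \<open>x^2 + 1\<close> are the only candidates for points of \<open>K5\<close> with image
  under T in \<open>K5\<close>. All of them are fixed points.\<close>

lemma g_poly_diag: "g_poly x x = x * (x^2 + 1) * (x^2 + x - 1) * (x^4 + x^3 + 3*x^2 - x + 1)"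
  for x :: "'a :: comm_ring_1"
  unfolding g_poly_def by (simp add: power_numeral_reduce algebra_simps)

section \<open>Characteristic zero and elementary facts on cycles\<close>

lemma of_int_qbar5_eq_0_iff [simp]: "(of_int k :: qbar5) = 0 \<longleftrightarrow> k = 0"
proof
  assume "(of_int k :: qbar5) = 0"
  then have "emb (of_int k) = emb 0" by (simp only: emb.hom_of_int emb.hom_zero)
  then have k: "(of_int k :: z5) = 0" by (simp only: emb.eq_iff)
  have "k mod 5 ^ m = 0" for m
    using z5_res_of_int[of k m] unfolding k by (simp add: zero_z5.rep_eq)
  then have dvd: "5 ^ m dvd k" for m by (rule mod_0_imp_dvd)
  show "k = 0"
  proof (rule ccontr)
    assume "k \<noteq> 0"
    have "nat \<bar>k\<bar> < 5 ^ nat \<bar>k\<bar>"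
      by (rule less_le_trans[OF less_exp power_mono]) simp_all
    then have "int (nat \<bar>k\<bar>) < int (5 ^ nat \<bar>k\<bar>)" by (simp only: of_nat_less_iff)
    moreover have "\<bar>5 ^ nat \<bar>k\<bar>\<bar> \<le> \<bar>k\<bar>" using dvd_imp_le_int[OF \<open>k \<noteq> 0\<close> dvd] .
    ultimately show False by simp
  qed
qed simp

lemma numeral_qbar5_neq_0 [simp]: "(numeral k :: qbar5) \<noteq> 0"
  using of_int_qbar5_eq_0_iff[of "numeral k"] by simp

lemma inj_of_int_qbar5: "inj_comm_ring_hom (of_int :: int \<Rightarrow> qbar5)"
  by unfold_locales simp_all

lemma on_cycle_mult:
  assumes "on_cycle k a" "k \<ge> 1"
  shows "on_cycle (k * m) a"
proof -
  obtain c where c: "c 0 = a" "c k = a" "\<And>i. i < k \<Longrightarrow> g_poly (c i) (c (Suc i)) = 0"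
    using assms(1) unfolding on_cycle_def by blast
  have "g_poly (c (i mod k)) (c (Suc i mod k)) = 0" for i
  proof -
    have lt: "i mod k < k" using assms(2) by simp
    show ?thesis
    proof (cases "Suc (i mod k) = k")
      case True
      then have "Suc i mod k = 0" by (simp add: mod_Suc)
      then show ?thesis using c(3)[OF lt] True c(1,2) by simp
    next
      case False
      then have "Suc i mod k = Suc (i mod k)" by (simp add: mod_Suc)
      then show ?thesis using c(3)[OF lt] by simp
    qed
  qed
  then show ?thesis unfolding on_cycle_def
    using c(1) by (intro exI[of _ "\<lambda>i. c (i mod k)"]) simp
qed

lemma on_cycle_fixed: "g_poly a a = 0 \<Longrightarrow> on_cycle k a"
  unfolding on_cycle_def by (intro exI[of _ "\<lambda>_. a"]) simp

locale sqrt5 =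
  fixes s :: qbar5
  assumes s: "s ^ 2 = 5"
begin

lemma s_notin_K5: "s \<notin> K5"
  by (rule sqrt5_notin_K5[OF s])

lemma s_V5: "s \<in> V5"
proof (rule ccontr)
  assume "s \<notin> V5"
  then have i: "inverse s \<in> V5" using V5_valuation_ring by blast
  have e: "inverse 5 = inverse s * inverse s" unfolding s[symmetric] power2_eq_square by simp
  show False using V5_ring(4)[OF i i] inverse_5_notin_V5 unfolding e by blast
qed

lemma s_M5: "s \<in> M5"
  using M5_prime[OF s_V5 s_V5] five_in_M5 s by (simp add: power2_eq_square)

lemma s_neq_0: "s \<noteq> 0"
  using s five_neq_0 by (metis power_zero_numeral)

lemma ss: "s * s = 5"
  using s by (simp only: power2_eq_square)

lemma one_plus_s_neq_0: "1 + s \<noteq> 0"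
proof
  assume "1 + s = 0"
  then have "s = - 1" by (simp add: eq_neg_iff_add_eq_0 add.commute)
  then have "1 \<in> M5" using M5_uminus[OF s_M5] by simp
  then show False using one_notin_M5 by blast
qed

lemma disc_neq_0: "4 + (1 + s) * (1 + s) \<noteq> 0"
proof -
  have "4 + (1 + s) * (1 + s) = 5 + s * s + 2 * s" by (simp add: algebra_simps)
  also have "\<dots> = s * s + s * s + 2 * s" by (simp only: ss)
  also have "\<dots> = 2 * s * (1 + s)" by (simp add: algebra_simps)
  finally show ?thesis using s_neq_0 one_plus_s_neq_0 by simp
qed

text \<open>The pole of T, and also the image of infinity. As \<open>inverse 0 = 0\<close>, the
  value of T at \<open>tau\<close> is a mere default, which is why lemmas on T exclude this
  point.\<close>

definition tau :: qbar5 where "tau = - (1 + s) * inverse 2"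

definition T :: "qbar5 \<Rightarrow> qbar5" where "T x = T_num s x * inverse (T_den s x)"

lemma T_den_eq_0_iff: "T_den s x = 0 \<longleftrightarrow> x = tau"
proof
  assume "T_den s x = 0"
  then have "2 * x = - (1 + s)" unfolding T_den_def by (simp only: eq_neg_iff_add_eq_0)
  then have "2 * x * inverse 2 = - (1 + s) * inverse 2" by (simp only:)
  moreover have "2 * x * inverse 2 = x" by (simp add: mult.commute mult.left_commute)
  ultimately show "x = tau" by (simp only: tau_def)
next
  assume x: "x = tau"
  have "2 * tau = - (1 + s) * (2 * inverse 2)" unfolding tau_def by (simp only: mult_ac)
  also have "2 * inverse 2 = (1 :: qbar5)" by (rule right_inverse) simp
  finally have "2 * tau = - (1 + s)" by simp
  then show "T_den s x = 0" unfolding T_den_def x by simp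
qed

lemma T_mult_den: "x \<noteq> tau \<Longrightarrow> T x * T_den s x = T_num s x"
  unfolding T_def using T_den_eq_0_iff[of x] by (simp add: mult.assoc)

lemma T_den_T_mult: "x \<noteq> tau \<Longrightarrow> T_den s (T x) * T_den s x = 4 + (1 + s) * (1 + s)"
proof -
  assume x: "x \<noteq> tau"
  have "T_den s (T x) * T_den s x = 2 * (T x * T_den s x) + (1 + s) * T_den s x"
    unfolding T_den_def[of s "T x"] by (simp add: distrib_right mult.assoc)
  then show ?thesis unfolding T_mult_den[OF x] using T_den_T[of s x] by (simp add: add.commute)
qed

lemma T_neq_tau: "x \<noteq> tau \<Longrightarrow> T x \<noteq> tau"
  using T_den_T_mult[of x] disc_neq_0 T_den_eq_0_iff[of "T x"] by auto

lemma T_T: "x \<noteq> tau \<Longrightarrow> T (T x) = x"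
proof -
  assume x: "x \<noteq> tau"
  have dx: "T_den s x \<noteq> 0" using x T_den_eq_0_iff by blast
  have dT: "T_den s (T x) \<noteq> 0" using T_neq_tau[OF x] T_den_eq_0_iff by blast
  have "T_num s (T x) * T_den s x = 2 * T_den s x - (1 + s) * (T x * T_den s x)"
    unfolding T_num_def[of s "T x"] by (simp add: left_diff_distrib mult.assoc)
  also have "\<dots> = (4 + (1 + s) * (1 + s)) * x" unfolding T_mult_den[OF x] by (rule T_num_T)
  also have "\<dots> = x * T_den s (T x) * T_den s x"
    unfolding T_den_T_mult[OF x, symmetric] by (simp only: mult_ac)
  finally have "T_num s (T x) = x * T_den s (T x)" using dx by simp
  then show ?thesis unfolding T_def[of "T x"] using dT by (simp add: mult.assoc)
qed

lemma g_poly_T: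
  assumes "x \<noteq> tau" "y \<noteq> tau" "g_poly x y = 0"
  shows "g_poly (T y) (T x) = 0"
proof -
  have "T_den s y ^ 5 * T_den s x ^ 5 * g_poly (T y) (T x) = 0"
    unfolding g_hom_scale[symmetric] T_mult_den[OF assms(1)] T_mult_den[OF assms(2)] g_hom_T[OF s] assms(3)
    by simp
  then show ?thesis using assms(1,2) T_den_eq_0_iff by simp
qed

text \<open>T sends \<open>tau\<close> to infinity: in \<open>g_hom_T\<close> the second denominator
  vanishes and, up to sign, only \<open>T_den s y ^ 5 * T_num s tau ^ 5\<close> remains. Hence a
  cycle that meets \<open>tau\<close> stays there, and T may be applied along every other
  cycle.\<close>

lemma g_poly_tau:
  assumes "g_poly tau y = 0"
  shows "y = tau"
proof -
  have d: "T_den s tau = 0" using T_den_eq_0_iff by blast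
  have "g_hom (T_num s y) (T_den s y) (T_num s tau) 0 = 0"
    using g_hom_T[OF s, of y tau] unfolding d assms by simp
  then have "T_den s y ^ 5 * T_num s tau ^ 5 = 0" unfolding g_hom_def by simp
  moreover have "T_num s tau \<noteq> 0"
  proof
    assume "T_num s tau = 0"
    then have "4 + (1 + s) * (1 + s) = 0" using T_den_T[of s tau] d by simp
    then show False using disc_neq_0 by blast
  qed
  ultimately show ?thesis using T_den_eq_0_iff by simp
qed

lemma on_cycle_tau: "on_cycle k tau"
proof (rule on_cycle_fixed)
  have t: "2 * tau = - (1 + s)"
    using T_den_eq_0_iff[of tau] unfolding T_den_def by (simp only: eq_neg_iff_add_eq_0 simp_thms)
  have "(2 * tau) * (2 * tau) + 2 * (2 * tau) - 4 = (1 + s) * (1 + s) - 2 * (1 + s) - 4"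
    unfolding t by (simp add: algebra_simps)
  also have "\<dots> = s * s - 5" by (simp add: algebra_simps)
  also have "\<dots> = 0" by (simp only: ss diff_self)
  finally have "4 * (tau ^ 2 + tau - 1) = 0" by (simp add: power2_eq_square algebra_simps)
  then have "tau ^ 2 + tau - 1 = 0" by (simp only: mult_eq_0_iff numeral_qbar5_neq_0 simp_thms)
  then show "g_poly tau tau = 0" unfolding g_poly_diag by simp
qed

lemma on_cycle_T:
  assumes a: "a \<noteq> tau" and "on_cycle k a"
  shows "on_cycle k (T a)"
proof -
  obtain c where c: "c 0 = a" "c k = a" "\<And>i. i < k \<Longrightarrow> g_poly (c i) (c (Suc i)) = 0"
    using assms(2) unfolding on_cycle_def by blast
  \<comment> \<open>Once at \<open>tau\<close>, the cycle stays there up to its end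
    \<open>c k = a\<close>.\<close>
  have ct: "c i \<noteq> tau" if "i \<le> k" for i
  proof
    assume i: "c i = tau"
    have "c (i + j) = tau" if "i + j \<le> k" for j
      using that
    proof (induction j)
      case 0
      show ?case using i by simp
    next
      case (Suc j)
      then have "g_poly (c (i + j)) (c (Suc (i + j))) = 0" using c(3)[of "i + j"] by simp
      then show ?case using Suc g_poly_tau by simp
    qed
    from this[of "k - i"] show False using \<open>i \<le> k\<close> c(2) a by simp
  qed
  have "g_poly (T (c (k - i))) (T (c (k - Suc i))) = 0" if "i < k" for i
  proof -
    have "Suc (k - Suc i) = k - i" using that by simp
    then have "g_poly (c (k - Suc i)) (c (k - i)) = 0" using c(3)[of "k - Suc i"] that by simp
    then show ?thesis using ct by (intro g_poly_T) simp_all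
  qed
  then show ?thesis unfolding on_cycle_def
    using c(1,2) by (intro exI[of _ "\<lambda>i. T (c (k - i))"]) simp
qed

lemma on_cycle_T_iff: "a \<noteq> tau \<Longrightarrow> on_cycle k (T a) \<longleftrightarrow> on_cycle k a"
  using on_cycle_T[of a k] on_cycle_T[of "T a" k] T_T[of a] T_neq_tau[of a] by auto

lemma K5_neq_tau: "a \<in> K5 \<Longrightarrow> a \<noteq> tau"
proof
  note K = is_subringD[OF subfield_setD(1)[OF subfield_K5]]
  assume a: "a \<in> K5" "a = tau"
  then have "T_den s a = 0" using T_den_eq_0_iff by blast
  then have "s = - (2 * a + 1)" unfolding T_den_def by (simp add: eq_neg_iff_add_eq_0 algebra_simps)
  moreover have "- (2 * a + 1) \<in> K5" using a(1) by (intro K(5) K(6) K(4) K(10) K(1))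
  ultimately show False using s_notin_K5 by simp
qed

text \<open>Clearing the denominator of T shows that \<open>s * (a + T a)\<close> lies in
  \<open>K5\<close>. Since \<open>s\<close> does not, \<open>a + T a\<close> vanishes, and what is
  left of the relation reads a^2 = -1.\<close>

lemma T_in_K5:
  assumes "a \<in> K5" "T a \<in> K5"
  shows "a ^ 2 = - 1" "T a = - a"
proof -
  note K = is_subringD[OF subfield_setD(1)[OF subfield_K5]]
  have "T a * (2 * a + (1 + s)) = 2 - (1 + s) * a"
    using T_mult_den[OF K5_neq_tau[OF assms(1)]] unfolding T_num_def T_den_def .
  then have e: "s * (a + T a) = 2 - a - T a - 2 * a * T a" by (simp add: algebra_simps)
  have sum: "a + T a = 0"
  proof (rule ccontr)
    assume nz: "a + T a \<noteq> 0"
    have "s = (2 - a - T a - 2 * a * T a) * inverse (a + T a)"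
      unfolding e[symmetric] using nz by (simp add: mult.assoc)
    moreover have "(2 - a - T a - 2 * a * T a) * inverse (a + T a) \<in> K5"
      using subfield_setD(2)[OF subfield_K5 K(6)[OF assms]]
      by (intro K(4) K(3) K(10) assms)
    ultimately show False using s_notin_K5 by simp
  qed
  then show Ta: "T a = - a" by (simp add: eq_neg_iff_add_eq_0 add.commute)
  have "2 * (a ^ 2 + 1) = 0" using e unfolding Ta by (simp add: power2_eq_square algebra_simps)
  then have "a ^ 2 + 1 = 0" by (simp only: mult_eq_0_iff numeral_qbar5_neq_0 simp_thms)
  then show "a ^ 2 = - 1" by (simp add: eq_neg_iff_add_eq_0)
qed

end


section \<open>Counting periodic points\<close>

lemma poly_of_int_poly_var: "poly (of_int_poly p) ([:0, 1:] :: 'a :: comm_ring_1 poly) = of_int_poly p"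
  by (induction p) (simp_all add: map_poly_pCons of_int_poly)

text \<open>The reduction of \<open>R_diag\<close> is recovered by specialising x at the variable of
  the polynomial ring over \<open>rf\<close>, itself a domain of characteristic 5.\<close>

lemma R_diag_rf:
  assumes "n \<ge> 1"
  shows "(of_int_poly (R_diag n) :: rf poly) =
    smult ((-1) ^ n) (([:0, 1:] - monom 1 (5 ^ n)) * [:- 2, 1:] ^ (5 ^ n - 1))"
proof -
  let ?x = "[:0, 1:] :: rf poly"
  obtain m where m: "n = Suc m" using assms by (cases n) auto
  have five: "(5 :: rf poly) = 0" using rf_five by (simp add: numeral_poly)
  have "of_int_poly (R_diag n) = poly (spec ?x (R_iter n)) ?x"
    using poly_R_diag[of n ?x] by (simp only: poly_of_int_poly_var)
  also have "\<dots> = (-1) ^ n * ((?x - ?x ^ 5 ^ n) * (?x - 2) ^ (5 ^ n - 1))"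
    unfolding m spec_R_iter_char_5[OF five]
    by (simp only: poly_smult poly_mult poly_power poly_pCons poly_0) simp
  also have "?x ^ 5 ^ n = monom 1 (5 ^ n)" by (simp add: monom_altdef)
  also have "?x - 2 = [:- 2, 1:]" by (simp add: numeral_poly)
  also have "(-1) ^ n * p = smult ((-1) ^ n) p" for p :: "rf poly"
    by (cases "even n") simp_all
  finally show ?thesis .
qed

lemma poly_R_diag_rf:
  "n \<ge> 1 \<Longrightarrow> poly (of_int_poly (R_diag n)) \<xi> = (-1) ^ n * ((\<xi> - \<xi> ^ 5 ^ n) * (\<xi> - 2) ^ (5 ^ n - 1))"
  for \<xi> :: rf
  by (simp add: R_diag_rf poly_monom)

text \<open>The factor X - X^(5^n) has derivative 1, so its roots are simple wherever the other
  factor does not vanish.\<close>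

lemma pderiv_R_diag_rf:
  assumes n: "n \<ge> 1" and \<xi>: "\<xi> \<in> Fq n" "\<xi> \<noteq> 2"
  shows "poly (of_int_poly (pderiv (R_diag n))) \<xi> \<noteq> 0"
proof -
  let ?u = "[:0, 1:] - monom 1 (5 ^ n) :: rf poly"
  have q0: "(of_nat (5 ^ n) :: rf) = 0" using n rf_five by (cases n) simp_all
  have "poly (pderiv ?u) \<xi> = 1"
    using q0 by (simp add: pderiv_diff pderiv_monom pderiv_pCons poly_monom)
  moreover have "poly ?u \<xi> = 0" using \<xi>(1) by (simp add: poly_monom Fq_def)
  ultimately have "poly (pderiv (?u * [:- 2, 1:] ^ (5 ^ n - 1))) \<xi> = (\<xi> - 2) ^ (5 ^ n - 1)"
    by (simp add: pderiv_mult poly_power del: mult_pCons_left mult_pCons_right)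
  then have "poly (pderiv (of_int_poly (R_diag n))) \<xi> = (-1) ^ n * (\<xi> - 2) ^ (5 ^ n - 1)"
    unfolding R_diag_rf[OF n] pderiv_smult poly_smult by simp
  then show ?thesis using \<xi>(2) by (simp add: pderiv_of_int_poly)
qed

lemma R_diag_neq_0: "n \<ge> 1 \<Longrightarrow> R_diag n \<noteq> 0"
proof
  assume n: "n \<ge> 1" and "R_diag n = 0"
  then have "poly (of_int_poly (pderiv (R_diag n))) (0 :: rf) = 0" by simp
  moreover have "(0 :: rf) \<in> Fq n" by (simp add: Fq_def zero_power)
  moreover have "(2 :: rf) \<noteq> 0" using of_int_rf_eq_0_iff[of 2] by simp
  ultimately show False using pderiv_R_diag_rf[OF n, of 0] by metis
qed

lemma on_cycle_red:
  assumes "k \<ge> 1" "a \<in> V5" "on_cycle k a" "red a \<noteq> 2"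
  shows "red a \<in> Fq k"
proof -
  have "poly (of_int_poly (R_diag k)) a = 0" using assms on_cycle_iff_R_diag by blast
  then have "poly (of_int_poly (R_diag k)) (red a) = 0"
    using red_poly[OF assms(2), of "R_diag k"] by (simp add: red_ring)
  then show ?thesis using assms(4) unfolding poly_R_diag_rf[OF assms(1)] Fq_def by simp
qed

lemma on_cycle_unique:
  assumes "k \<ge> 1" "a \<in> V5" "b \<in> V5" "on_cycle k a" "on_cycle k b" "red a = red b" "red a \<noteq> 2"
  shows "a = b"
proof (rule root_lift_unique[OF assms(2,3,6)])
  show "poly (of_int_poly (R_diag k)) a = 0" "poly (of_int_poly (R_diag k)) b = 0"
    using assms(4,5) on_cycle_iff_R_diag[OF assms(1)] by blast+
  show "poly (of_int_poly (pderiv (R_diag k))) (red a) \<noteq> 0"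
    by (rule pderiv_R_diag_rf[OF assms(1) on_cycle_red[OF assms(1,2,4,7)] assms(7)])
qed

lemma Fq_diff: "\<xi> \<in> Fq j \<Longrightarrow> \<xi> \<in> Fq k \<Longrightarrow> j \<le> k \<Longrightarrow> \<xi> \<in> Fq (k - j)"
proof -
  assume *: "\<xi> \<in> Fq j" "\<xi> \<in> Fq k" "j \<le> k"
  have "(5 :: nat) ^ k = 5 ^ (k - j) * 5 ^ j" using *(3) by (simp flip: power_add)
  then have "(\<xi> ^ 5 ^ (k - j)) ^ 5 ^ j = \<xi> ^ 5 ^ k" by (simp add: power_mult)
  then have "(\<xi> ^ 5 ^ (k - j)) ^ 5 ^ j = \<xi> ^ 5 ^ j" using *(1,2) by (simp add: Fq_def)
  then have "\<xi> ^ 5 ^ (k - j) = \<xi>" by (rule frobenius_inj)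
  then show ?thesis by (simp add: Fq_def)
qed

lemma Fq_mod: "\<xi> \<in> Fq p \<Longrightarrow> \<xi> \<in> Fq k \<Longrightarrow> \<xi> \<in> Fq (k mod p)"
proof (induction k rule: less_induct)
  case (less k)
  show ?case
  proof (cases "p = 0 \<or> k < p")
    case True
    then show ?thesis using less.prems by auto
  next
    case False
    then have "\<xi> \<in> Fq (k - p)" using Fq_diff less.prems by simp
    then have "\<xi> \<in> Fq ((k - p) mod p)" using less.IH[of "k - p"] less.prems False by simp
    then show ?thesis using False by (simp add: le_mod_geq)
  qed
qed

context unram_ring
begin

text \<open>Residue 2 is left out: it is a multiple root of the reduction, to which simple lifting
  does not apply.\<close>

definition S :: "qbar5 set" where "S = {a \<in> B. on_cycle n a \<and> red a \<noteq> 2}"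

lemma on_cycle_lift:
  assumes "k \<ge> 1" "\<xi> \<in> Fq n" "\<xi> \<in> Fq k" "\<xi> \<noteq> 2"
  shows "\<exists>a\<in>B. on_cycle k a \<and> red a = \<xi>"
proof -
  obtain x where x: "x \<in> B" "red x = \<xi>" using red_B_surj[OF assms(2)] by blast
  have "poly (of_int_poly (R_diag k)) (red x) = 0"
    unfolding x(2) poly_R_diag_rf[OF assms(1)] using assms(3) by (simp add: Fq_def)
  from B_hensel[OF x(1) this] pderiv_R_diag_rf[OF assms(1,3,4)] x(2)
  obtain a where "a \<in> B" "poly (of_int_poly (R_diag k)) a = 0" "red a = \<xi>" by auto
  then show ?thesis using on_cycle_iff_R_diag[OF assms(1)] by blast
qed

text \<open>If the residue lies in \<open>Fq k\<close>, it has a lift \<open>b\<close> on a cycle of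
  length \<open>k\<close>. Both \<open>a\<close> and \<open>b\<close> lie on cycles of length
  \<open>n * k\<close> and have the same residue, so uniqueness of lifts identifies them.\<close>

lemma S_on_cycle_iff:
  assumes a: "a \<in> S" and k: "k \<ge> 1"
  shows "on_cycle k a \<longleftrightarrow> red a \<in> Fq k"
proof
  have aB: "a \<in> B" "on_cycle n a" "red a \<noteq> 2" using a unfolding S_def by auto
  show "on_cycle k a \<Longrightarrow> red a \<in> Fq k" using on_cycle_red[OF k B_subset_V5[OF aB(1)]] aB(3) by blast
  assume "red a \<in> Fq k"
  then obtain b where b: "b \<in> B" "on_cycle k b" "red b = red a"
    using on_cycle_lift[OF k red_B[OF aB(1)] _ aB(3)] by blast
  have nk: "n * k \<ge> 1" using n k by simp
  have ca: "on_cycle (n * k) a" by (rule on_cycle_mult[OF aB(2) n])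
  have cb: "on_cycle (n * k) b" using on_cycle_mult[OF b(2) k, of n] by (simp add: mult.commute)
  have "a = b"
    by (rule on_cycle_unique[OF nk B_subset_V5[OF aB(1)] B_subset_V5[OF b(1)] ca cb b(3)[symmetric] aB(3)])
  then show "on_cycle k a" using b(2) by simp
qed

lemma red_bij_S: "bij_betw red S (Fq n - {2})"
proof (rule bij_betwI')
  fix a b assume "a \<in> S" "b \<in> S"
  then show "(red a = red b) = (a = b)"
    using on_cycle_unique[OF n, of a b] B_subset_V5 unfolding S_def by blast
next
  fix a assume "a \<in> S"
  then show "red a \<in> Fq n - {2}" using red_B unfolding S_def by blast
next
  fix \<xi> assume "\<xi> \<in> Fq n - {2}"
  then show "\<exists>a\<in>S. \<xi> = red a" using on_cycle_lift[OF n, of \<xi>] unfolding S_def by blast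
qed

lemma card_S: "finite S" "card S = 5 ^ n - 1"
proof -
  have "(2 :: rf) \<in> Fq n" using frobenius_of_int[of 2 n] by (simp add: Fq_def)
  then have "card (Fq n - {2}) = 5 ^ n - 1" using card_Fq[OF n] by simp
  then show "card S = 5 ^ n - 1" using bij_betw_same_card[OF red_bij_S] by simp
  show "finite S" using bij_betw_finite[OF red_bij_S] card_Fq_le[OF n] by simp
qed

lemma S_subset_K5: "a \<in> S \<Longrightarrow> a \<in> K5"
  using L_subset_K5 B_subset_L unfolding S_def by blast

end

context sqrt5
begin

text \<open>The number of points found meets the degree bound, which yields at once that the list is
  complete and that every root is simple.\<close>

lemma on_cycle_set:
  assumes "unram_ring n \<theta>"
  shows "{a. on_cycle n a} = unram_ring.S n \<theta> \<union> T ` unram_ring.S n \<theta> \<union> {tau}" (is "?Z = ?W")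
    and "finite {a. on_cycle n a}"
    and "on_cycle n a \<Longrightarrow> order a (of_int_poly (R_diag n)) = 1"
    and "unram_ring.S n \<theta> \<inter> T ` unram_ring.S n \<theta> = {}"
    and "inj_on T (unram_ring.S n \<theta>)"
proof -
  interpret U: unram_ring n \<theta> by fact
  let ?S = U.S
  let ?p = "of_int_poly (R_diag n) :: qbar5 poly"
  interpret i: inj_comm_ring_hom "of_int :: int \<Rightarrow> qbar5" by (rule inj_of_int_qbar5)
  have p: "?p \<noteq> 0" using R_diag_neq_0[OF U.n] by (simp add: poly_eq_iff coeff_map_poly)
  have Z: "?Z = {a. poly ?p a = 0}" using on_cycle_iff_R_diag[OF U.n] by blast
  show fin: "finite ?Z" unfolding Z by (rule poly_roots_finite[OF p])
  have tau: "a \<noteq> tau" if "a \<in> ?S" for a using K5_neq_tau U.S_subset_K5 that by blast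
  show inj: "inj_on T ?S" by (rule inj_on_inverseI[of _ T]) (rule T_T[OF tau])
  show disj: "?S \<inter> T ` ?S = {}"
  proof (rule equals0I)
    fix b assume "b \<in> ?S \<inter> T ` ?S"
    then obtain a where a: "a \<in> ?S" "b = T a" "T a \<in> ?S" by blast
    \<comment> \<open>A common point would give square roots a and -a of -1, both in
      \<open>S\<close>; their residues are 2 and -2 in some order, and \<open>S\<close> excludes
      residue 2.\<close>
    have "a ^ 2 = - 1" "T a = - a"
      using T_in_K5[OF U.S_subset_K5[OF a(1)] U.S_subset_K5[OF a(3)]] by blast+
    have aV: "a \<in> V5" "red a \<noteq> 2" "red (T a) \<noteq> 2" using a U.B_subset_V5 unfolding U.S_def by blast+
    have "red a ^ 2 = - 1" using red_power[OF aV(1), of 2] \<open>a ^ 2 = - 1\<close> by (simp add: red_ring V5_ring)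
    moreover have "(red a - 2) * (red a + 2) = red a ^ 2 + 1 - 5"
      by (simp add: power2_eq_square algebra_simps)
    ultimately have "(red a - 2) * (red a + 2) = 0" using rf_five by simp
    then have "red a + 2 = 0" using aV(2) by simp
    then have "2 = - red a" by (simp only: add_eq_0_iff)
    moreover have "red (T a) = - red a" unfolding \<open>T a = - a\<close> using aV(1) by (rule red_ring(6))
    ultimately show False using aV(3) by simp
  qed
  have sub: "?W \<subseteq> ?Z"
    using on_cycle_T[OF tau] on_cycle_tau unfolding U.S_def by blast
  have "tau \<notin> T ` ?S"
  proof
    assume "tau \<in> T ` ?S"
    then obtain a where a: "a \<in> ?S" "tau = T a" by (rule imageE)
    show False using T_neq_tau[OF tau[OF a(1)]] a(2) by simp
  qed
  moreover have "tau \<notin> ?S" using tau by blast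
  ultimately have "tau \<notin> ?S \<union> T ` ?S" by simp
  then have "card ?W = Suc (card (?S \<union> T ` ?S))" using U.card_S by simp
  also have "card (?S \<union> T ` ?S) = card ?S + card (T ` ?S)"
    using disj U.card_S by (intro card_Un_disjoint) simp_all
  also have "card (T ` ?S) = card ?S" by (rule card_image[OF inj])
  also have "Suc (card ?S + card ?S) = 2 * 5 ^ n - 1" unfolding U.card_S using one_le_power[of "5 :: nat" n] by linarith
  finally have cW: "card ?W = 2 * 5 ^ n - 1" .
  have deg: "degree ?p \<le> 2 * 5 ^ n - 1"
    using degree_R_diag[OF U.n] degree_map_poly_le[of of_int "R_diag n"] by (rule order.trans[rotated])
  have "card ?Z \<le> degree ?p" unfolding Z by (rule card_poly_roots_bound[OF p])
  then have cZ: "card ?Z \<le> card ?W" using deg cW by simp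
  then show "?Z = ?W" using card_seteq[OF fin sub] by blast
  then have cZ': "card ?Z = 2 * 5 ^ n - 1" using cW by simp
  have ord1: "order x ?p \<ge> 1" if "x \<in> ?Z" for x
    using that p order_root[of ?p x] unfolding Z by (cases "order x ?p") auto
  show "order a ?p = 1" if a: "on_cycle n a"
  proof (rule ccontr)
    assume "order a ?p \<noteq> 1"
    then have 2: "order a ?p \<ge> 2" using ord1[of a] a by auto
    have aZ: "a \<in> ?Z" using a by simp
    have "(\<Sum>x\<in>?Z. order x ?p) = order a ?p + (\<Sum>x\<in>?Z - {a}. order x ?p)"
      by (rule sum.remove[OF fin aZ])
    moreover have "(\<Sum>x\<in>?Z - {a}. order x ?p) \<ge> (\<Sum>x\<in>?Z - {a}. 1)"
      by (rule sum_mono) (use ord1 in blast)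
    moreover have "(\<Sum>x\<in>?Z - {a}. 1) = card ?Z - 1" using fin aZ by simp
    moreover have "card ?Z \<ge> 1" using fin aZ card_0_eq[of ?Z] by (metis One_nat_def Suc_leI card_gt_0_iff empty_iff)
    ultimately have "(\<Sum>x\<in>?Z. order x ?p) \<ge> Suc (card ?Z)" using 2 by simp
    moreover have "(\<Sum>x\<in>?Z. order x ?p) \<le> degree ?p" unfolding Z by (rule sum_order_le_degree[OF p])
    ultimately show False using deg cZ' one_le_power[of "5 :: nat" n] by linarith
  qed
qed

lemma on_cycle_cases:
  assumes U: "unram_ring n \<theta>" and a: "on_cycle n a"
  obtains "a \<in> unram_ring.S n \<theta>" | b where "b \<in> unram_ring.S n \<theta>" "b \<noteq> tau" "a = T b" | "a = tau"
proof -
  interpret U: unram_ring n \<theta> by fact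
  have "a \<in> U.S \<union> T ` U.S \<union> {tau}" using a on_cycle_set(1)[OF U] by blast
  then show thesis using that K5_neq_tau[OF U.S_subset_K5] by blast
qed

text \<open>The residue of the unramified representative decides all cycle lengths of a periodic
  point at once. For the fixed point \<open>tau\<close>, which has no such representative, the
  residue 0 serves.\<close>

lemma periodic_Fq:
  assumes "periodic_point a"
  shows "\<exists>\<xi>. \<forall>k\<ge>1. on_cycle k a \<longleftrightarrow> \<xi> \<in> Fq k"
proof -
  obtain n where n: "n \<ge> 1" "on_cycle n a" using assms unfolding periodic_point_def by blast
  obtain \<theta> where U: "unram_ring n \<theta>" using ex_unram_ring[OF n(1)] by blast
  interpret U: unram_ring n \<theta> by fact
  show ?thesis
  proof (cases rule: on_cycle_cases[OF U n(2)])
    case 1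
    show ?thesis using U.S_on_cycle_iff[OF 1] by (intro exI[of _ "red a"]) blast
  next
    case (2 b)
    have "on_cycle k a \<longleftrightarrow> red b \<in> Fq k" if "k \<ge> 1" for k
      unfolding 2(3) on_cycle_T_iff[OF 2(2)]
      by (rule U.S_on_cycle_iff[OF 2(1) that])
    then show ?thesis by (intro exI[of _ "red b"]) blast
  next
    case 3
    have "(0 :: rf) \<in> Fq k" for k by (simp add: Fq_def zero_power)
    then show ?thesis using 3 on_cycle_tau by (intro exI[of _ 0]) blast
  qed
qed

lemma minimal_period:
  assumes "periodic_point a"
  shows "minimal_period a \<ge> 1" "on_cycle (minimal_period a) a"
    and "k \<ge> 1 \<Longrightarrow> on_cycle k a \<longleftrightarrow> minimal_period a dvd k"
proof -
  let ?p = "minimal_period a"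
  have "\<exists>n. n \<ge> 1 \<and> on_cycle n a" using assms unfolding periodic_point_def by blast
  then have p: "?p \<ge> 1 \<and> on_cycle ?p a" unfolding minimal_period_def by (rule LeastI_ex)
  then show "?p \<ge> 1" "on_cycle ?p a" by blast+
  obtain \<xi> where \<xi>: "\<And>k. k \<ge> 1 \<Longrightarrow> on_cycle k a \<longleftrightarrow> \<xi> \<in> Fq k" using periodic_Fq[OF assms] by blast
  have min: "?p \<le> k" if "k \<ge> 1" "on_cycle k a" for k
    unfolding minimal_period_def using that by (intro Least_le) blast
  show "on_cycle k a \<longleftrightarrow> ?p dvd k" if k: "k \<ge> 1"
  proof
    assume "on_cycle k a"
    then have "\<xi> \<in> Fq (k mod ?p)" using \<xi> k p Fq_mod by blast
    have "k mod ?p < ?p" using p by simp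
    have "k mod ?p = 0"
    proof (rule ccontr)
      assume "k mod ?p \<noteq> 0"
      then have ge: "k mod ?p \<ge> 1" by simp
      then have "on_cycle (k mod ?p) a" using \<xi>[OF ge] \<open>\<xi> \<in> Fq (k mod ?p)\<close> by blast
      from min[OF ge this] \<open>k mod ?p < ?p\<close> show False by simp
    qed
    then show "?p dvd k" by (rule mod_0_imp_dvd)
  next
    assume "?p dvd k"
    then obtain m where "k = ?p * m" by (rule dvdE)
    then show "on_cycle k a" using on_cycle_mult[of ?p a m] p by simp
  qed
qed

lemma order_R_diag:
  assumes "k \<ge> 1"
  shows "order a (of_int_poly (R_diag k)) = (if on_cycle k a then 1 else 0)"
proof (cases "on_cycle k a")
  case True
  obtain \<theta> where "unram_ring k \<theta>" using ex_unram_ring[OF assms] by blast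
  then show ?thesis using on_cycle_set(3) True by simp
next
  case False
  then show ?thesis using on_cycle_iff_R_diag[OF assms] order_0I by simp
qed

end


section \<open>The rational function of minimal period\<close>

lemma moebius_prime_mult:
  assumes p: "prime p" and e: "squarefree e" "\<not> p dvd e"
  shows "squarefree (p * e)" "moebius (p * e) = - moebius e"
proof -
  have cop: "coprime p e" using p e(2) by (rule prime_imp_coprime)
  have e0: "e \<noteq> 0" using e(1) not_squarefree_0 by metis
  show sf: "squarefree (p * e)"
    using cop e(1) squarefree_prime[OF p] by (intro squarefree_mult_coprime)
  have "prime_factors (p * e) = insert p (prime_factors e)"
    using p e0 by (subst prime_factors_product) (auto simp: prime_prime_factors prime_gt_0_nat)
  moreover have "p \<notin> prime_factors e" using e(2) by auto
  ultimately show "moebius (p * e) = - moebius e"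
    unfolding moebius_def using sf e(1) by simp
qed

text \<open>The squarefree divisors pair off as e and p e, for a prime p dividing \<open>m\<close>,
  with opposite signs.\<close>

lemma sum_moebius:
  assumes "m \<ge> 1"
  shows "(\<Sum>e | e dvd m. moebius e) = (if m = 1 then 1 else 0)"
proof (cases "m = 1")
  case True
  have "{e. e dvd m} = {1}" using True by auto
  then show ?thesis using True by (simp add: moebius_def)
next
  case False
  then obtain p where p: "prime p" "p dvd m" using prime_factor_nat by blast
  define D where "D = {e. e dvd m \<and> squarefree e \<and> \<not> p dvd e}"
  have fin: "finite {e. e dvd m}" using assms by (intro finite_divisors_nat) simp
  have finD: "finite D" unfolding D_def by (rule finite_subset[OF _ fin]) auto
  have p0: "p \<noteq> 0" using p(1) by auto
  have sub: "D \<union> (*) p ` D \<subseteq> {e. e dvd m}"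
  proof -
    have "p * e dvd m" if "e \<in> D" for e
      using that p prime_imp_coprime[OF p(1), of e] unfolding D_def by (intro divides_mult) auto
    then show ?thesis unfolding D_def by auto
  qed
  have "moebius e = 0" if "e \<in> {e. e dvd m} - (D \<union> (*) p ` D)" for e
  proof (rule ccontr)
    assume "moebius e \<noteq> 0"
    then have sf: "squarefree e" unfolding moebius_def by (simp split: if_splits)
    have em: "e dvd m" "e \<notin> D" "e \<notin> (*) p ` D" using that by auto
    then have "p dvd e" using sf unfolding D_def by blast
    then obtain f where f: "e = p * f" by (rule dvdE)
    have "\<not> p dvd f"
    proof
      assume "p dvd f"
      then have "p ^ 2 dvd e" unfolding f power2_eq_square by (rule mult_dvd_mono[OF dvd_refl])
      then show False using squarefreeD[OF sf] p(1) by (metis not_prime_unit)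
    qed
    moreover have "squarefree f" using sf unfolding f by (rule squarefree_mono[rotated]) simp
    moreover have "f dvd m" using em(1) unfolding f by (rule dvd_mult_right)
    ultimately have "f \<in> D" unfolding D_def by blast
    then show False using em(3) f by blast
  qed
  then have "(\<Sum>e | e dvd m. moebius e) = (\<Sum>e\<in>D \<union> (*) p ` D. moebius e)"
    by (intro sum.mono_neutral_right[OF fin sub]) blast
  also have "\<dots> = (\<Sum>e\<in>D. moebius e) + (\<Sum>e\<in>(*) p ` D. moebius e)"
    using finD by (intro sum.union_disjoint) (auto simp: D_def)
  also have "(\<Sum>e\<in>(*) p ` D. moebius e) = (\<Sum>e\<in>D. moebius (p * e))"
    using p0 by (subst sum.reindex) (auto intro: inj_onI)
  also have "\<dots> = (\<Sum>e\<in>D. - moebius e)"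
    by (intro sum.cong refl) (use moebius_prime_mult[OF p(1)] in \<open>auto simp: D_def\<close>)
  finally show ?thesis using False by (simp add: sum_negf)
qed

text \<open>Moebius inversion for the indicator of the multiples of \<open>d\<close>; it yields the
  order of the rational function at a point of minimal period \<open>d\<close>.\<close>

lemma sum_moebius_multiples:
  assumes n: "n \<ge> 1" and d: "d \<ge> 1"
  shows "(\<Sum>k | k dvd n. moebius (n div k) * (if d dvd k then 1 else 0)) = (if n = d then 1 else 0)"
proof (cases "d dvd n")
  case False
  then have "\<not> d dvd k" if "k dvd n" for k using that dvd_trans by blast
  then have "(\<Sum>k | k dvd n. moebius (n div k) * (if d dvd k then 1 else 0)) = 0"
    by (intro sum.neutral) auto
  moreover have "n \<noteq> d" using False by auto
  ultimately show ?thesis by simp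
next
  case True
  then obtain m where m: "n = d * m" by (rule dvdE)
  have m1: "m \<ge> 1" using n m by (cases m) auto
  have "(\<Sum>k | k dvd n. moebius (n div k) * (if d dvd k then 1 else 0)) = (\<Sum>k\<in>{k. k dvd n \<and> d dvd k}. moebius (n div k))"
    using n by (intro sum.mono_neutral_cong_right) (auto intro: finite_divisors_nat)
  also have "\<dots> = (\<Sum>e | e dvd m. moebius e)"
  proof (rule sum.reindex_bij_witness[of _ "\<lambda>e. n div e" "\<lambda>k. n div k"])
    fix k assume "k \<in> {k. k dvd n \<and> d dvd k}"
    then have k: "k dvd n" "d dvd k" by simp_all
    obtain l where "k = d * l" using k(2) by (rule dvdE)
    then have l: "k = d * l" "k dvd n" using k(1) by simp_all
    then have lm: "l dvd m" using m d by simp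
    show "n div (n div k) = k" using l(2) n by (simp add: div_div_eq_right)
    have "n div k = m div l" using l(1) m d by simp
    moreover have "m = m div l * l" using lm by simp
    then have "m div l dvd m" by (rule dvdI)
    ultimately show "n div k \<in> {e. e dvd m}" by simp
  next
    fix e assume "e \<in> {e. e dvd m}"
    then have e: "e dvd m" by simp
    then have en: "e dvd n" unfolding m by (rule dvd_mult)
    show "n div (n div e) = e" using en n by (simp add: div_div_eq_right)
    have "n div e = d * (m div e)" unfolding m using e by (rule div_mult_swap[symmetric])
    then have "d dvd n div e" by simp
    moreover have "n = n div e * e" using en by simp
    then have "n div e dvd n" by (rule dvdI)
    ultimately show "n div e \<in> {k. k dvd n \<and> d dvd k}" by blast
  qed simp
  also have "\<dots> = (if m = 1 then 1 else 0)" by (rule sum_moebius[OF m1])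
  also have "m = 1 \<longleftrightarrow> n = d" using m d by simp
  finally show ?thesis .
qed

text \<open>Numerator and denominator before cancellation. They may share roots, so vanishing is
  read off from the difference of the orders.\<close>

definition P_num :: "nat \<Rightarrow> int poly" where
  "P_num n = (\<Prod>k | k dvd n \<and> moebius (n div k) = 1. R_diag k)"

definition P_den :: "nat \<Rightarrow> int poly" where
  "P_den n = (\<Prod>k | k dvd n \<and> moebius (n div k) = - 1. R_diag k)"

lemma moebius_cases: "moebius n = 1 \<or> moebius n = 0 \<or> moebius n = - 1"
  unfolding moebius_def by (cases "even (card (prime_factors n))") auto

lemma P_fun_eq: "n \<ge> 1 \<Longrightarrow> P_fun n = Fract (P_num n) (P_den n)"
proof -
  assume n: "n \<ge> 1"
  have fin: "finite {k. k dvd n}" using n by (intro finite_divisors_nat) simp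
  let ?f = "\<lambda>e k. if moebius (n div k) = e then to_fract (R_diag k) else 1"
  have "P_fun n = (\<Prod>k | k dvd n. ?f 1 k / ?f (- 1) k)"
    unfolding P_fun_def
  proof (intro prod.cong refl)
    fix k
    show "Fract (R_diag k) 1 powi moebius (n div k) = ?f 1 k / ?f (- 1) k"
      using moebius_cases[of "n div k"] unfolding to_fract_def[symmetric]
      by (elim disjE) (simp_all add: power_int_minus inverse_eq_divide)
  qed
  also have "\<dots> = (\<Prod>k | k dvd n. ?f 1 k) / (\<Prod>k | k dvd n. ?f (- 1) k)"
    by (rule prod_dividef)
  finally have P: "P_fun n = (\<Prod>k | k dvd n. ?f 1 k) / (\<Prod>k | k dvd n. ?f (- 1) k)" .
  have prod: "(\<Prod>k | k dvd n. ?f e k) = to_fract (\<Prod>k | k dvd n \<and> moebius (n div k) = e. R_diag k)" for e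
  proof -
    have "(\<Prod>k | k dvd n. ?f e k) = (\<Prod>k\<in>{k \<in> {k. k dvd n}. moebius (n div k) = e}. to_fract (R_diag k))"
      by (rule prod.inter_filter[symmetric, OF fin])
    then show ?thesis by (simp add: to_fract_hom.hom_prod)
  qed
  show ?thesis unfolding P prod P_num_def P_den_def by (simp only: Fract_conv_to_fract)
qed

lemma R_diag_prod_neq_0:
  assumes "n \<ge> 1"
  shows "P_num n \<noteq> 0" "P_den n \<noteq> 0"
proof -
  have k: "k \<ge> 1" if "k dvd n" for k using that assms by (cases k) auto
  have fin: "finite {k. k dvd n}" using assms by (intro finite_divisors_nat) simp
  have "finite {k. k dvd n \<and> Q k}" for Q by (rule finite_subset[OF _ fin]) auto
  then show "P_num n \<noteq> 0" "P_den n \<noteq> 0"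
    unfolding P_num_def P_den_def using R_diag_neq_0 k by (simp_all add: prod_zero_iff)
qed

lemma of_int_poly_qbar5_neq_0: "p \<noteq> 0 \<Longrightarrow> (of_int_poly p :: qbar5 poly) \<noteq> 0"
  by (simp add: poly_eq_iff coeff_map_poly)

lemma order_prod_of_int_poly:
  assumes "finite A" "\<And>k. k \<in> A \<Longrightarrow> f k \<noteq> 0"
  shows "order a (of_int_poly (\<Prod>k\<in>A. f k) :: qbar5 poly) = (\<Sum>k\<in>A. order a (of_int_poly (f k)))"
  using assms
proof (induction A rule: finite_induct)
  case empty
  show ?case by (simp add: order_0I)
next
  case (insert k A)
  have "f k * (\<Prod>k\<in>A. f k) \<noteq> 0" using insert by (simp add: prod_zero_iff)
  then have "(of_int_poly (f k) * of_int_poly (\<Prod>k\<in>A. f k) :: qbar5 poly) \<noteq> 0"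
    using of_int_poly_qbar5_neq_0 of_int_poly_hom.hom_mult by metis
  from order_mult[OF this, of a] show ?case using insert by (simp add: of_int_poly_hom.hom_mult)
qed

text \<open>Over the algebraic closure the resultant has the value of \<open>q\<close> at the common
  root as a factor, so it vanishes, which contradicts coprimality over the integers.\<close>

lemma coprime_no_common_root:
  fixes p q :: "int poly" and a :: qbar5
  assumes "coprime p q" "p \<noteq> 0" "poly (of_int_poly p) a = 0" "poly (of_int_poly q) a = 0"
  shows False
proof -
  let ?p = "of_int_poly p :: qbar5 poly" and ?q = "of_int_poly q :: qbar5 poly"
  interpret i: inj_comm_ring_hom "of_int :: int \<Rightarrow> qbar5" by (rule inj_of_int_qbar5)
  have "?p \<noteq> 0" by (rule of_int_poly_qbar5_neq_0[OF assms(2)])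
  from alg_closed_imp_factorization[OF this]
  obtain rs where rs: "size rs = degree ?p" "?p = smult (lead_coeff ?p) (\<Prod>r\<in>#rs. [:- r, 1:])"
    by (elim exE conjE)
  have pr: "poly ?p a = lead_coeff ?p * (\<Prod>x\<in>#rs. a - x)"
    by (subst rs(2)) (simp add: poly_prod_mset multiset.map_comp o_def)
  have "lead_coeff ?p \<noteq> 0" using \<open>?p \<noteq> 0\<close> by simp
  then have "(\<Prod>x\<in>#rs. a - x) = 0" using pr assms(3) by simp
  then have a: "a \<in># rs" by (auto simp: prod_mset_zero_iff)
  have "of_int (resultant p q) = resultant ?p ?q" by (rule i.resultant_hom[symmetric])
  also have "\<dots> = resultant_sub (size rs) (degree ?q) (smult (lead_coeff ?p) (\<Prod>r\<in>#rs. [:- r, 1:])) ?q"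
    by (simp only: resultant_sub rs(1) rs(2)[symmetric])
  also have "\<dots> = lead_coeff ?p ^ degree ?q * (\<Prod>r\<in>#rs. poly ?q r)"
    by (rule resultant_sub_linear_factors) simp
  also have "(\<Prod>r\<in>#rs. poly ?q r) = 0" using a assms(4) by (auto simp: prod_mset_zero_iff)
  finally have "resultant p q = 0" by simp
  then have "degree (gcd p q) \<noteq> 0" by (simp only: resultant_0_gcd simp_thms)
  then show False using assms(1) by (simp add: coprime_iff_gcd_eq_1)
qed

context sqrt5
begin

text \<open>The roots of each \<open>R_diag k\<close> are simple, so at a periodic point the orders
  are indicators of the minimal period dividing \<open>k\<close>.\<close>

lemma order_P_fun:
  assumes n: "n \<ge> 1"
  shows "int (order a (of_int_poly (P_num n))) - int (order a (of_int_poly (P_den n))) =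
    (if a \<in> points_of_period n then 1 else 0)"
proof -
  have k: "k \<ge> 1" if "k dvd n" for k using that n by (cases k) auto
  have fin: "finite {k. k dvd n}" using n by (intro finite_divisors_nat) simp
  let ?o = "\<lambda>k. if on_cycle k a then 1 else 0 :: int"
  have ord: "int (order a (of_int_poly (\<Prod>k | k dvd n \<and> moebius (n div k) = e. R_diag k))) =
      (\<Sum>k | k dvd n. if moebius (n div k) = e then ?o k else 0)" for e
  proof -
    have fin': "finite {k. k dvd n \<and> moebius (n div k) = e}" by (rule finite_subset[OF _ fin]) auto
    have "order a (of_int_poly (\<Prod>k | k dvd n \<and> moebius (n div k) = e. R_diag k)) =
        (\<Sum>k | k dvd n \<and> moebius (n div k) = e. order a (of_int_poly (R_diag k)))"
      by (rule order_prod_of_int_poly[OF fin']) (use R_diag_neq_0 k in blast)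
    also have "int \<dots> = (\<Sum>k | k dvd n \<and> moebius (n div k) = e. ?o k)"
      unfolding of_nat_sum by (intro sum.cong refl) (use k in \<open>simp add: order_R_diag\<close>)
    also have "\<dots> = (\<Sum>k | k dvd n. if moebius (n div k) = e then ?o k else 0)"
      using sum.inter_filter[OF fin, of ?o "\<lambda>k. moebius (n div k) = e"] by simp
    finally show ?thesis .
  qed
  have "int (order a (of_int_poly (P_num n))) - int (order a (of_int_poly (P_den n))) =
      (\<Sum>k | k dvd n. (if moebius (n div k) = 1 then ?o k else 0) - (if moebius (n div k) = - 1 then ?o k else 0))"
    unfolding P_num_def P_den_def ord sum_subtractf ..
  also have "\<dots> = (\<Sum>k | k dvd n. moebius (n div k) * ?o k)"
  proof (intro sum.cong refl)
    fix k
    show "(if moebius (n div k) = 1 then ?o k else 0) - (if moebius (n div k) = - 1 then ?o k else 0) = moebius (n div k) * ?o k"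
      using moebius_cases[of "n div k"] by (elim disjE) simp_all
  qed
  also have "\<dots> = (if a \<in> points_of_period n then 1 else 0)"
  proof (cases "periodic_point a")
    case False
    then have "\<not> on_cycle k a" if "k \<ge> 1" for k using that unfolding periodic_point_def by blast
    then have "(\<Sum>k | k dvd n. moebius (n div k) * ?o k) = 0" using k by (intro sum.neutral) simp
    then show ?thesis using False unfolding points_of_period_def by simp
  next
    case True
    have "(\<Sum>k | k dvd n. moebius (n div k) * ?o k) =
        (\<Sum>k | k dvd n. moebius (n div k) * (if minimal_period a dvd k then 1 else 0))"
      by (intro sum.cong refl) (use k minimal_period(3)[OF True] in simp)
    also have "\<dots> = (if n = minimal_period a then 1 else 0)"
      by (rule sum_moebius_multiples[OF n minimal_period(1)[OF True]])
    finally show ?thesis using True unfolding points_of_period_def by (simp add: eq_commute)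
  qed
  finally show ?thesis .
qed

text \<open>The difference of the orders does not depend on the fraction chosen. A fraction in
  lowest terms turns a positive difference into a root at which the denominator does not
  vanish.\<close>

lemma points_of_period_eq_roots:
  assumes n: "n \<ge> 1"
  shows "points_of_period n = rational_function_roots (P_fun n)"
proof -
  note nz = R_diag_prod_neq_0[OF n]
  have ord: "int (order a (of_int_poly p)) - int (order a (of_int_poly q)) = (if a \<in> points_of_period n then 1 else 0)"
    if pq: "P_fun n = Fract p q" "q \<noteq> 0" for a and p q :: "int poly"
  proof -
    have "Fract (P_num n) (P_den n) = Fract p q" using P_fun_eq[OF n] pq(1) by simp
    then have eq: "P_num n * q = p * P_den n" using nz pq(2) by (simp add: eq_fract)
    have nz1: "(of_int_poly (P_num n) * of_int_poly q :: qbar5 poly) \<noteq> 0"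
      using of_int_poly_qbar5_neq_0[OF nz(1)] of_int_poly_qbar5_neq_0[OF pq(2)] by simp
    have eq': "(of_int_poly (P_num n) * of_int_poly q :: qbar5 poly) = of_int_poly p * of_int_poly (P_den n)"
      using eq of_int_poly_hom.hom_mult by metis
    have "order a (of_int_poly (P_num n)) + order a (of_int_poly q) = order a (of_int_poly p) + order a (of_int_poly (P_den n))"
      using order_mult[OF nz1, of a] nz1 order_mult[of "of_int_poly p" "of_int_poly (P_den n)" a] unfolding eq' by simp
    then show ?thesis using order_P_fun[OF n, of a] by linarith
  qed
  show ?thesis
  proof (intro equalityI subsetI)
    fix a assume a: "a \<in> points_of_period n"
    define p where "p = fst (quot_of_fract (P_fun n))"
    define q where "q = snd (quot_of_fract (P_fun n))"
    have pq: "P_fun n = Fract p q"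
      using quot_to_fract_quot_of_fract[of "P_fun n"] unfolding quot_to_fract_def p_def q_def
      by (simp add: case_prod_unfold)
    have q0: "q \<noteq> 0" unfolding q_def by simp
    have cop: "coprime p q" unfolding p_def q_def by (rule coprime_quot_of_fract)
    have "order a (of_int_poly p :: qbar5 poly) \<noteq> 0" using ord[OF pq q0, of a] a by simp
    then have pa: "poly (of_int_poly p) a = 0" using order_0I[of "of_int_poly p" a] by metis
    have "P_fun n \<noteq> 0" using P_fun_eq[OF n] nz by (simp add: Zero_fract_def eq_fract)
    then have p0: "p \<noteq> 0" using pq q0 by (auto simp: Zero_fract_def eq_fract)
    have "poly (of_int_poly q) a \<noteq> 0" using coprime_no_common_root[OF cop p0 pa] by blast
    then show "a \<in> rational_function_roots (P_fun n)"
      unfolding rational_function_roots_def using pq pa by blast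
  next
    fix a assume "a \<in> rational_function_roots (P_fun n)"
    then obtain p q where pq: "P_fun n = Fract p q" "poly (of_int_poly q) a \<noteq> 0" "poly (of_int_poly p) a = 0"
      unfolding rational_function_roots_def by blast
    have q0: "q \<noteq> 0" using pq(2) by auto
    have "P_fun n \<noteq> 0" using P_fun_eq[OF n] nz by (simp add: Zero_fract_def eq_fract)
    then have p0: "p \<noteq> 0" using pq(1) q0 by (auto simp: Zero_fract_def eq_fract)
    have "order a (of_int_poly p) \<noteq> 0" using order_root[of "of_int_poly p" a] pq(3) of_int_poly_qbar5_neq_0[OF p0] by simp
    moreover have "order a (of_int_poly q) = 0" using pq(2) by (rule order_0I)
    ultimately show "a \<in> points_of_period n" using ord[OF pq(1) q0, of a] by (simp split: if_splits)
  qed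
qed

end


section \<open>Degrees and the main theorem\<close>

context sqrt5
begin

definition quad :: "qbar5 set \<Rightarrow> qbar5 set" where
  "quad K = {x. \<exists>u\<in>K. \<exists>v\<in>K. x = u + v * s}"

lemma quadI: "u \<in> K \<Longrightarrow> v \<in> K \<Longrightarrow> u + v * s \<in> quad K"
  unfolding quad_def by blast

lemma quadE:
  assumes "x \<in> quad K"
  obtains u v where "u \<in> K" "v \<in> K" "x = u + v * s"
  using assms unfolding quad_def by blast

text \<open>The inverse is the conjugate over the norm \<open>N\<close>, which is nonzero because
  \<open>s\<close> is not a quotient of elements of \<open>K\<close>.\<close>

lemma subfield_quad:
  assumes K: "subfield K qbar5_ring" and sK: "s \<notin> K"
  shows "subfield (quad K) qbar5_ring"
proof (rule subfield_setI)
  note R = is_subringD[OF subfield_setD(1)[OF K]]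
  show "is_subring (quad K)"
    unfolding is_subring_def
  proof (intro conjI ballI)
    show "1 \<in> quad K" using quadI[OF R(1) R(2)] by simp
    fix x y assume "x \<in> quad K" "y \<in> quad K"
    then obtain u v u' v' where uv: "u \<in> K" "v \<in> K" "x = u + v * s" "u' \<in> K" "v' \<in> K" "y = u' + v' * s"
      by (elim quadE)
    have "x - y = (u - u') + (v - v') * s" unfolding uv by (simp add: algebra_simps)
    then show "x - y \<in> quad K" using quadI[OF R(3)[OF uv(1,4)] R(3)[OF uv(2,5)]] by simp
    have "x * y = u * u' + v * v' * (s * s) + (u * v' + v * u') * s" unfolding uv by (simp add: algebra_simps)
    then have "x * y = (u * u' + v * v' * 5) + (u * v' + v * u') * s" by (simp only: ss)
    moreover have "u * u' + v * v' * 5 \<in> K" using uv by (intro R(6) R(4) R(10))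
    moreover have "u * v' + v * u' \<in> K" using uv by (intro R(6) R(4))
    ultimately show "x * y \<in> quad K" using quadI by metis
  qed
  fix x assume x: "x \<in> quad K" "x \<noteq> 0"
  obtain u v where uv: "u \<in> K" "v \<in> K" "x = u + v * s" using x(1) by (rule quadE)
  define N where "N = u * u - v * v * 5"
  have NK: "N \<in> K" unfolding N_def using uv by (intro R(3) R(4) R(10))
  have "x * (u - v * s) = u * u - v * v * (s * s)" unfolding uv(3) by (simp add: algebra_simps)
  then have xN: "x * (u - v * s) = N" unfolding N_def ss .
  have "N \<noteq> 0"
  proof
    assume "N = 0"
    then have 0: "u - v * s = 0" using xN x(2) by simp
    show False
    proof (cases "v = 0")
      case True
      then have "x = 0" using 0 uv(3) by simp
      then show False using x(2) by simp
    next
      case False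
      have "u = v * s" using 0 by simp
      then have "u * inverse v = s" using False by (simp add: mult.commute mult.left_commute)
      moreover have "u * inverse v \<in> K" using R(4)[OF uv(1) subfield_setD(2)[OF K uv(2)]] .
      ultimately show False using sK by simp
    qed
  qed
  have "x * ((u - v * s) * inverse N) = 1"
    unfolding mult.assoc[symmetric] xN using \<open>N \<noteq> 0\<close> by simp
  then have "inverse x = (u - v * s) * inverse N" by (rule inverse_unique)
  also have "\<dots> = u * inverse N + (- v * inverse N) * s" by (simp add: algebra_simps)
  finally show "inverse x \<in> quad K"
    using quadI[OF R(4)[OF uv(1) subfield_setD(2)[OF K NK]] R(4)[OF R(5)[OF uv(2)] subfield_setD(2)[OF K NK]]] by simp
qed

lemma field_adjoin_eq_quad:
  assumes K: "subfield K qbar5_ring" and sK: "s \<notin> K"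
  shows "field_adjoin K s = quad K"
proof
  note R = is_subringD[OF subfield_setD(1)[OF K]]
  show "field_adjoin K s \<subseteq> quad K"
  proof (rule field_adjoin_subset[OF subfield_quad[OF K sK]])
    show "K \<subseteq> quad K"
    proof
      fix x assume "x \<in> K"
      then show "x \<in> quad K" using quadI[OF _ R(2), of x] by simp
    qed
    show "s \<in> quad K" using quadI[OF R(2) R(1)] by simp
  qed
  note F = is_subringD[OF subfield_setD(1)[OF subfield_adjoin(1)[of K s]]]
  show "quad K \<subseteq> field_adjoin K s"
  proof
    fix x assume "x \<in> quad K"
    then obtain u v where uv: "u \<in> K" "v \<in> K" "x = u + v * s" by (rule quadE)
    have "u \<in> field_adjoin K s" "v \<in> field_adjoin K s" using uv subfield_adjoin(2) by blast+
    then show "x \<in> field_adjoin K s" unfolding uv(3) using subfield_adjoin(3)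
      by (intro F(6) F(4))
  qed
qed

lemma s_notin_Q5: "s \<notin> Q5"
proof -
  obtain \<theta> where "unram_ring 1 \<theta>" using ex_unram_ring[of 1] by auto
  then interpret U: unram_ring 1 \<theta> .
  show ?thesis using U.Q5_subset_L U.L_subset_K5 s_notin_K5 by blast
qed

lemma T_closed:
  assumes "subfield G qbar5_ring" "s \<in> G" "x \<in> G"
  shows "T x \<in> G"
proof -
  note R = is_subringD[OF subfield_setD(1)[OF assms(1)]]
  have "T_num s x \<in> G" unfolding T_num_def using assms(2,3) by (intro R(3) R(10) R(4) R(6) R(1))
  moreover have "T_den s x \<in> G" unfolding T_den_def using assms(2,3) by (intro R(10) R(4) R(6) R(1))
  ultimately show ?thesis unfolding T_def using subfield_setD(2)[OF assms(1)] by (intro R(4))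
qed

lemma tau_closed:
  assumes "subfield G qbar5_ring" "s \<in> G"
  shows "tau \<in> G"
proof -
  note R = is_subringD[OF subfield_setD(1)[OF assms(1)]]
  have "inverse 2 \<in> G" using subfield_setD(2)[OF assms(1) R(10)] .
  then show ?thesis unfolding tau_def using assms(2) by (intro R(4) R(5) R(6) R(1))
qed

section \<open>Degrees over the field of 5-adic numbers with a square root of 5 adjoined\<close>

abbreviation F :: "qbar5 set" where "F \<equiv> field_adjoin Q5 s"

lemma F_eq: "F = quad Q5"
  by (rule field_adjoin_eq_quad[OF subfield_Q5 s_notin_Q5])

text \<open>Splitting the coefficients as u + v s turns a relation into P + Q s = 0 with P and Q in
  \<open>U.L\<close>. As \<open>s\<close> lies outside \<open>U.L\<close>, both vanish, and
  independence over \<open>Q5\<close> applies to each.\<close>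

lemma independent_over_F:
  assumes U: "unram_ring n \<theta>"
    and a: "a \<in> unram_ring.B n \<theta>" "\<And>d. 1 \<le> d \<Longrightarrow> d < n \<Longrightarrow> red a \<notin> Fq d"
  shows "Qb.independent F (map (\<lambda>i. a ^ i) [0..<n])"
proof (rule independent_powers[OF subfield_adjoin(1)])
  interpret U: unram_ring n \<theta> by fact
  note L = is_subringD[OF U.is_subring_L]
  fix c i assume c: "\<forall>i. c i \<in> F" "(\<Sum>i<n. c i * a ^ i) = 0" and i: "i < n"
  have "\<forall>i. \<exists>u v. u \<in> Q5 \<and> v \<in> Q5 \<and> c i = u + v * s"
    using c(1) unfolding F_eq quad_def by blast
  then obtain u v where uv: "\<And>i. u i \<in> Q5" "\<And>i. v i \<in> Q5" "\<And>i. c i = u i + v i * s" by metis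
  define P where "P = (\<Sum>i<n. u i * a ^ i)"
  define Q where "Q = (\<Sum>i<n. v i * a ^ i)"
  have aL: "a ^ i \<in> U.L" for i using U.B_subset_L[OF U.B_ring(7)[OF a(1)]] .
  have PL: "P \<in> U.L" unfolding P_def
    using uv(1) U.Q5_subset_L aL by (intro is_subring_sum[OF U.is_subring_L] L(4)) blast+
  have QL: "Q \<in> U.L" unfolding Q_def
    using uv(2) U.Q5_subset_L aL by (intro is_subring_sum[OF U.is_subring_L] L(4)) blast+
  have "P + Q * s = (\<Sum>i<n. c i * a ^ i)"
    unfolding P_def Q_def uv(3) sum_distrib_right sum.distrib[symmetric]
    by (intro sum.cong refl) (simp add: distrib_right mult.assoc mult.commute[of s])
  then have PQ: "P + Q * s = 0" using c(2) by simp
  have "Q = 0"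
  proof (rule ccontr)
    assume Q: "Q \<noteq> 0"
    have "Q * s = - P" using PQ by (simp add: eq_neg_iff_add_eq_0 add.commute)
    then have "inverse Q * (Q * s) = inverse Q * - P" by simp
    then have "s = inverse Q * - P" using Q by (simp add: mult.assoc[symmetric])
    moreover have "inverse Q * - P \<in> U.L" using U.inverse_in_L[OF QL] L(5)[OF PL] by (rule L(4))
    ultimately show False using U.L_subset_K5 s_notin_K5 by auto
  qed
  moreover have "P = 0" using PQ \<open>Q = 0\<close> by simp
  moreover have ind: "w i = 0" if w: "\<And>i. w i \<in> Q5" "(\<Sum>i<n. w i * a ^ i) = 0" for w
    by (rule Q5_independent_powers[where c = w and \<theta> = a, OF U.n U.B_subset_V5[OF a(1)] _ w i]) (rule a(2))
  ultimately have "u i = 0" "v i = 0" using ind[of u, OF uv(1)] ind[of v, OF uv(2)] unfolding P_def Q_def by blast+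
  then show "c i = 0" using uv(3) by simp
qed

lemma quad_L_span:
  assumes U: "unram_ring n \<theta>"
  shows "Qb.Span F (map (\<lambda>i. \<theta> ^ i) [0..<n]) = quad (unram_ring.L n \<theta>)"
proof -
  interpret U: unram_ring n \<theta> by fact
  have sL: "s \<notin> U.L" using U.L_subset_K5 s_notin_K5 by blast
  note E = is_subringD[OF subfield_setD(1)[OF subfield_quad[OF U.subfield_L sL]]]
  note sumE = is_subring_sum[OF subfield_setD(1)[OF subfield_quad[OF U.subfield_L sL]]]
  have FE: "x \<in> quad U.L" if "x \<in> F" for x
    using that U.Q5_subset_L unfolding F_eq quad_def by blast
  have LE: "x \<in> quad U.L" if "x \<in> U.L" for x
    using quadI[OF that is_subringD(2)[OF U.is_subring_L]] by simp
  show ?thesis unfolding Span_powers[OF subfield_adjoin(1)]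
  proof (intro equalityI subsetI)
    fix x assume "x \<in> {x. \<exists>c. (\<forall>i. c i \<in> F) \<and> x = (\<Sum>i<n. c i * \<theta> ^ i)}"
    then obtain c where c: "\<forall>i. c i \<in> F" "x = (\<Sum>i<n. c i * \<theta> ^ i)" by blast
    show "x \<in> quad U.L" unfolding c(2)
      using c(1) FE LE[OF U.B_subset_L[OF U.theta_in_B]] by (intro sumE E(4) E(7)) blast+
  next
    fix x assume "x \<in> quad U.L"
    then obtain u v where uv: "u \<in> U.L" "v \<in> U.L" "x = u + v * s" by (rule quadE)
    obtain p where p: "\<forall>i. p i \<in> Q5" "u = (\<Sum>i<n. p i * \<theta> ^ i)" using uv(1) unfolding U.L_eq_span by blast
    obtain q where q: "\<forall>i. q i \<in> Q5" "v = (\<Sum>i<n. q i * \<theta> ^ i)" using uv(2) unfolding U.L_eq_span by blast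
    have "x = (\<Sum>i<n. (p i + q i * s) * \<theta> ^ i)"
      unfolding uv(3) p(2) q(2) sum_distrib_right sum.distrib[symmetric]
      by (intro sum.cong refl) (simp add: distrib_right mult.assoc mult.commute[of s])
    moreover have "\<forall>i. p i + q i * s \<in> F" unfolding F_eq using p(1) q(1) quadI by blast
    ultimately show "x \<in> {x. \<exists>c. (\<forall>i. c i \<in> F) \<and> x = (\<Sum>i<n. c i * \<theta> ^ i)}"
      by (intro CollectI exI[of _ "\<lambda>i. p i + q i * s"] conjI)
  qed
qed

text \<open>The first n powers of \<open>a\<close> are independent in the n-dimensional space
  \<open>quad U.L\<close>, hence span it; so this space is the field generated by
  \<open>a\<close>.\<close>

lemma has_degree_S:
  assumes U: "unram_ring n \<theta>"
    and a: "a \<in> unram_ring.B n \<theta>" "\<And>d. 1 \<le> d \<Longrightarrow> d < n \<Longrightarrow> red a \<notin> Fq d"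
  shows "has_degree_over F a n"
proof -
  interpret U: unram_ring n \<theta> by fact
  let ?E = "quad U.L"
  have sL: "s \<notin> U.L" using U.L_subset_K5 s_notin_K5 by blast
  have sfE: "subfield ?E qbar5_ring" by (rule subfield_quad[OF U.subfield_L sL])
  have dimE: "Qb.dimension n F ?E"
    using Qb.dimension_independent[OF independent_over_F[OF U U.theta_in_B U.theta_exact]]
    unfolding quad_L_span[OF U] by simp
  have aE: "a \<in> ?E" using quadI[OF U.B_subset_L[OF a(1)] is_subringD(2)[OF U.is_subring_L]] by simp
  have FE: "F \<subseteq> ?E" using U.Q5_subset_L unfolding F_eq quad_def by blast
  have sub: "set (map (\<lambda>i. a ^ i) [0..<n]) \<subseteq> ?E"
    using is_subringD(7)[OF subfield_setD(1)[OF sfE] aE] by auto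
  have span: "Qb.Span F (map (\<lambda>i. a ^ i) [0..<n]) = ?E"
    using Qb.independent_length_eq_dimension[OF subfield_adjoin(1) dimE independent_over_F[OF U a] sub] by simp
  have "field_adjoin F a = ?E"
  proof
    show "field_adjoin F a \<subseteq> ?E" by (rule field_adjoin_subset[OF sfE FE aE])
    note G = is_subringD[OF subfield_setD(1)[OF subfield_adjoin(1)[of F a]]]
    show "?E \<subseteq> field_adjoin F a"
    proof
      fix x assume "x \<in> ?E"
      then obtain c where c: "\<forall>i. c i \<in> F" "x = (\<Sum>i<n. c i * a ^ i)"
        unfolding span[symmetric] Span_powers[OF subfield_adjoin(1)] by blast
      show "x \<in> field_adjoin F a" unfolding c(2)
        using c(1) subfield_adjoin(2)[of F a] subfield_adjoin(3)[of a F]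
        by (intro is_subring_sum[OF subfield_setD(1)[OF subfield_adjoin(1)]] G(4) G(7)) blast+
    qed
  qed
  then show ?thesis unfolding has_degree_over_def using dimE by simp
qed

lemma field_adjoin_T:
  assumes "a \<noteq> tau"
  shows "field_adjoin F (T a) = field_adjoin F a"
proof -
  have sF: "s \<in> field_adjoin F x" for x using subfield_adjoin(2,3) by blast
  have "field_adjoin F (T b) \<subseteq> field_adjoin F b" for b
    by (rule field_adjoin_subset[OF subfield_adjoin(1,2) T_closed[OF subfield_adjoin(1) sF subfield_adjoin(3)]])
  from this[of a] this[of "T a"] show ?thesis unfolding T_T[OF assms] by blast
qed

lemma has_degree_points_of_period:
  assumes n: "n \<ge> 1" and a: "a \<in> points_of_period n"
  shows "has_degree_over F a n"
proof -
  have per: "periodic_point a" "minimal_period a = n" using a unfolding points_of_period_def by simp_all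
  have cyc: "on_cycle n a" using minimal_period(2)[OF per(1)] per(2) by simp
  have no: "\<not> on_cycle d a" if "1 \<le> d" "d < n" for d
    using minimal_period(3)[OF per(1) that(1)] that per(2) by (auto dest: dvd_imp_le)
  obtain \<theta> where U: "unram_ring n \<theta>" using ex_unram_ring[OF n] by blast
  interpret U: unram_ring n \<theta> by fact
  have S: "has_degree_over F b n" if b: "b \<in> U.S" and nb: "\<And>d. 1 \<le> d \<Longrightarrow> d < n \<Longrightarrow> \<not> on_cycle d b" for b
  proof (rule has_degree_S[OF U])
    show "b \<in> U.B" using b unfolding U.S_def by blast
    show "red b \<notin> Fq d" if "1 \<le> d" "d < n" for d
      using nb[OF that] U.S_on_cycle_iff[OF b that(1)] by blast
  qed
  show ?thesis
  proof (cases rule: on_cycle_cases[OF U cyc])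
    case 1
    then show ?thesis using S no by blast
  next
    case (2 b)
    have "has_degree_over F b n"
    proof (rule S[OF 2(1)])
      fix d assume "1 \<le> d" "d < n"
      then show "\<not> on_cycle d b" using no[of d] unfolding 2(3) on_cycle_T_iff[OF 2(2)] by blast
    qed
    then show ?thesis unfolding has_degree_over_def 2(3) field_adjoin_T[OF 2(2)] .
  next
    case 3
    have "n = 1" using minimal_period(3)[OF per(1), of 1] on_cycle_tau 3 per(2) by simp
    have sF: "s \<in> F" by (rule subfield_adjoin(3))
    have "field_adjoin F tau = F"
      using field_adjoin_subset[OF subfield_adjoin(1) order.refl tau_closed[OF subfield_adjoin(1) sF]]
        subfield_adjoin(2)[of F tau] by blast
    then show ?thesis unfolding has_degree_over_def 3 \<open>n = 1\<close>
      using Qb.dimension_one[OF subfield_adjoin(1)] by simp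
  qed
qed

lemma periodic_in_K5_adjoin:
  assumes "periodic_point a"
  shows "a \<in> field_adjoin K5 s"
proof -
  obtain n where n: "n \<ge> 1" "on_cycle n a" using assms unfolding periodic_point_def by blast
  obtain \<theta> where U: "unram_ring n \<theta>" using ex_unram_ring[OF n(1)] by blast
  interpret U: unram_ring n \<theta> by fact
  have SK: "b \<in> field_adjoin K5 s" if "b \<in> U.S" for b
    using U.S_subset_K5[OF that] subfield_adjoin(2) by blast
  show ?thesis
  proof (cases rule: on_cycle_cases[OF U n(2)])
    case 1
    then show ?thesis by (rule SK)
  next
    case (2 b)
    show ?thesis unfolding 2(3) by (rule T_closed[OF subfield_adjoin(1,3) SK[OF 2(1)]])
  next
    case 3
    show ?thesis unfolding 3 by (rule tau_closed[OF subfield_adjoin(1,3)])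
  qed
qed

lemma points_of_period_T_iff:
  assumes "b \<noteq> tau"
  shows "T b \<in> points_of_period n \<longleftrightarrow> b \<in> points_of_period n"
  unfolding points_of_period_def periodic_point_def minimal_period_def
  by (simp add: on_cycle_T_iff[OF assms])

text \<open>For n > 1 the fixed points drop out, in particular \<open>tau\<close> and the square
  roots of -1. What remains consists of pairs \<open>b\<close>, \<open>T b\<close> with
  \<open>b\<close> in \<open>U.S\<close>, and \<open>T b\<close> in \<open>K5\<close> would force
  b^2 = -1.\<close>

lemma half_in_K5:
  assumes n: "n > 1"
  shows "finite (points_of_period n)"
    and "2 * card (points_of_period n \<inter> K5) = card (points_of_period n)"
proof -
  let ?P = "points_of_period n"
  have n1: "n \<ge> 1" using n by simp
  obtain \<theta> where U: "unram_ring n \<theta>" using ex_unram_ring[OF n1] by blast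
  interpret U: unram_ring n \<theta> by fact
  have cyc: "on_cycle n a" if "a \<in> ?P" for a
    using that minimal_period(2)[of a] unfolding points_of_period_def by auto
  then have "?P \<subseteq> {a. on_cycle n a}" by blast
  then show fin: "finite ?P" using on_cycle_set(2)[OF U] by (rule finite_subset)
  have not1: "\<not> on_cycle 1 a" if "a \<in> ?P" for a
    using that minimal_period(3)[of a 1] n unfolding points_of_period_def by simp
  have tau: "tau \<notin> ?P" using not1 on_cycle_tau by blast
  define S' where "S' = ?P \<inter> U.S"
  have S'S: "b \<in> U.S" "b \<in> ?P" "b \<noteq> tau" if "b \<in> S'" for b
    using that K5_neq_tau[OF U.S_subset_K5] unfolding S'_def by blast+
  have P_eq: "?P = S' \<union> T ` S'"
  proof (intro equalityI subsetI)
    fix a assume a: "a \<in> ?P"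
    show "a \<in> S' \<union> T ` S'"
    proof (cases rule: on_cycle_cases[OF U cyc[OF a]])
      case 1
      then show ?thesis using a unfolding S'_def by blast
    next
      case (2 b)
      have "b \<in> ?P" using a points_of_period_T_iff[OF 2(2)] unfolding 2(3) by blast
      then show ?thesis using 2 unfolding S'_def by blast
    next
      case 3
      then show ?thesis using a tau by simp
    qed
  next
    fix a assume "a \<in> S' \<union> T ` S'"
    then consider "a \<in> S'" | b where "b \<in> S'" "a = T b" by blast
    then show "a \<in> ?P"
    proof cases
      case 1
      then show ?thesis by (rule S'S(2))
    next
      case 2
      then show ?thesis using points_of_period_T_iff[OF S'S(3)[OF 2(1)]] S'S(2)[OF 2(1)] by simp
    qed
  qed
  have "T b \<notin> K5" if b: "b \<in> S'" for b
  proof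
    assume "T b \<in> K5"
    then have "b ^ 2 = - 1" using T_in_K5(1)[OF U.S_subset_K5[OF S'S(1)[OF b]]] by blast
    then have "g_poly b b = 0" unfolding g_poly_diag by simp
    then show False using on_cycle_fixed not1[OF S'S(2)[OF b]] by blast
  qed
  then have K: "?P \<inter> K5 = S'"
    using P_eq S'S(1) U.S_subset_K5 by blast
  have disj: "S' \<inter> T ` S' = {}" using on_cycle_set(4)[OF U] unfolding S'_def by blast
  have inj: "inj_on T S'" using on_cycle_set(5)[OF U] by (rule inj_on_subset) (simp add: S'_def)
  have finS: "finite S'" using fin unfolding S'_def by simp
  have "card ?P = card S' + card (T ` S')"
    by (subst P_eq) (rule card_Un_disjoint[OF finS finite_imageI[OF finS] disj])
  also have "card (T ` S') = card S'" by (rule card_image[OF inj])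
  finally show "2 * card (?P \<inter> K5) = card ?P" unfolding K by simp
qed

end

theorem theorem2p1:
  fixes s :: qbar5
  assumes "s ^ 2 = 5"
  shows "(\<forall>a. periodic_point a \<longrightarrow> a \<in> field_adjoin K5 s)
    \<and> (\<forall>n\<ge>1. points_of_period n = rational_function_roots (P_fun n)
             \<and> (\<forall>a\<in>points_of_period n. has_degree_over (field_adjoin Q5 s) a n))
    \<and> (\<forall>n>1. finite (points_of_period n)
             \<and> 2 * card (points_of_period n \<inter> K5) = card (points_of_period n))"
proof -
  interpret sqrt5 s by unfold_locales (rule assms)
  show ?thesis
    using periodic_in_K5_adjoin points_of_period_eq_roots has_degree_points_of_period half_in_K5 by blast
qed

end
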